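(* Let $G$ be a countable group of isometries of a separable Gromov hyperbolic space $X$, let $\mu$ be a non-elementary probability distribution on $G$, and let $x_0\in X$ be a basepoint. Then there is a constant $L>0$ such that for almost every sample path we have $$\liminf_{n\to\infty}\frac{d_X(x_0,w_nx_0)}{n} = L > 0.$$ Furthermore, if $\mu$ has finite first moment, then the limit $$\lim_{n\to\infty}\frac{d_X(x_0,w_nx_0)}{n}=L>0$$ exists almost surely. Finally, if the support of $\mu$ is bounded in $X$, then there are constants $c<1$, $K$ and $L>0$ such that $$\mathbb{P}(d_X(x_0,w_nx_0)\le Ln)\le Kc^n$$ for all $n$.
   Context: A Gromov hyperbolic space is a geodesic metric space $X$ (with metric $d_X$) for which there is $\delta\ge 0$ such that in every geodesic triangle each side is contained in a $\delta$-neighbourhood of the other two sides; $X$ is not assumed proper or locally compact. Its Gromov boundary $\partial X$ is the set of equivalence classes of sequences $(x_n)$ in $X$ with $(x_m\cdot x_n)_{x_0}\to\infty$ as $\min\{m,n\}\to\infty$, where $(x\cdot y)_{x_0}=\frac12(d_X(x_0,x)+d_X(x_0,y)-d_X(x,y))$ and $(x_n)\sim(y_n)$ if $(x_n\cdot y_n)_{x_0}\to\infty$. A group of isometries of $X$ is non-elementary if it contains a pair of hyperbolic (loxodromic) isometries with disjoint fixed point sets in $\partial X$. A probability measure $\mu$ on $G$ is non-elementary if the semigroup generated by its support is a non-elementary subgroup of $G$. The measure $\mu$ has finite first moment if $\int_G d_X(x_0,gx_0)\,d\mu(g)<\infty$. The support of $\mu$ is bounded in $X$ if $\{gx_0 :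 \mu(g)>0\}$ is a bounded subset of $X$. The random walk is $w_n=g_1g_2\cdots g_n$, where the $g_i$ are independent identically distributed elements of $G$ with distribution $\mu$; a sample path is the sequence $(w_nx_0)_{n\in\mathbb{N}}$, and $\mathbb{P}$ is the resulting probability on sample paths.
   Formalization: In the first claim the constant L is taken in (0,+∞], since without a moment assumption the liminf can be almost surely infinite; under finite first moment L is proved to be a finite real number. *)

theory Defs
  imports "HOL-Probability.Probability" "HOL-Algebra.Group"
begin

section \<open>Gromov hyperbolic spaces\<close>

text \<open>The space $X$ is the whole type \<open>'a\<close>, an arbitrary metric space.\<close>

definition geodesic_segment :: "'a::metric_space set \<Rightarrow> 'a \<Rightarrow> 'a \<Rightarrow> bool" where
  "geodesic_segment S x y \<longleftrightarrow>
     (\<exists>\<gamma>. \<gamma> 0 = x \<and> \<gamma> (dist x y) = y \<and>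
          (\<forall>s\<in>{0..dist x y}. \<forall>t\<in>{0..dist x y}. dist (\<gamma> s) (\<gamma> t) = \<bar>s - t\<bar>) \<and>
          S = \<gamma> ` {0..dist x y})"

definition geodesic_space :: "'a::metric_space itself \<Rightarrow> bool" where
  "geodesic_space _ \<longleftrightarrow> (\<forall>x y::'a. \<exists>S. geodesic_segment S x y)"

definition geodesic_triangle :: "'a::metric_space set \<Rightarrow> 'a set \<Rightarrow> 'a set \<Rightarrow> bool" where
  "geodesic_triangle A B C \<longleftrightarrow>
     (\<exists>x y z. geodesic_segment A x y \<and> geodesic_segment B y z \<and> geodesic_segment C z x)"

definition in_nbhd :: "real \<Rightarrow> 'a::metric_space set \<Rightarrow> 'a set \<Rightarrow> bool" where
  "in_nbhd \<delta> A B \<longleftrightarrow> (\<forall>p\<in>A. \<exists>q\<in>B. dist p q \<le> \<delta>)"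

definition gromov_hyperbolic :: "'a::metric_space itself \<Rightarrow> bool" where
  "gromov_hyperbolic T \<longleftrightarrow> geodesic_space T \<and>
     (\<exists>\<delta>\<ge>0. \<forall>A B C :: 'a set. geodesic_triangle A B C \<longrightarrow>
        in_nbhd \<delta> A (B \<union> C) \<and> in_nbhd \<delta> B (C \<union> A) \<and> in_nbhd \<delta> C (A \<union> B))"

section \<open>The Gromov boundary\<close>

definition gromov_product :: "'a::metric_space \<Rightarrow> 'a \<Rightarrow> 'a \<Rightarrow> real" where
  "gromov_product x0 x y = (dist x0 x + dist x0 y - dist x y) / 2"

text \<open>Along the product filter, a double sequence converges as $\min\{m,n\}\to\infty$.\<close>

definition gromov_sequences :: "'a::metric_space \<Rightarrow> (nat \<Rightarrow> 'a) set" where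
  "gromov_sequences x0 =
     {x. filterlim (\<lambda>(m, n). gromov_product x0 (x m) (x n)) at_top (sequentially \<times>\<^sub>F sequentially)}"

definition gromov_equiv :: "'a::metric_space \<Rightarrow> ((nat \<Rightarrow> 'a) \<times> (nat \<Rightarrow> 'a)) set" where
  "gromov_equiv x0 =
     {(x, y). x \<in> gromov_sequences x0 \<and> y \<in> gromov_sequences x0 \<and>
              filterlim (\<lambda>n. gromov_product x0 (x n) (y n)) at_top sequentially}"

definition gromov_boundary :: "'a::metric_space \<Rightarrow> (nat \<Rightarrow> 'a) set set" where
  "gromov_boundary x0 = gromov_sequences x0 // gromov_equiv x0"

text \<open>A surjective isometry $g$ acts on $\partial X$ by $g[(x_n)] = [(g x_n)]$. The image of a class
  under \<open>\<lambda>x. g \<circ> x\<close> is again a full class, because $g$ is invertible.\<close>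

definition boundary_fixed_points :: "'a::metric_space \<Rightarrow> ('a \<Rightarrow> 'a) \<Rightarrow> (nat \<Rightarrow> 'a) set set" where
  "boundary_fixed_points x0 g = {\<xi> \<in> gromov_boundary x0. (\<lambda>x. g \<circ> x) ` \<xi> = \<xi>}"

section \<open>Groups of isometries\<close>

definition isom_group :: "('a::metric_space \<Rightarrow> 'a) monoid" where
  "isom_group = \<lparr>carrier = {f. surj f \<and> (\<forall>x y. dist (f x) (f y) = dist x y)},
                 mult = (\<circ>), one = id\<rparr>"

lemma group_isom_group: "group (isom_group :: ('a::metric_space \<Rightarrow> 'a) monoid)"
proof (rule groupI)
  fix f :: "'a \<Rightarrow> 'a" assume f: "f \<in> carrier isom_group"
  have "inj f"
  proof (rule injI)
    fix x y assume "f x = f y"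
    moreover have "dist (f x) (f y) = dist x y" using f by (simp add: isom_group_def)
    ultimately show "x = y" by simp
  qed
  then have "inv_into UNIV f \<circ> f = id" by (simp add: inv_o_cancel)
  moreover have "surj (inv_into UNIV f)" using \<open>inj f\<close> by (rule inj_imp_surj_inv)
  moreover have "dist (inv_into UNIV f x) (inv_into UNIV f y) = dist x y" for x y
  proof -
    have s: "surj f" and d: "\<And>x y. dist (f x) (f y) = dist x y"
      using f by (auto simp: isom_group_def)
    have "dist (inv_into UNIV f x) (inv_into UNIV f y) = dist (f (inv_into UNIV f x)) (f (inv_into UNIV f y))" by (simp only: d)
    then show ?thesis by (simp add: surj_f_inv_f[OF s])
  qed
  ultimately show "\<exists>g\<in>carrier isom_group. g \<otimes>\<^bsub>isom_group\<^esub> f = \<one>\<^bsub>isom_group\<^esub>"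
    by (intro bexI[of _ "inv_into UNIV f"]) (auto simp: isom_group_def)
next
  fix f g :: "'a \<Rightarrow> 'a" assume "f \<in> carrier isom_group" "g \<in> carrier isom_group"
  then show "f \<otimes>\<^bsub>isom_group\<^esub> g \<in> carrier isom_group"
    using comp_surj[of g f] by (simp add: isom_group_def comp_def)
qed (simp_all add: isom_group_def comp_assoc)

text \<open>An isometry is hyperbolic (loxodromic) if its translation length
  $\lim_n d(x_0, g^n x_0)/n$ is positive. The limit always exists by subadditivity and is
  independent of $x_0$.\<close>

definition loxodromic :: "'a::metric_space \<Rightarrow> ('a \<Rightarrow> 'a) \<Rightarrow> bool" where
  "loxodromic x0 g \<longleftrightarrow> g \<in> carrier isom_group \<and>
     (\<exists>\<tau>>0. (\<lambda>n. dist x0 ((g ^^ n) x0) / real n) \<longlonglongrightarrow> \<tau>)"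

definition non_elementary :: "'a::metric_space \<Rightarrow> ('a \<Rightarrow> 'a) set \<Rightarrow> bool" where
  "non_elementary x0 H \<longleftrightarrow>
     (\<exists>g\<in>H. \<exists>h\<in>H. loxodromic x0 g \<and> loxodromic x0 h \<and>
        boundary_fixed_points x0 g \<inter> boundary_fixed_points x0 h = {})"

section \<open>Measures on the group and the random walk\<close>

definition measure_support :: "'b measure \<Rightarrow> 'b set" where
  "measure_support \<mu> = {g \<in> space \<mu>. measure \<mu> {g} > 0}"

inductive_set semigroup_generated :: "('a \<Rightarrow> 'a) set \<Rightarrow> ('a \<Rightarrow> 'a) set" for S where
  base: "g \<in> S \<Longrightarrow> g \<in> semigroup_generated S"
| mult: "g \<in> semigroup_generated S \<Longrightarrow> h \<in> semigroup_generated S \<Longrightarrow> g \<circ> h \<in> semigroup_generated S"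

definition non_elementary_measure ::
    "'a::metric_space \<Rightarrow> ('a \<Rightarrow> 'a) set \<Rightarrow> ('a \<Rightarrow> 'a) measure \<Rightarrow> bool" where
  "non_elementary_measure x0 G \<mu> \<longleftrightarrow>
     subgroup (semigroup_generated (measure_support \<mu>)) (isom_group\<lparr>carrier := G\<rparr>) \<and>
     non_elementary x0 (semigroup_generated (measure_support \<mu>))"

definition finite_first_moment :: "'a::metric_space \<Rightarrow> ('a \<Rightarrow> 'a) measure \<Rightarrow> bool" where
  "finite_first_moment x0 \<mu> \<longleftrightarrow> (\<integral>\<^sup>+g. ennreal (dist x0 (g x0)) \<partial>\<mu>) < \<infinity>"

definition bounded_support :: "'a::metric_space \<Rightarrow> ('a \<Rightarrow> 'a) measure \<Rightarrow> bool" where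
  "bounded_support x0 \<mu> \<longleftrightarrow> bounded ((\<lambda>g. g x0) ` measure_support \<mu>)"

text \<open>The space of i.i.d. increments. Coordinate \<open>i\<close> of \<open>\<omega>\<close> is the increment $g_{i+1}$, so that
  \<open>walk \<omega> n\<close> is $w_n = g_1 g_2 \cdots g_n$.\<close>

definition step_space :: "'b measure \<Rightarrow> (nat \<Rightarrow> 'b) measure" where
  "step_space \<mu> = (\<Pi>\<^sub>M i\<in>UNIV. \<mu>)"

primrec walk :: "(nat \<Rightarrow> 'a \<Rightarrow> 'a) \<Rightarrow> nat \<Rightarrow> 'a \<Rightarrow> 'a" where
  "walk \<omega> 0 = id"
| "walk \<omega> (Suc n) = walk \<omega> n \<circ> \<omega> n"

text \<open>For countable \<open>G\<close> the events in question are thus measurable, although composition of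
  arbitrary self-maps of \<open>'a\<close> need not be; this is why \<open>\<mu>\<close> lives on \<open>Pow G\<close>.\<close>

lemma walk_measurable:
  assumes G: "subgroup G isom_group" and c: "countable G" and m: "sets \<mu> = Pow G"
  shows "(\<lambda>\<omega>. walk \<omega> n) \<in> measurable (step_space \<mu>) (count_space G)"
proof (induction n)
  case 0
  have "id \<in> G" using subgroup.one_closed[OF G] by (simp add: isom_group_def)
  then show ?case by (simp only: walk.simps) (rule measurable_const, simp only: space_count_space)
next
  case (Suc n)
  have sp: "sets \<mu> = sets (count_space G)" using m by simp
  have "(\<lambda>\<omega>. \<omega> n) \<in> measurable (step_space \<mu>) \<mu>" unfolding step_space_def by simp
  then have co: "(\<lambda>\<omega>. \<omega> n) \<in> measurable (step_space \<mu>) (count_space G)"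
    using measurable_cong_sets[OF refl sp] by blast
  have "g \<circ> h \<in> G" if "g \<in> G" "h \<in> G" for g h
    using subgroup.m_closed[OF G that] by (simp add: isom_group_def)
  then have f: "(\<lambda>(g,h). g \<circ> h) \<in> measurable (count_space (G\<times>G)) (count_space G)" by auto
  have "(\<lambda>\<omega>. (walk \<omega> n, \<omega> n)) \<in> measurable (step_space \<mu>) (count_space G \<Otimes>\<^sub>M count_space G)"
    using Suc co by measurable
  then have "(\<lambda>\<omega>. (walk \<omega> n, \<omega> n)) \<in> measurable (step_space \<mu>) (count_space (G \<times> G))"
    by (simp add: pair_measure_countable c)
  from measurable_compose[OF this f] show ?case by (simp only: walk.simps split_conv)
qed

end

theory Submission
  imports Defs
begin

text \<open>
  The lower bound follows Gouezel's pivoting method and needs no moment assumption. Two independent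
  loxodromic elements yield a finite set \<open>S\<close> of isometries, charged by a convolution power
  of \<open>\<mu>\<close>, such that for all \<open>x, y\<close> most \<open>s \<in> S\<close> make the path from \<open>x\<close> via \<open>x\<^sub>0\<close> and
  \<open>s x\<^sub>0\<close> to \<open>s y\<close> almost geodesic. Condition on everything except the independent uniform pairs
  \<open>a, b \<in> S\<close> that occur along the walk. Most pairs extend a chain of aligned points (a pivot is
  added), and a pair that does not can destroy \<open>k\<close> pivots only with a probability exponentially
  small in \<open>k\<close>, because the earlier choices \<open>a\<close> can be resampled without affecting the other
  pivots. So \<open>E 2\<^sup>-\<^sup>d\<close>, for \<open>d\<close> the distance of the walk to \<open>x\<^sub>0\<close>, decays exponentially. This
  gives the exponential bound and, by Borel--Cantelli, the positivity of the liminf, which is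
  constant by Kolmogorov's 0-1 law. For a finite first moment, subadditivity along blocks bounds
  the limsup by \<open>E d\<^sub>m / m\<close>, and greedily cutting the path at times of small displacement shows
  that these quotients come arbitrarily close to the liminf.
\<close>

section \<open>Gromov products and isometries\<close>

text \<open>Following the law of the number of pivots would require conditional laws of whole
  configurations. Starting from 2^-d this yields the exponential moment directly. Pairs are needed
  because b is tested against what follows it and a against its two sides. With b fixed, the allowed
  values of a depend on nothing later than b, so they can still be averaged over after the later
  part of the path has been changed. Building the Schottky set threatens to be circular: the words
  must be long compared with the error C, and C depends on the words. C is therefore made
  independent of the middle power b^K, and K is chosen last. The number 48 makes the losses add up:
  1/2 + 4/24 + 4/48 = 3/4. On the ergodic side, one-sided forms of the subadditive and pointwise
  theorems suffice, because the liminf is already known to be constant.\<close>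

lemma gromov_product_commute: "gromov_product p x y = gromov_product p y x"
  by (simp add: gromov_product_def dist_commute)

lemma gromov_product_self [simp]:
  "gromov_product p p x = 0" "gromov_product p x p = 0" "gromov_product p x x = dist p x"
  by (simp_all add: gromov_product_def dist_commute)

lemma gromov_product_nonneg: "0 \<le> gromov_product p x y"
  unfolding gromov_product_def using dist_triangle[of x y p] by (simp add: dist_commute)

lemma gromov_product_le_dist: "gromov_product p x y \<le> dist p x" "gromov_product p x y \<le> dist p y"
  unfolding gromov_product_def using dist_triangle[of p y x] dist_triangle[of p x y]
  by (simp_all add: dist_commute)

lemma gromov_product_complement:
  "gromov_product p x y = dist p x - gromov_product x p y"
  unfolding gromov_product_def by (simp add: dist_commute field_simps)

lemma dist_gromov_product: "dist x y = dist p x + dist p y - 2 * gromov_product p x y"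
  unfolding gromov_product_def by (simp add: field_simps)

lemma gromov_product_change_base: "gromov_product p x y \<le> gromov_product q x y + dist p q"
  unfolding gromov_product_def using dist_triangle[of p x q] dist_triangle[of p y q]
  by (simp add: field_simps)

lemma gromov_product_perturb:
  "gromov_product p x' y' \<ge> gromov_product p x y - dist x x' - dist y y'"
proof -
  have "dist x' y' \<le> dist x x' + dist x y + dist y y'"
    using dist_triangle[of x' y' x] dist_triangle[of x y' y] by (simp add: dist_commute)
  moreover have "dist p x \<le> dist p x' + dist x x'" "dist p y \<le> dist p y' + dist y y'"
    using dist_triangle[of p x x'] dist_triangle[of p y y'] by (simp_all add: dist_commute)
  ultimately show ?thesis
    unfolding gromov_product_def by (simp add: field_simps)
qed

section \<open>Geodesic triangles and the four-point inequality\<close>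

lemma geodesic_segment_split:
  assumes "geodesic_segment S x y" "p \<in> S"
  shows "dist x y = dist x p + dist p y"
proof -
  obtain \<gamma> t where \<gamma>: "\<gamma> 0 = x" "\<gamma> (dist x y) = y" "t \<in> {0..dist x y}" "p = \<gamma> t"
    "\<forall>s\<in>{0..dist x y}. \<forall>t\<in>{0..dist x y}. dist (\<gamma> s) (\<gamma> t) = \<bar>s - t\<bar>"
    using assms unfolding geodesic_segment_def by blast
  have "dist x p = t" "dist p y = dist x y - t"
    using \<gamma>(5)[rule_format, of 0 t] \<gamma>(5)[rule_format, of t "dist x y"] \<gamma>(1-4) by auto
  then show ?thesis by simp
qed

lemma geodesic_segment_compact_connected:
  assumes "geodesic_segment S x y"
  shows "compact S" "connected S" "x \<in> S" "y \<in> S"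
proof -
  obtain \<gamma> where \<gamma>: "\<gamma> 0 = x" "\<gamma> (dist x y) = y" "S = \<gamma> ` {0..dist x y}"
    "\<forall>s\<in>{0..dist x y}. \<forall>t\<in>{0..dist x y}. dist (\<gamma> s) (\<gamma> t) = \<bar>s - t\<bar>"
    using assms unfolding geodesic_segment_def by blast
  have "continuous_on {0..dist x y} \<gamma>"
    unfolding continuous_on_iff using \<gamma>(4) by (auto simp: dist_real_def)
  then show "compact S" "connected S"
    unfolding \<gamma>(3) by (auto intro: compact_continuous_image connected_continuous_image)
  show "x \<in> S" "y \<in> S"
    using \<gamma>(1,2,3) by (metis atLeastAtMost_iff image_eqI order_refl zero_le_dist)+
qed

lemma geodesic_segment_commute: "geodesic_segment S x y \<Longrightarrow> geodesic_segment S y x"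
proof -
  assume "geodesic_segment S x y"
  then obtain \<gamma> where \<gamma>: "\<gamma> 0 = x" "\<gamma> (dist x y) = y" "S = \<gamma> ` {0..dist x y}"
    "\<forall>s\<in>{0..dist x y}. \<forall>t\<in>{0..dist x y}. dist (\<gamma> s) (\<gamma> t) = \<bar>s - t\<bar>"
    unfolding geodesic_segment_def by blast
  have "(\<lambda>t. dist x y - t) ` {0..dist x y} = {0..dist x y}"
    by (auto simp: image_iff intro!: bexI[of _ "dist x y - _"])
  then have "S = (\<lambda>t. \<gamma> (dist x y - t)) ` {0..dist x y}"
    using \<gamma>(3) by (metis image_image)
  then show "geodesic_segment S y x"
    unfolding geodesic_segment_def using \<gamma>
    by (intro exI[of _ "\<lambda>t. \<gamma> (dist x y - t)"]) (auto simp: dist_commute)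
qed

text \<open>By connectedness, some point of the side \<open>[x,z]\<close> is close to both other sides; it realises
  the Gromov product up to \<open>2\<delta>\<close>.\<close>

lemma slim_triangle_insize:
  fixes w x z :: "'a::metric_space"
  assumes slim: "\<And>A B C. geodesic_triangle A B C \<Longrightarrow> in_nbhd \<delta> (A :: 'a set) (B \<union> C)"
    and S: "geodesic_segment S x z" and A: "geodesic_segment A w x" and B: "geodesic_segment B w z"
  shows "\<exists>p\<in>S. dist w p \<le> gromov_product w x z + 2 * \<delta>"
proof -
  note cS = geodesic_segment_compact_connected[OF S]
  note cA = geodesic_segment_compact_connected[OF A]
  note cB = geodesic_segment_compact_connected[OF B]
  have tri: "geodesic_triangle S B A"
    unfolding geodesic_triangle_def using S A geodesic_segment_commute[OF B] by blast
  have ne: "A \<noteq> {}" "B \<noteq> {}" using cA cB by auto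
  define S1 where "S1 = {p. infdist p A \<le> \<delta>}"
  define S2 where "S2 = {p. infdist p B \<le> \<delta>}"
  have cl: "closed S1" "closed S2"
    unfolding S1_def S2_def by (auto intro!: closed_Collect_le continuous_intros)
  have d0: "0 \<le> \<delta>"
    using slim[OF tri] cS(3) unfolding in_nbhd_def by (metis zero_le_dist order_trans)
  have "S \<subseteq> S1 \<union> S2"
  proof
    fix p assume "p \<in> S"
    then obtain q where "q \<in> B \<union> A" "dist p q \<le> \<delta>"
      using slim[OF tri] unfolding in_nbhd_def by blast
    then show "p \<in> S1 \<union> S2"
      unfolding S1_def S2_def using infdist_le[of q A p] infdist_le[of q B p] by force
  qed
  moreover have "x \<in> S1" "z \<in> S2" unfolding S1_def S2_def using cA cB d0 by simp_all
  ultimately have "S1 \<inter> S2 \<inter> S \<noteq> {}"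
    using cS(2)[unfolded connected_closed] cl cS(3,4)
    by (metis IntI empty_iff inf_commute)
  then obtain p where p: "p \<in> S" "infdist p A \<le> \<delta>" "infdist p B \<le> \<delta>"
    unfolding S1_def S2_def by auto
  \<comment> \<open>Segments are compact, so the distances of p to the two other sides are attained
    and no extra error enters.\<close>
  have attain: "\<exists>q\<in>K. dist p q \<le> \<delta>" if K: "compact K" "K \<noteq> {}" "infdist p K \<le> \<delta>" for K
  proof -
    have "continuous_on K (dist p)" by (intro continuous_intros)
    then obtain q where "q \<in> K" "\<And>y. y \<in> K \<Longrightarrow> dist p q \<le> dist p y"
      using continuous_attains_inf[OF K(1,2), of "dist p"] by blast
    then have "dist p q \<le> infdist p K"
      unfolding infdist_def using K(2) by (auto intro: cINF_greatest)
    then show ?thesis using \<open>q \<in> K\<close> K(3) by (intro bexI[of _ q]) auto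
  qed
  obtain q r where q: "q \<in> A" "dist p q \<le> \<delta>" and r: "r \<in> B" "dist p r \<le> \<delta>"
    using attain[OF cA(1) ne(1) p(2)] attain[OF cB(1) ne(2) p(3)] by blast
  have "dist w p \<le> gromov_product w x z + 2 * \<delta>"
    unfolding gromov_product_def
    using geodesic_segment_split[OF S p(1)] geodesic_segment_split[OF A q(1)]
      geodesic_segment_split[OF B r(1)] q(2) r(2)
      dist_triangle[of w p q] dist_triangle[of w p r] dist_triangle[of p x q] dist_triangle[of p z r]
    by (simp add: dist_commute field_simps)
  with p(1) show ?thesis by blast
qed

lemma gromov_product_le_dist_segment:
  assumes "geodesic_segment S x y" "q \<in> S"
  shows "gromov_product w x y \<le> dist w q"
  unfolding gromov_product_def using geodesic_segment_split[OF assms]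
    dist_triangle[of w x q] dist_triangle[of w y q] by (simp add: dist_commute)

text \<open>Gromov's four-point condition. All later arguments use hyperbolicity in this form only,
  so geodesics disappear after the next lemma.\<close>

definition four_point :: "real \<Rightarrow> 'a::metric_space itself \<Rightarrow> bool" where
  "four_point \<delta> _ \<longleftrightarrow> 0 \<le> \<delta> \<and>
     (\<forall>p x y z::'a. min (gromov_product p x y) (gromov_product p y z) - \<delta> \<le> gromov_product p x z)"

text \<open>A point p of [x,z] realises the product of x and z at w up to 2\<delta>, and slimness
  puts a point q of another side within \<delta> of p. Every point of a side is at least as far from
  w as the product of the endpoints of that side, whence 3\<delta>.\<close>

lemma gromov_hyperbolic_four_point:
  assumes "gromov_hyperbolic TYPE('a::metric_space)"
  shows "\<exists>\<delta>. four_point \<delta> TYPE('a)"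
proof -
  obtain \<delta> where \<delta>: "0 \<le> \<delta>" "\<And>A B C :: 'a set. geodesic_triangle A B C \<Longrightarrow> in_nbhd \<delta> A (B \<union> C)"
    using assms unfolding gromov_hyperbolic_def by blast
  have seg: "\<exists>S. geodesic_segment S x y" for x y :: 'a
    using assms unfolding gromov_hyperbolic_def geodesic_space_def by blast
  have "min (gromov_product w x y) (gromov_product w y z) - 3 * \<delta> \<le> gromov_product w x z"
    for w x y z :: 'a
  proof -
    obtain S A B U V where S: "geodesic_segment S x z" "geodesic_segment A w x" "geodesic_segment B w z"
       "geodesic_segment U x y" "geodesic_segment V y z" using seg by metis
    obtain p where p: "p \<in> S" "dist w p \<le> gromov_product w x z + 2 * \<delta>"
      using slim_triangle_insize[OF \<delta>(2) S(1-3)] by blast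
    have "geodesic_triangle S V U"
      unfolding geodesic_triangle_def using S geodesic_segment_commute by blast
    then obtain q where q: "q \<in> V \<union> U" "dist p q \<le> \<delta>"
      using \<delta>(2) p(1) unfolding in_nbhd_def by blast
    have "min (gromov_product w x y) (gromov_product w y z) \<le> dist w q"
      using q(1) gromov_product_le_dist_segment[OF S(4)] gromov_product_le_dist_segment[OF S(5)]
      by (auto simp: min_le_iff_disj)
    then show ?thesis using p(2) q(2) dist_triangle[of w q p] by linarith
  qed
  then have "four_point (3 * \<delta>) TYPE('a)" unfolding four_point_def using \<delta>(1) by simp
  then show ?thesis by blast
qed

section \<open>Isometries and the hyperbolic setting\<close>

abbreviation isometry :: "('a::metric_space \<Rightarrow> 'a) \<Rightarrow> bool" where
  "isometry f \<equiv> f \<in> carrier isom_group"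

lemma isometry_iff: "isometry f \<longleftrightarrow> surj f \<and> (\<forall>x y. dist (f x) (f y) = dist x y)"
  by (simp add: isom_group_def)

lemma isometry_dist [simp]: "isometry f \<Longrightarrow> dist (f x) (f y) = dist x y"
  by (simp add: isometry_iff)

lemma isometry_gromov_product [simp]:
  "isometry f \<Longrightarrow> gromov_product (f p) (f x) (f y) = gromov_product p x y"
  by (simp add: gromov_product_def)

lemma isometry_id [simp]: "isometry id" by (simp add: isometry_iff)

lemma isometry_comp [simp]: "isometry f \<Longrightarrow> isometry g \<Longrightarrow> isometry (f \<circ> g)"
  unfolding isometry_iff using comp_surj[of g f] by simp

lemma isometry_funpow [simp]: "isometry f \<Longrightarrow> isometry (f ^^ n)"
  by (induction n) simp_all

lemma isometry_surjD: "isometry f \<Longrightarrow> \<exists>x. f x = y"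
  by (metis isometry_iff surjD)

lemma isometry_inverse:
  assumes "isometry f"
  obtains f' where "isometry f'" "f \<circ> f' = id" "f' \<circ> f = id"
proof
  have s: "surj f" and i: "inj f"
    using assms by (auto simp: isometry_iff intro!: injI) (metis dist_eq_0_iff)
  show 1: "f \<circ> inv_into UNIV f = id" using s by (simp add: surj_iff)
  show "inv_into UNIV f \<circ> f = id" using i by simp
  have "dist (inv_into UNIV f x) (inv_into UNIV f y) = dist x y" for x y
    using isometry_dist[OF assms, of "inv_into UNIV f x" "inv_into UNIV f y"] s by (simp add: surj_f_inv_f)
  then show "isometry (inv_into UNIV f)" using i by (simp add: isometry_iff inj_imp_surj_inv)
qed

locale hyperbolic =
  fixes \<delta> :: real and x0 :: "'a::metric_space"
  assumes four_point: "four_point \<delta> TYPE('a)"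
begin

lemma delta_nonneg: "0 \<le> \<delta>" using four_point by (simp add: four_point_def)

lemma gromov_product_min:
  "min (gromov_product p x y) (gromov_product p y z) - \<delta> \<le> gromov_product p x (z::'a)"
  using four_point unfolding four_point_def by blast

text \<open>The working form of the four-point inequality: if z follows y beyond the point where x
  leaves y, then x leaves z no later, up to \<delta>.\<close>

lemma gromov_product_transfer:
  assumes "gromov_product p x y \<le> c" "c + \<delta> < gromov_product p y (z::'a)"
  shows "gromov_product p x z \<le> c + \<delta>"
  using gromov_product_min[of p x z y] assms by (simp add: gromov_product_commute min_def split: if_splits)

end

section \<open>Schottky sets and pivots\<close>

text \<open>Read from the current endpoint of the path back to its start. Length is demanded of
  every link except the last in the list: the first stretch of the path is arbitrary and may be
  trivial.\<close>

fun chain :: "real \<Rightarrow> real \<Rightarrow> 'a::metric_space list \<Rightarrow> bool" where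
  "chain C D (z # y # x # xs) \<longleftrightarrow>
     D \<le> dist z y \<and> gromov_product y z x \<le> C \<and> chain C D (y # x # xs)"
| "chain C D _ \<longleftrightarrow> True"

lemma chain_map:
  assumes "isometry f" shows "chain C D (map f xs) \<longleftrightarrow> chain C D xs"
  by (induction C D xs rule: chain.induct) (use assms in simp_all)

lemma chain_glue:
  "chain C D (xs @ [x, y]) \<Longrightarrow> chain C D (x # y # ys) \<Longrightarrow> chain C D (xs @ x # y # ys)"
proof (induction xs)
  case (Cons a xs)
  show ?case
  proof (cases xs)
    case Nil
    with Cons show ?thesis by simp
  next
    case (Cons b xs')
    with Cons.prems Cons.IH show ?thesis by (cases xs') auto
  qed
qed simp

text \<open>\<open>path_average [(A\<^sub>k, b\<^sub>k, w\<^sub>k), \<dots>, (A\<^sub>1, b\<^sub>1, w\<^sub>1)] u\<^sub>0 \<Phi>\<close> is the average of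
  \<open>\<Phi> (u\<^sub>0 a\<^sub>1 b\<^sub>1 w\<^sub>1 \<cdots> a\<^sub>k b\<^sub>k w\<^sub>k)\<close> over independent uniform \<open>a\<^sub>i \<in> A\<^sub>i\<close>.\<close>

type_synonym 'a pivots = "(('a \<Rightarrow> 'a) set \<times> ('a \<Rightarrow> 'a) \<times> ('a \<Rightarrow> 'a)) list"

fun path_average :: "'a pivots \<Rightarrow> ('a \<Rightarrow> 'a) \<Rightarrow> (('a \<Rightarrow> 'a) \<Rightarrow> real) \<Rightarrow> real" where
  "path_average [] u0 \<Phi> = \<Phi> u0"
| "path_average ((A, b, w) # st) u0 \<Phi> =
     (\<Sum>a\<in>A. path_average st u0 (\<lambda>u. \<Phi> (u \<circ> a \<circ> b \<circ> w))) / real (card A)"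

lemma path_average_sum:
  "path_average st u0 (\<lambda>u. \<Sum>i\<in>I. \<Phi> i u) = (\<Sum>i\<in>I. path_average st u0 (\<Phi> i))"
proof (induction st arbitrary: \<Phi>)
  case (Cons x st)
  obtain A b w where x: "x = (A, b, w)" by (cases x) auto
  have "path_average (x # st) u0 (\<lambda>u. \<Sum>i\<in>I. \<Phi> i u)
      = (\<Sum>a\<in>A. \<Sum>i\<in>I. path_average st u0 (\<lambda>u. \<Phi> i (u \<circ> a \<circ> b \<circ> w))) / real (card A)"
    by (simp add: x Cons)
  also have "\<dots> = (\<Sum>i\<in>I. path_average (x # st) u0 (\<Phi> i))"
    by (subst sum.swap) (simp add: x sum_divide_distrib)
  finally show ?case .
qed simp

lemma path_average_divide:
  "path_average st u0 (\<lambda>u. \<Phi> u / c) = path_average st u0 \<Phi> / c"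
  by (induction st u0 \<Phi> rule: path_average.induct) (simp_all add: sum_divide_distrib ac_simps)

lemma card_filter_ge:
  assumes "finite S" "real (card {s\<in>S. \<not> P s}) \<le> r" "real (card {s\<in>S. \<not> Q s}) \<le> r'"
  shows "real (card S) - r - r' \<le> real (card {s\<in>S. P s \<and> Q s})"
proof -
  have "S = {s\<in>S. P s \<and> Q s} \<union> ({s\<in>S. \<not> P s} \<union> {s\<in>S. \<not> Q s})" by blast
  then have "card S \<le> card {s\<in>S. P s \<and> Q s} + (card {s\<in>S. \<not> P s} + card {s\<in>S. \<not> Q s})"
    by (metis (no_types, lifting) card_Un_le order_trans add_left_mono)
  then show ?thesis using assms by linarith
qed

text \<open>\<open>S_source\<close> controls the turn at \<open>x0\<close> between z and s,
  \<open>S_target\<close> the turn at \<open>s x0\<close> before going on to \<open>s z\<close>; for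
  each z only a fraction 1/48 of \<open>S\<close> may fail. \<open>D_large\<close> lets a link of
  length D - 2C outweigh the loss 2 (C + 2\<delta>) at its turn by at least 1.\<close>

locale schottky = hyperbolic \<delta> x0 for \<delta> and x0 :: "'a::metric_space" +
  fixes S :: "('a \<Rightarrow> 'a) set" and C D :: real
  assumes finite_S: "finite S" and S_nonempty: "S \<noteq> {}"
    and S_isometry: "s \<in> S \<Longrightarrow> isometry s"
    and S_long: "s \<in> S \<Longrightarrow> D \<le> dist x0 (s x0)"
    and S_source: "real (card {s\<in>S. \<not> gromov_product x0 z (s x0) \<le> C}) \<le> real (card S) / 48"
    and S_target: "real (card {s\<in>S. \<not> gromov_product (s x0) x0 (s z) \<le> C}) \<le> real (card S) / 48"
    and C_nonneg: "0 \<le> C"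
    and D_large: "4 * C + 4 * \<delta> + 1 \<le> D"
begin

abbreviation gp :: "'a \<Rightarrow> 'a \<Rightarrow> 'a \<Rightarrow> real" where "gp \<equiv> gromov_product"

abbreviation good_chain :: "'a list \<Rightarrow> bool" where "good_chain \<equiv> chain (C + \<delta>) (D - 2 * C)"

definition admissible :: "'a \<Rightarrow> ('a \<Rightarrow> 'a) \<Rightarrow> ('a \<Rightarrow> 'a) set" where
  "admissible p b = {a\<in>S. gp x0 p (a x0) \<le> C \<and> gp (a x0) x0 (a (b x0)) \<le> C}"

lemma card_S_pos: "0 < card S" using finite_S S_nonempty by (simp add: card_gt_0_iff)

lemma admissible_subset: "admissible p b \<subseteq> S" by (auto simp: admissible_def)

lemma finite_admissible [simp]: "finite (admissible p b)"
  using admissible_subset finite_S by (rule finite_subset)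

lemma card_admissible_ge: "real (card S) - real (card S) / 24 \<le> real (card (admissible p b))"
  unfolding admissible_def using card_filter_ge[OF finite_S S_source S_target, of p "b x0"] by simp

lemma card_admissible_pos: "0 < card (admissible p b)"
proof -
  have "0 < real (card S) - real (card S) / 24" using card_S_pos by simp
  then show ?thesis using card_admissible_ge[of p b] by linarith
qed

lemma card_admissible_complement:
  "real (card {a\<in>S. a \<notin> admissible p b}) \<le> real (card S) / 24"
proof -
  have "card {a\<in>S. a \<notin> admissible p b} = card S - card (admissible p b)"
    using card_Diff_subset[OF finite_admissible admissible_subset]
    by (metis set_diff_eq)
  moreover have "card (admissible p b) \<le> card S"
    using admissible_subset finite_S by (rule card_mono[rotated])
  ultimately show ?thesis using card_admissible_ge[of p b] by linarith
qed

text \<open>Since s is long compared with the turn at \<open>s x0\<close>, the points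
  \<open>s x0\<close> and \<open>s z\<close> lie in the same direction from \<open>x0\<close>; so
  the turn at \<open>x0\<close> stays good, up to \<delta>.\<close>

lemma S_extend:
  assumes s: "s \<in> S" and t: "gp x0 t (s x0) \<le> C" and z: "gp (s x0) x0 (s z) \<le> C"
  shows "gp x0 t (s z) \<le> C + \<delta>" "D - 2 * C \<le> dist x0 (s z)"
proof -
  have d: "dist x0 (s z) = dist x0 (s x0) + dist (s x0) (s z) - 2 * gp (s x0) x0 (s z)"
    using dist_gromov_product[of x0 "s z" "s x0"] by (simp add: dist_commute)
  then show "D - 2 * C \<le> dist x0 (s z)"
    using S_long[OF s] z zero_le_dist[of "s x0" "s z"] by linarith
  have "gp x0 (s x0) (s z) = dist x0 (s x0) - gp (s x0) x0 (s z)"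
    by (rule gromov_product_complement)
  then have "C + \<delta> < gp x0 (s x0) (s z)"
    using S_long[OF s] z D_large C_nonneg delta_nonneg by linarith
  then show "gp x0 t (s z) \<le> C + \<delta>" by (rule gromov_product_transfer[OF t])
qed

text \<open>Local-to-global principle. By induction from the far end, y and the chain point next to
  x lie in the same direction from x, so the local bound on the turn passes to y. The error does not
  accumulate, because each long link absorbs it anew.\<close>

lemma good_chain_end:
  "good_chain (xs @ [y]) \<Longrightarrow> xs = z # x # xs' \<Longrightarrow> gp x z y \<le> C + 2 * \<delta>"
proof (induction xs arbitrary: z x xs')
  case (Cons a xs)
  then have xs: "xs = x # xs'" and a: "a = z" by auto
  show ?case
  proof (cases xs')
    case Nil
    with Cons.prems show ?thesis using delta_nonneg by simp
  next
    case (Cons w xs'')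
    have c: "good_chain (z # x # w # xs'' @ [y])" using Cons.prems by (simp add: Cons)
    then have zw: "gp x z w \<le> C + \<delta>" by simp
    have xw: "D - 2 * C \<le> dist x w" using c by (cases xs'') auto
    have "gp w x y \<le> C + 2 * \<delta>"
      using Cons.IH[of x w xs''] c xs Cons by simp
    then have "C + \<delta> + \<delta> < gp x w y"
      using xw gromov_product_complement[of x w y] D_large C_nonneg delta_nonneg by linarith
    from gromov_product_transfer[OF zw this] show ?thesis by simp
  qed
qed simp

text \<open>Each link contributes D - 2C and loses at most twice the turn C + 2\<delta>, a net gain
  of 1 by \<open>D_large\<close>.\<close>

lemma good_chain_dist:
  "good_chain (z # xs @ [y]) \<Longrightarrow> real (length xs) \<le> dist z y"
proof (induction xs arbitrary: z)
  case (Cons x xs)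
  have ge: "real (length xs) \<le> dist x y"
    using Cons by (cases xs) auto
  have "gp x z y \<le> C + 2 * \<delta>"
    using good_chain_end[of "z # x # xs" y] Cons.prems by simp
  moreover have "D - 2 * C \<le> dist z x" using Cons.prems by (cases xs) auto
  ultimately show ?case
    using ge dist_gromov_product[of z y x] D_large delta_nonneg by (simp add: dist_commute)
qed simp

text \<open>In a state \<open>pivot_state st u0 p\<close>, \<open>p\<close> is the point before the last one of a chain ending at
  \<open>u x\<^sub>0\<close>, pulled back by \<open>u\<close>, where \<open>u\<close> is any of the products averaged over. Membership of
  \<open>a\<^sub>i\<close> in its set \<open>A\<^sub>i\<close> depends only on data that survive the removal of later pivots.\<close>

inductive pivot_state :: "'a pivots \<Rightarrow> ('a \<Rightarrow> 'a) \<Rightarrow> 'a \<Rightarrow> bool" where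
  start: "isometry u0 \<Longrightarrow> u0 p = x0 \<Longrightarrow> pivot_state [] u0 p"
| push: "pivot_state st u0 p' \<Longrightarrow> b \<in> S \<Longrightarrow> isometry w \<Longrightarrow>
     xs @ [x0] = b (w x0) # b (w p) # ys \<Longrightarrow>
     (\<And>t. gp x0 t (b x0) \<le> C \<Longrightarrow> good_chain (xs @ [x0, t])) \<Longrightarrow>
     pivot_state ((admissible p' b, b, w) # st) u0 p"

inductive_cases pivot_state_ConsE: "pivot_state ((A, b, w) # st) u0 p"

text \<open>In coordinates where the pivot \<open>u (a x0)\<close> is at \<open>x0\<close>, the new
  stretch of the chain consists of the endpoint \<open>b (w x0)\<close>, the pivot and t, the image
  of the previous point. Only the turn at \<open>b x0\<close> must be good, a condition on b alone;
  the one on a is left to \<open>admissible\<close>.\<close>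

lemma pivot_state_push:
  assumes st: "pivot_state st u0 p'" and b: "b \<in> S" and w: "isometry w"
    and good: "gp (b x0) x0 (b (w x0)) \<le> C"
  shows "\<exists>p. pivot_state ((admissible p' b, b, w) # st) u0 p"
proof -
  obtain p where p: "b (w p) = x0"
    using isometry_surjD[OF isometry_comp[OF S_isometry[OF b] w]] by (auto simp: comp_def)
  have "good_chain [b (w x0), x0, t]" if "gp x0 t (b x0) \<le> C" for t
    using S_extend[OF b that good] by (simp add: dist_commute gromov_product_commute)
  then show ?thesis
    using pivot_state.push[OF st b w, of "[b (w x0)]" p "[]"] p by auto
qed

text \<open>Backtracking after a further motion v. If the turn at \<open>a x0\<close> is good,
  fixing a and absorbing \<open>a \<circ> b \<circ> w \<circ> v\<close> into the preceding w, or
  into \<open>u0\<close>, costs just this one pivot. The set \<open>A1\<close> is unchanged, since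
  it does not involve \<open>w1\<close>.\<close>

lemma pivot_state_freeze:
  assumes st: "pivot_state ((A, b, w) # st) u0 p" and a: "a \<in> A" and v: "isometry v"
    and good: "gp (a x0) x0 (a (b (w (v x0)))) \<le> C"
  shows "st = [] \<and> (\<exists>p'. pivot_state [] (u0 \<circ> a \<circ> b \<circ> w \<circ> v) p') \<or>
    (\<exists>A1 b1 w1 st' p'. st = (A1, b1, w1) # st' \<and>
       pivot_state ((A1, b1, w1 \<circ> a \<circ> b \<circ> w \<circ> v) # st') u0 p')"
proof -
  from st obtain q where q: "pivot_state st u0 q" "b \<in> S" "isometry w" "A = admissible q b"
    by (elim pivot_state_ConsE)
  have aS: "a \<in> S" using a q admissible_subset by auto
  have iso: "isometry (f \<circ> a \<circ> b \<circ> w \<circ> v)" if "isometry f" for f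
    using that S_isometry[OF aS] S_isometry[OF q(2)] q(3) v by (intro isometry_comp)
  from q(1) show ?thesis
  proof (cases rule: pivot_state.cases)
    case start
    obtain p' where "(u0 \<circ> a \<circ> b \<circ> w \<circ> v) p' = x0"
      using isometry_surjD[OF iso[OF start(2)]] by blast
    then show ?thesis using start pivot_state.start[OF iso[OF start(2)]] by blast
  next
    case (push st' q' b1 w1 xs ys)
    define w' where "w' = w1 \<circ> a \<circ> b \<circ> w \<circ> v"
    have w': "isometry w'" unfolding w'_def by (rule iso[OF push(4)])
    have b1: "isometry b1" using S_isometry push by blast
    \<comment> \<open>The former endpoint \<open>b1 (w1 x0)\<close> becomes the point before the
      last one.\<close>
    obtain p' where p': "b1 (w' p') = b1 (w1 x0)"
      using isometry_surjD[OF w', of "w1 x0"] by metis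
    have az: "gp x0 q (a (b (w (v x0)))) \<le> C + \<delta>" "D - 2 * C \<le> dist x0 (a (b (w (v x0))))"
      using S_extend[OF aS _ good, of q] a q(4) by (auto simp: admissible_def)
    have "good_chain ((b1 (w' x0) # xs) @ [x0, t])" if t: "gp x0 t (b1 x0) \<le> C" for t
    proof -
      have eq: "xs @ [x0, t] = b1 (w1 x0) # b1 (w1 q) # ys @ [t]"
        using push(5) by (metis append.assoc append_Cons append_Nil)
      have "good_chain (xs @ [x0, t])" by (rule push(6)[OF t])
      moreover have "D - 2 * C \<le> dist (b1 (w' x0)) (b1 (w1 x0))"
        using az(2) b1 push(4) by (simp add: w'_def dist_commute)
      moreover have "gp (b1 (w1 x0)) (b1 (w' x0)) (b1 (w1 q)) \<le> C + \<delta>"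
        using az(1) b1 push(4) by (simp add: w'_def gromov_product_commute)
      ultimately show ?thesis by (simp add: eq)
    qed
    then have "pivot_state ((admissible q' b1, b1, w') # st') u0 p'"
      using push p' by (intro pivot_state.push[OF push(2,3) w', of "b1 (w' x0) # xs" p' "b1 (w1 q) # ys"]) auto
    then show ?thesis using push(1) unfolding w'_def by blast
  qed
qed

section \<open>Test functions and their contraction by one random pair\<close>

text \<open>The weights 2^-k stand in for an exponential moment of the number of pivots; quantifying
  over all states makes the bound available for whatever frozen data arise.\<close>

definition bounded_by :: "real \<Rightarrow> (('a \<Rightarrow> 'a) \<Rightarrow> real) \<Rightarrow> bool" where
  "bounded_by \<beta> \<Phi> \<longleftrightarrow> (\<forall>u. 0 \<le> \<Phi> u) \<and>
     (\<forall>st u0 p. pivot_state st u0 p \<longrightarrow> path_average st u0 \<Phi> \<le> \<beta> * (1/2) ^ length st)"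

lemma bounded_byD:
  "bounded_by \<beta> \<Phi> \<Longrightarrow> pivot_state st u0 p \<Longrightarrow> path_average st u0 \<Phi> \<le> \<beta> * (1/2) ^ length st"
  unfolding bounded_by_def by blast

lemma bounded_by_apply: "bounded_by \<beta> \<Phi> \<Longrightarrow> isometry u \<Longrightarrow> \<Phi> u \<le> \<beta>"
  using bounded_byD[OF _ pivot_state.start, of \<beta> \<Phi> u] isometry_surjD[of u x0] by auto

text \<open>Turns a state into an actual chain for each product u: the stretches stored with the
  pivots are glued, and each pivot contributes at least one point.\<close>

lemma path_average_le:
  assumes "pivot_state st u0 p"
    and "\<And>u ys. good_chain (u x0 # u p # ys) \<Longrightarrow> last (u p # ys) = x0 \<Longrightarrow> isometry u \<Longrightarrow>
           length st \<le> length ys \<Longrightarrow> \<Phi> u \<le> c"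
  shows "path_average st u0 \<Phi> \<le> c"
  using assms
proof (induction arbitrary: \<Phi> rule: pivot_state.induct)
  case (start u0 p)
  then show ?case using start(3)[of u0 "[]"] by simp
next
  case (push st u0 p' b w xs p ys)
  have "path_average st u0 (\<lambda>u. \<Phi> (u \<circ> a \<circ> b \<circ> w)) \<le> c" if a: "a \<in> admissible p' b" for a
  proof (rule push.IH)
    fix u zs
    assume zs: "good_chain (u x0 # u p' # zs)" "last (u p' # zs) = x0" "isometry u"
      "length st \<le> length zs"
    have aS: "a \<in> S" and a1: "gp x0 p' (a x0) \<le> C" and a2: "gp (a x0) x0 (a (b x0)) \<le> C"
      using a by (auto simp: admissible_def)
    have ua: "isometry (u \<circ> a)" using zs(3) S_isometry[OF aS] by simp
    \<comment> \<open>t is the starting point of a as seen from the pivot; admissibility of a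
      becomes the condition on t under which the stored stretch is a good chain.\<close>
    obtain t where t: "a t = x0" using isometry_surjD[OF S_isometry[OF aS]] by blast
    have "gp (a x0) (a t) (a (b x0)) \<le> C" using a2 t by simp
    then have "gp x0 t (b x0) \<le> C" using S_isometry[OF aS] by simp
    then have "good_chain (xs @ [x0, t])" by (rule push.hyps(5))
    then have "good_chain (map (u \<circ> a) (xs @ [x0, t]))" using chain_map[OF ua] by blast
    then have c1: "good_chain (map (u \<circ> a) xs @ [u (a x0), u x0])" using t by simp
    have "D - 2 * C \<le> dist (u (a x0)) (u x0)"
      using S_long[OF aS] zs(3) C_nonneg by (simp add: dist_commute)
    moreover have "gp (u x0) (u (a x0)) (u p') \<le> C + \<delta>"
      using a1 zs(3) delta_nonneg by (simp add: gromov_product_commute)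
    ultimately have c2: "good_chain (u (a x0) # u x0 # u p' # zs)" using zs(1) by simp
    from chain_glue[OF c1 c2]
    have c3: "good_chain (map (u \<circ> a) (xs @ [x0]) @ u x0 # u p' # zs)" by simp
    show "\<Phi> (u \<circ> a \<circ> b \<circ> w) \<le> c"
    proof (rule push.prems)
      show "good_chain ((u \<circ> a \<circ> b \<circ> w) x0 # (u \<circ> a \<circ> b \<circ> w) p #
          (map (u \<circ> a) ys @ u x0 # u p' # zs))"
        using c3 push.hyps(4) by simp
      show "isometry (u \<circ> a \<circ> b \<circ> w)"
        using ua S_isometry[OF push.hyps(2)] push.hyps(3) by simp
    qed (use zs in auto)
  qed
  then have "(\<Sum>a\<in>admissible p' b. path_average st u0 (\<lambda>u. \<Phi> (u \<circ> a \<circ> b \<circ> w)))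
      \<le> real (card (admissible p' b)) * c"
    by (intro sum_bounded_above)
  then show ?case using card_admissible_pos[of p' b] by (simp add: divide_le_eq mult.commute)
qed

text \<open>The initial test function: k pivots give a chain from \<open>u x0\<close> to
  \<open>x0\<close> with at least k inner points, hence a distance of at least k.\<close>

lemma bounded_by_distance: "bounded_by 1 (\<lambda>u. 2 powr - dist x0 (u x0))"
  unfolding bounded_by_def
proof (intro conjI allI impI)
  fix st :: "'a pivots" and u0 p assume st: "pivot_state st u0 p"
  have "path_average st u0 (\<lambda>u. 2 powr - dist x0 (u x0)) \<le> 2 powr - real (length st)"
  proof (rule path_average_le[OF st])
    fix u ys assume c: "good_chain (u x0 # u p # ys)" "last (u p # ys) = x0" "length st \<le> length ys"
    have "u p # ys = butlast (u p # ys) @ [x0]" using c(2) by (metis append_butlast_last_id list.discI)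
    then have "good_chain (u x0 # butlast (u p # ys) @ [x0])" using c(1) by simp
    from good_chain_dist[OF this] have "real (length ys) \<le> dist x0 (u x0)"
      by (simp only: length_butlast dist_commute[of "u x0"]) simp
    then show "2 powr - dist x0 (u x0) \<le> 2 powr - real (length st)" using c(3) by simp
  qed
  then show "path_average st u0 (\<lambda>u. 2 powr - dist x0 (u x0)) \<le> 1 * (1 / 2) ^ length st"
    by (simp add: powr_minus powr_realpow power_one_over inverse_eq_divide)
qed simp

text \<open>A translation \<open>v\<close> costs a constant factor: for most \<open>a\<close> it removes the last pivot only.\<close>

lemma bounded_by_translate:
  assumes \<Phi>: "bounded_by \<beta> \<Phi>" and \<beta>: "0 \<le> \<beta>"
  shows "pivot_state st u0 p \<Longrightarrow> isometry v \<Longrightarrow>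
    path_average st u0 (\<lambda>u. \<Phi> (u \<circ> v)) \<le> 4 * \<beta> * (1/2) ^ length st"
proof (induction st arbitrary: u0 p v)
  case Nil
  have "isometry u0" using Nil(1) by (cases rule: pivot_state.cases) auto
  then have "isometry (u0 \<circ> v)" using Nil(2) by simp
  from bounded_by_apply[OF \<Phi> this] show ?case using \<beta> by (simp add: comp_def del: comp_apply)
next
  case (Cons x st)
  obtain A b w where x: "x = (A, b, w)" by (cases x) auto
  note st = Cons.prems(1)[unfolded x]
  from st obtain q where q: "pivot_state st u0 q" "b \<in> S" "isometry w" "A = admissible q b"
    by (elim pivot_state_ConsE)
  define good where "good = {a\<in>A. gp (a x0) x0 (a (b (w (v x0)))) \<le> C}"
  define B where "B = \<beta> * (1/2) ^ length st"
  define val where "val a = path_average st u0 (\<lambda>u. \<Phi> (u \<circ> a \<circ> b \<circ> w \<circ> v))" for a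
  have B: "0 \<le> B" using \<beta> by (simp add: B_def)
  have finA: "finite A" and AS: "A \<subseteq> S" using q(4) admissible_subset by auto
  have val_good: "val a \<le> B" if a: "a \<in> good" for a
  proof -
    have "a \<in> A" "gp (a x0) x0 (a (b (w (v x0)))) \<le> C" using a by (auto simp: good_def)
    from pivot_state_freeze[OF st this(1) Cons.prems(2) this(2)] show ?thesis
    proof (elim disjE conjE exE)
      fix p' assume "st = []" "pivot_state [] (u0 \<circ> a \<circ> b \<circ> w \<circ> v) p'"
      with bounded_byD[OF \<Phi> this(2)] show ?thesis by (simp add: val_def B_def)
    next
      fix A1 b1 w1 st' p'
      assume s: "st = (A1, b1, w1) # st'"
        "pivot_state ((A1, b1, w1 \<circ> a \<circ> b \<circ> w \<circ> v) # st') u0 p'"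
      from bounded_byD[OF \<Phi> s(2)] show ?thesis
        by (simp add: val_def B_def s(1) comp_assoc del: comp_apply)
    qed
  qed
  \<comment> \<open>If the turn at \<open>a x0\<close> is bad, a is still fixed, and everything
    after the shorter state becomes a translation of it, at the price of the factor 4.\<close>
  have val_bad: "val a \<le> 4 * B" if a: "a \<in> A" for a
  proof -
    have "isometry (a \<circ> b \<circ> w \<circ> v)"
      using a AS S_isometry q(2,3) Cons.prems(2) by (intro isometry_comp) auto
    from Cons.IH[OF q(1) this] show ?thesis by (simp only: val_def B_def comp_assoc mult.assoc)
  qed
  have "A - good \<subseteq> {a\<in>S. \<not> gp (a x0) x0 (a (b (w (v x0)))) \<le> C}" using AS by (auto simp: good_def)
  then have "card (A - good) \<le> card {a\<in>S. \<not> gp (a x0) x0 (a (b (w (v x0)))) \<le> C}"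
    using finite_S by (intro card_mono) auto
  then have "real (card (A - good)) \<le> real (card S) / 48"
    using S_target[of "b (w (v x0))"] by linarith
  \<comment> \<open>\<open>A\<close> is at least 23/24 of \<open>S\<close>, and 48 * 23/24 =
    46.\<close>
  then have few: "real (card (A - good)) \<le> real (card A) / 46"
    using card_admissible_ge[of q b] q(4) by simp
  have "good \<subseteq> A" by (auto simp: good_def)
  then have "(\<Sum>a\<in>A. val a) = (\<Sum>a\<in>good. val a) + (\<Sum>a\<in>A - good. val a)"
    using finA by (simp add: sum.subset_diff)
  also have "\<dots> \<le> real (card good) * B + real (card (A - good)) * (4 * B)"
    using val_good val_bad by (intro add_mono sum_bounded_above) auto
  also have "\<dots> \<le> real (card A) * B + real (card A) / 46 * (4 * B)"
    using B few card_mono[OF finA \<open>good \<subseteq> A\<close>] by (intro add_mono mult_right_mono) auto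
  \<comment> \<open>The constant 4 reproduces itself: 1 + 4/46 is below 2, and 2 B is 4 \<beta>
    times the weight for one pivot more.\<close>
  also have "\<dots> \<le> real (card A) * (2 * B)" using B by (simp add: field_simps)
  finally have "(\<Sum>a\<in>A. val a) \<le> (2 * B) * real (card A)" by (simp add: mult.commute)
  then have "(\<Sum>a\<in>A. val a) / real (card A) \<le> 2 * B"
    using card_admissible_pos[of q b] q(4) by (simp add: divide_le_eq)
  then have "path_average (x # st) u0 (\<lambda>u. \<Phi> (u \<circ> v)) \<le> 2 * B"
    by (simp only: x val_def path_average.simps)
  then show ?case by (simp only: B_def list.size power_Suc add_Suc_right add_0_right)
qed

definition step_average :: "('a \<Rightarrow> 'a) \<Rightarrow> (('a \<Rightarrow> 'a) \<Rightarrow> real) \<Rightarrow> ('a \<Rightarrow> 'a) \<Rightarrow> real" where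
  "step_average w \<Phi> u = (\<Sum>b\<in>S. \<Sum>a\<in>S. \<Phi> (u \<circ> a \<circ> b \<circ> w)) / (real (card S))\<^sup>2"

text \<open>For good b the admissible a create a pivot and gain a factor 1/2, while the other a, at
  most 1/24 of \<open>S\<close>, cost a factor 4: together 1/2 + 4/24 = 2/3. Bad b, at most 1/48 of
  \<open>S\<close>, add 4/48.\<close>

lemma bounded_by_step_average:
  assumes \<Phi>: "bounded_by \<beta> \<Phi>" and \<beta>: "0 \<le> \<beta>" and w: "isometry w"
  shows "bounded_by (3/4 * \<beta>) (step_average w \<Phi>)"
  unfolding bounded_by_def
proof (intro conjI allI impI)
  show "0 \<le> step_average w \<Phi> u" for u
    using \<Phi> unfolding step_average_def bounded_by_def by (intro divide_nonneg_nonneg sum_nonneg) auto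
next
  fix st :: "'a pivots" and u0 p assume st: "pivot_state st u0 p"
  define N where "N = real (card S)"
  define B where "B = \<beta> * (1/2) ^ length st"
  define val where "val a b = path_average st u0 (\<lambda>u. \<Phi> (u \<circ> a \<circ> b \<circ> w))" for a b :: "'a \<Rightarrow> 'a"
  define good where "good = {b\<in>S. gp (b x0) x0 (b (w x0)) \<le> C}"
  have B: "0 \<le> B" and N: "0 < N" using \<beta> card_S_pos by (simp_all add: B_def N_def)
  have val_le: "val a b \<le> 4 * B" if "a \<in> S" "b \<in> S" for a b
  proof -
    have "isometry (a \<circ> b \<circ> w)" using that S_isometry w by (intro isometry_comp) auto
    from bounded_by_translate[OF \<Phi> \<beta> st this] show ?thesis by (simp only: val_def B_def comp_assoc mult.assoc)
  qed
  have row: "(\<Sum>a\<in>S. val a b) \<le> N * (4 * B)" if "b \<in> S" for b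
    unfolding N_def using val_le that by (intro sum_bounded_above) auto
  have row_good: "(\<Sum>a\<in>S. val a b) \<le> N * (2/3 * B)" if b: "b \<in> good" for b
  proof -
    define A where "A = admissible p b"
    have bS: "b \<in> S" using b by (simp add: good_def)
    obtain p' where "pivot_state ((A, b, w) # st) u0 p'"
      using pivot_state_push[OF st bS w] b unfolding good_def A_def by blast
    from bounded_byD[OF \<Phi> this] have "(\<Sum>a\<in>A. val a b) / real (card A) \<le> B / 2"
      by (simp add: val_def B_def)
    moreover have "0 < real (card A)" using card_admissible_pos[of p b] by (simp add: A_def)
    ultimately have "(\<Sum>a\<in>A. val a b) \<le> B / 2 * real (card A)"
      by (simp only: pos_divide_le_eq)
    also have "\<dots> \<le> B / 2 * N"
      using B card_mono[OF finite_S admissible_subset, of p b] by (intro mult_left_mono) (auto simp: N_def A_def)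
    finally have "(\<Sum>a\<in>A. val a b) \<le> B / 2 * N" .
    moreover have "(\<Sum>a\<in>S - A. val a b) \<le> real (card (S - A)) * (4 * B)"
      using val_le bS by (intro sum_bounded_above) auto
    moreover have "real (card (S - A)) * (4 * B) \<le> N / 24 * (4 * B)"
      using B card_admissible_complement[of p b]
      by (intro mult_right_mono) (simp_all add: N_def A_def set_diff_eq)
    moreover have "(\<Sum>a\<in>S. val a b) = (\<Sum>a\<in>A. val a b) + (\<Sum>a\<in>S - A. val a b)"
      unfolding A_def by (subst add.commute) (rule sum.subset_diff[OF admissible_subset finite_S])
    ultimately have "(\<Sum>a\<in>S. val a b) \<le> B / 2 * N + N / 24 * (4 * B)" by linarith
    also have "\<dots> = N * (2/3 * B)" by simp
    finally show ?thesis .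
  qed
  have few: "real (card (S - good)) \<le> N / 48"
  proof -
    have "S - good = {b\<in>S. \<not> gp (b x0) x0 (b (w x0)) \<le> C}" by (auto simp: good_def)
    then show ?thesis using S_target[of "w x0"] by (simp add: N_def)
  qed
  have gS: "good \<subseteq> S" by (auto simp: good_def)
  have "(\<Sum>b\<in>S. \<Sum>a\<in>S. val a b) = (\<Sum>b\<in>good. \<Sum>a\<in>S. val a b) + (\<Sum>b\<in>S - good. \<Sum>a\<in>S. val a b)"
    by (subst add.commute) (rule sum.subset_diff[OF gS finite_S])
  also have "\<dots> \<le> real (card good) * (N * (2/3 * B)) + real (card (S - good)) * (N * (4 * B))"
    using row_good row by (intro add_mono sum_bounded_above) auto
  also have "\<dots> \<le> N * (N * (2/3 * B)) + N / 48 * (N * (4 * B))"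
    using few card_mono[OF finite_S gS] B N by (intro add_mono mult_right_mono) (simp_all add: N_def)
  also have "\<dots> = (3/4 * B) * N\<^sup>2" by (simp add: power2_eq_square)
  finally have "(\<Sum>b\<in>S. \<Sum>a\<in>S. val a b) / N\<^sup>2 \<le> 3/4 * B"
    using N by (subst pos_divide_le_eq) simp_all
  then show "path_average st u0 (step_average w \<Phi>) \<le> 3 / 4 * \<beta> * (1 / 2) ^ length st"
    unfolding step_average_def N_def[symmetric]
    by (simp only: path_average_divide path_average_sum val_def[symmetric]) (simp add: B_def)
qed

end

section \<open>Exponential decay for walks charging a Schottky set\<close>

text \<open>A recursion on functions, so that the estimates need discrete laws only;
  \<open>nn_integral_walk\<close> makes the link with the product space.\<close>

primrec walk_expect ::
    "('a \<Rightarrow> 'a) pmf \<Rightarrow> (('a \<Rightarrow> 'a) \<Rightarrow> ennreal) \<Rightarrow> nat \<Rightarrow> ('a \<Rightarrow> 'a) \<Rightarrow> ennreal" where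
  "walk_expect P \<Phi> 0 u = \<Phi> u"
| "walk_expect P \<Phi> (Suc n) u = (\<integral>\<^sup>+g. walk_expect P \<Phi> n (u \<circ> g) \<partial>P)"

primrec walk_pmf :: "('a \<Rightarrow> 'a) pmf \<Rightarrow> nat \<Rightarrow> ('a \<Rightarrow> 'a) pmf" where
  "walk_pmf P 0 = return_pmf id"
| "walk_pmf P (Suc n) = bind_pmf P (\<lambda>g. map_pmf (\<lambda>v. g \<circ> v) (walk_pmf P n))"

lemma walk_expect_add:
  "walk_expect P \<Phi> (m + n) u = (\<integral>\<^sup>+g. walk_expect P \<Phi> n (u \<circ> g) \<partial>walk_pmf P m)"
proof (induction m arbitrary: u)
  case (Suc m)
  show ?case by (simp add: Suc comp_assoc nn_integral_bind_pmf del: comp_apply)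
qed simp

lemma walk_expect_mult:
  "walk_expect P \<Phi> (n * m) u = walk_expect (walk_pmf P m) \<Phi> n u"
  by (induction n arbitrary: u) (simp_all add: walk_expect_add)

lemma set_walk_pmf_mult:
  "g \<in> set_pmf (walk_pmf P m) \<Longrightarrow> h \<in> set_pmf (walk_pmf P n) \<Longrightarrow> g \<circ> h \<in> set_pmf (walk_pmf P (m + n))"
proof (induction m arbitrary: g)
  case (Suc m)
  then obtain k v where "g = k \<circ> v" "k \<in> set_pmf P" "v \<in> set_pmf (walk_pmf P m)" by auto
  moreover have "v \<circ> h \<in> set_pmf (walk_pmf P (m + n))" using Suc.IH Suc.prems(2) calculation(3) by blast
  ultimately show ?case by (auto simp: comp_assoc simp del: comp_apply)
qed simp

lemma set_walk_pmf_isometry: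
  "(\<And>g. g \<in> set_pmf P \<Longrightarrow> isometry g) \<Longrightarrow> g \<in> set_pmf (walk_pmf P n) \<Longrightarrow> isometry g"
  by (induction n arbitrary: g) auto

text \<open>Q dominates a small multiple of any finitely supported law inside its support; \<nu> is
  the normalised remainder. For a convolution power of the step law this exhibits the random
  pairs.\<close>

lemma pmf_split:
  fixes Q \<sigma> :: "'b pmf"
  assumes fin: "finite (set_pmf \<sigma>)" and sub: "set_pmf \<sigma> \<subseteq> set_pmf Q"
  obtains p \<nu> where "0 < p" "p < 1" "set_pmf \<nu> \<subseteq> set_pmf Q"
    "Q = bind_pmf (bernoulli_pmf p) (\<lambda>c. if c then \<sigma> else \<nu>)"
proof -
  \<comment> \<open>The bound 1/2 leaves positive mass for the remainder.\<close>
  define p where "p = min (1/2) (Min (pmf Q ` set_pmf \<sigma>))"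
  have "0 < Min (pmf Q ` set_pmf \<sigma>)"
    using fin sub set_pmf_not_empty[of \<sigma>] by (subst Min_gr_iff) (auto simp: pmf_positive_iff)
  then have p: "0 < p" "p < 1" by (auto simp: p_def)
  have le: "p * pmf \<sigma> x \<le> pmf Q x" for x
  proof (cases "x \<in> set_pmf \<sigma>")
    case True
    have "p * pmf \<sigma> x \<le> p * 1" using p by (intro mult_left_mono pmf_le_1) auto
    also have "\<dots> \<le> pmf Q x" using True fin by (auto simp: p_def min_le_iff_disj)
    finally show ?thesis .
  qed (simp add: set_pmf_iff)
  define f where "f x = (pmf Q x - p * pmf \<sigma> x) / (1 - p)" for x
  have f0: "0 \<le> f x" for x using le p by (simp add: f_def)
  have "(\<integral>\<^sup>+x. ennreal (f x) \<partial>count_space UNIV) = 1"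
  proof -
    have "ennreal (pmf Q x) = ennreal (1 - p) * ennreal (f x) + ennreal p * ennreal (pmf \<sigma> x)" for x
    proof -
      have "pmf Q x = (1 - p) * f x + p * pmf \<sigma> x" using p by (simp add: f_def)
      then show ?thesis
        using p f0[of x] by (metis diff_ge_0_iff_ge ennreal_mult ennreal_plus less_imp_le mult_nonneg_nonneg pmf_nonneg)
    qed
    then have "(\<integral>\<^sup>+x. ennreal (pmf Q x) \<partial>count_space UNIV) =
        ennreal (1 - p) * (\<integral>\<^sup>+x. ennreal (f x) \<partial>count_space UNIV) +
        ennreal p * (\<integral>\<^sup>+x. ennreal (pmf \<sigma> x) \<partial>count_space UNIV)"
      by (simp add: nn_integral_add nn_integral_cmult)
    moreover have "(\<integral>\<^sup>+x. ennreal (pmf R x) \<partial>count_space UNIV) = 1" for R :: "'b pmf"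
      using measure_pmf.emeasure_space_1[of R] by (simp add: nn_integral_pmf)
    ultimately have eq: "1 = ennreal (1 - p) * (\<integral>\<^sup>+x. ennreal (f x) \<partial>count_space UNIV) + ennreal p"
      by simp
    define I where "I = (\<integral>\<^sup>+x. ennreal (f x) \<partial>count_space UNIV)"
    have eq: "1 = ennreal (1 - p) * I + ennreal p" using eq by (simp add: I_def)
    then have "I \<noteq> \<infinity>" using p by (auto simp: ennreal_mult_top)
    then obtain r where r: "I = ennreal r" "0 \<le> r" by (cases I) auto
    have "ennreal 1 = ennreal ((1 - p) * r + p)" using eq p r by (simp add: ennreal_mult ennreal_plus)
    then have "1 = (1 - p) * r + p" using p r(2) by (subst (asm) ennreal_inj) auto
    then have "(1 - p) * (r - 1) = 0" by (simp add: algebra_simps)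
    then have "r = 1" using p by simp
    then show ?thesis using r(1) by (simp add: I_def)
  qed
  then have f: "pmf (embed_pmf f) x = f x" for x using f0 by (intro pmf_embed_pmf) auto
  show thesis
  proof (rule that[OF p])
    show "set_pmf (embed_pmf f) \<subseteq> set_pmf Q"
    proof
      fix x assume "x \<in> set_pmf (embed_pmf f)"
      then have "f x \<noteq> 0" by (simp add: set_pmf_iff f)
      then have "p * pmf \<sigma> x \<noteq> pmf Q x" by (auto simp: f_def)
      moreover have "0 \<le> p * pmf \<sigma> x" using p by simp
      ultimately show "x \<in> set_pmf Q" using le[of x] by (auto simp: set_pmf_iff)
    qed
    show "Q = bind_pmf (bernoulli_pmf p) (\<lambda>c. if c then \<sigma> else embed_pmf f)"
      using p by (intro pmf_eqI) (simp add: pmf_bind f f_def)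
  qed
qed

lemma nn_integral_pmf_swap:
  "(\<integral>\<^sup>+x. \<integral>\<^sup>+y. f x y \<partial>measure_pmf B \<partial>measure_pmf A) = (\<integral>\<^sup>+y. \<integral>\<^sup>+x. f x y \<partial>measure_pmf A \<partial>measure_pmf B)"
proof -
  have "(\<integral>\<^sup>+z. (case z of (x, y) \<Rightarrow> f x y) \<partial>bind_pmf A (\<lambda>x. bind_pmf B (\<lambda>y. return_pmf (x, y)))) =
        (\<integral>\<^sup>+z. (case z of (x, y) \<Rightarrow> f x y) \<partial>bind_pmf B (\<lambda>y. bind_pmf A (\<lambda>x. return_pmf (x, y))))"
    by (simp only: bind_commute_pmf[of A B])
  then show ?thesis by (simp add: nn_integral_bind_pmf)
qed

context schottky begin

lemma finite_SS: "finite (S \<times> S)" "S \<times> S \<noteq> {}" using finite_S S_nonempty by auto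

text \<open>The laws left after conditioning on everything but the pairs: j independent uniform
  pairs separated by fixed isometries.\<close>

inductive schottky_walk :: "nat \<Rightarrow> ('a \<Rightarrow> 'a) pmf \<Rightarrow> bool" where
  zero: "isometry w \<Longrightarrow> schottky_walk 0 (return_pmf w)"
| step: "schottky_walk j J \<Longrightarrow> isometry w \<Longrightarrow>
    schottky_walk (Suc j) (bind_pmf J (\<lambda>u. map_pmf (\<lambda>(a, b). u \<circ> a \<circ> b \<circ> w) (pmf_of_set (S \<times> S))))"

lemma schottky_walk_translate:
  assumes "schottky_walk j J" "isometry v"
  shows "schottky_walk j (map_pmf (\<lambda>u. u \<circ> v) J)"
  using assms(1)
proof (cases rule: schottky_walk.cases)
  case (zero w)
  then show ?thesis using schottky_walk.zero[of "w \<circ> v"] assms(2) by simp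
next
  case (step j J' w)
  have "map_pmf (\<lambda>u. u \<circ> v) J =
      bind_pmf J' (\<lambda>u. map_pmf (\<lambda>(a, b). u \<circ> a \<circ> b \<circ> (w \<circ> v)) (pmf_of_set (S \<times> S)))"
    unfolding step(2) map_bind_pmf pmf.map_comp by (simp add: comp_def case_prod_unfold)
  then show ?thesis using schottky_walk.step[OF step(3), of "w \<circ> v"] step assms(2) by simp
qed

lemma nn_integral_schottky_step:
  assumes "\<And>u. 0 \<le> \<Phi> u"
  shows "(\<integral>\<^sup>+g. ennreal (\<Phi> g) \<partial>map_pmf (\<lambda>(a, b). u \<circ> a \<circ> b \<circ> w) (pmf_of_set (S \<times> S)))
    = ennreal (step_average w \<Phi> u)"
proof -
  have "(\<integral>\<^sup>+g. ennreal (\<Phi> g) \<partial>map_pmf (\<lambda>(a, b). u \<circ> a \<circ> b \<circ> w) (pmf_of_set (S \<times> S)))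
      = (\<Sum>(a, b)\<in>S \<times> S. ennreal (\<Phi> (u \<circ> a \<circ> b \<circ> w))) / ennreal (real (card (S \<times> S)))"
    by (simp add: nn_integral_pmf_of_set[OF finite_SS(2,1)] case_prod_unfold ennreal_of_nat_eq_real_of_nat
        del: comp_apply)
  also have "(\<Sum>(a, b)\<in>S \<times> S. ennreal (\<Phi> (u \<circ> a \<circ> b \<circ> w)))
      = ennreal (\<Sum>b\<in>S. \<Sum>a\<in>S. \<Phi> (u \<circ> a \<circ> b \<circ> w))"
    using assms by (subst sum.swap)
      (simp add: sum.cartesian_product case_prod_unfold sum_ennreal sum_nonneg del: comp_apply)
  also have "\<dots> / ennreal (real (card (S \<times> S))) = ennreal (step_average w \<Phi> u)"
    unfolding step_average_def using assms card_S_pos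
    by (subst divide_ennreal) (auto intro!: sum_nonneg simp: card_cartesian_product power2_eq_square)
  finally show ?thesis .
qed

text \<open>The last pair is integrated first; this replaces \<Phi> by
  \<open>step_average w \<Phi>\<close>, a test function with 3/4 of the bound.\<close>

lemma schottky_walk_expect:
  assumes "schottky_walk j J" "bounded_by \<beta> \<Phi>" "0 \<le> \<beta>"
  shows "(\<integral>\<^sup>+u. ennreal (\<Phi> u) \<partial>J) \<le> ennreal ((3/4) ^ j * \<beta>)"
  using assms
proof (induction arbitrary: \<Phi> \<beta> rule: schottky_walk.induct)
  case (zero w)
  then show ?case using bounded_by_apply[OF zero(2,1)] by (simp add: ennreal_leI)
next
  case (step j J w)
  have "\<And>u. 0 \<le> \<Phi> u" using step.prems by (auto simp: bounded_by_def)
  then have "(\<integral>\<^sup>+u. ennreal (\<Phi> u) \<partial>bind_pmf J (\<lambda>u. map_pmf (\<lambda>(a, b). u \<circ> a \<circ> b \<circ> w) (pmf_of_set (S \<times> S))))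
     = (\<integral>\<^sup>+u. ennreal (step_average w \<Phi> u) \<partial>J)"
    by (simp only: nn_integral_bind_pmf nn_integral_schottky_step)
  also have "\<dots> \<le> ennreal ((3/4) ^ j * (3/4 * \<beta>))"
    using step.prems by (intro step.IH bounded_by_step_average step.hyps) auto
  finally show ?case by (simp add: ac_simps)
qed

text \<open>Each step of \<open>Q\<close> tosses a coin: with probability p it appends a pair and
  gains 3/4, otherwise it is a motion from \<nu>, absorbed into the last fixed isometry at no cost.
  Hence the factor 3p/4 + 1 - p = 1 - p/4.\<close>

lemma walk_expect_schottky_walk:
  fixes Q :: "('a \<Rightarrow> 'a) pmf"
  assumes p: "0 < p" "p < 1" and \<nu>: "\<And>g. g \<in> set_pmf \<nu> \<Longrightarrow> isometry g"
    and Q: "Q = bind_pmf (bernoulli_pmf p)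
      (\<lambda>c. if c then map_pmf (\<lambda>(a, b). a \<circ> b) (pmf_of_set (S \<times> S)) else \<nu>)"
    and \<Phi>: "bounded_by 1 \<Phi>"
  shows "schottky_walk j J \<Longrightarrow>
    (\<integral>\<^sup>+u. walk_expect Q (\<lambda>u. ennreal (\<Phi> u)) n u \<partial>J) \<le> ennreal ((3/4) ^ j * (1 - p / 4) ^ n)"
proof (induction n arbitrary: j J)
  case 0
  then show ?case using schottky_walk_expect[OF 0 \<Phi>] by simp
next
  case (Suc n)
  define F where "F = walk_expect Q (\<lambda>u. ennreal (\<Phi> u)) n"
  define \<rho> where "\<rho> = (1 - p / 4) ^ n"
  define J' where "J' = bind_pmf J (\<lambda>u. map_pmf (\<lambda>(a, b). u \<circ> a \<circ> b \<circ> id) (pmf_of_set (S \<times> S)))"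
  have \<rho>: "0 \<le> \<rho>" using p by (simp add: \<rho>_def)
  have "(\<integral>\<^sup>+u. F u \<partial>J') \<le> ennreal ((3/4) ^ Suc j * \<rho>)"
    unfolding F_def \<rho>_def J'_def by (intro Suc.IH schottky_walk.step Suc.prems isometry_id)
  moreover have "(\<integral>\<^sup>+u. F u \<partial>J') = (\<integral>\<^sup>+u. \<integral>\<^sup>+g. F (u \<circ> g) \<partial>map_pmf (\<lambda>(a, b). a \<circ> b) (pmf_of_set (S \<times> S)) \<partial>J)"
    unfolding J'_def by (simp add: nn_integral_bind_pmf case_prod_unfold comp_assoc del: comp_apply)
  ultimately have 1: "(\<integral>\<^sup>+u. \<integral>\<^sup>+g. F (u \<circ> g) \<partial>map_pmf (\<lambda>(a, b). a \<circ> b) (pmf_of_set (S \<times> S)) \<partial>J)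
      \<le> ennreal ((3/4) ^ Suc j * \<rho>)" by simp
  have "(\<integral>\<^sup>+u. F (u \<circ> g) \<partial>J) \<le> ennreal ((3/4) ^ j * \<rho>)" if "g \<in> set_pmf \<nu>" for g
    using Suc.IH[OF schottky_walk_translate[OF Suc.prems \<nu>[OF that]]] by (simp add: F_def \<rho>_def)
  then have "(\<integral>\<^sup>+g. \<integral>\<^sup>+u. F (u \<circ> g) \<partial>J \<partial>\<nu>) \<le> (\<integral>\<^sup>+g. ennreal ((3/4) ^ j * \<rho>) \<partial>\<nu>)"
    by (intro nn_integral_mono_AE) (simp add: AE_measure_pmf_iff)
  then have 2: "(\<integral>\<^sup>+u. \<integral>\<^sup>+g. F (u \<circ> g) \<partial>\<nu> \<partial>J) \<le> ennreal ((3/4) ^ j * \<rho>)"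
    by (subst nn_integral_pmf_swap) simp
  have "walk_expect Q (\<lambda>u. ennreal (\<Phi> u)) (Suc n) u =
      ennreal p * (\<integral>\<^sup>+g. F (u \<circ> g) \<partial>map_pmf (\<lambda>(a, b). a \<circ> b) (pmf_of_set (S \<times> S))) +
      ennreal (1 - p) * (\<integral>\<^sup>+g. F (u \<circ> g) \<partial>\<nu>)" for u
  proof -
    have "walk_expect Q (\<lambda>u. ennreal (\<Phi> u)) (Suc n) u = (\<integral>\<^sup>+g. F (u \<circ> g) \<partial>Q)"
      by (simp add: F_def)
    also have "\<dots> = (\<integral>\<^sup>+c. \<integral>\<^sup>+g. F (u \<circ> g) \<partial>(if c then map_pmf (\<lambda>(a, b). a \<circ> b) (pmf_of_set (S \<times> S)) else \<nu>)
        \<partial>bernoulli_pmf p)"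
      unfolding Q by (simp only: nn_integral_bind_pmf)
    also have "\<dots> = (\<integral>\<^sup>+g. F (u \<circ> g) \<partial>map_pmf (\<lambda>(a, b). a \<circ> b) (pmf_of_set (S \<times> S))) * ennreal p +
        (\<integral>\<^sup>+g. F (u \<circ> g) \<partial>\<nu>) * ennreal (1 - p)"
      using p by (subst nn_integral_bernoulli_pmf) auto
    finally show ?thesis by (simp add: mult.commute)
  qed
  then have "(\<integral>\<^sup>+u. walk_expect Q (\<lambda>u. ennreal (\<Phi> u)) (Suc n) u \<partial>J) =
      ennreal p * (\<integral>\<^sup>+u. \<integral>\<^sup>+g. F (u \<circ> g) \<partial>map_pmf (\<lambda>(a, b). a \<circ> b) (pmf_of_set (S \<times> S)) \<partial>J) +
      ennreal (1 - p) * (\<integral>\<^sup>+u. \<integral>\<^sup>+g. F (u \<circ> g) \<partial>\<nu> \<partial>J)"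
    by (simp only:) (simp add: nn_integral_add nn_integral_cmult del: comp_apply nn_integral_map_pmf)
  also have "\<dots> \<le> ennreal p * ennreal ((3/4) ^ Suc j * \<rho>) + ennreal (1 - p) * ennreal ((3/4) ^ j * \<rho>)"
    using 1 2 by (intro add_mono mult_left_mono) auto
  also have "\<dots> = ennreal (p * ((3/4) ^ Suc j * \<rho>) + (1 - p) * ((3/4) ^ j * \<rho>))"
    using p \<rho> by (subst ennreal_plus) (simp_all add: ennreal_mult'[symmetric])
  also have "p * ((3/4) ^ Suc j * \<rho>) + (1 - p) * ((3/4) ^ j * \<rho>) = (3/4) ^ j * (1 - p / 4) ^ Suc n"
    by (simp add: \<rho>_def algebra_simps)
  finally show ?case .
qed

text \<open>The walk is read in blocks of length \<open>N\<close>. The leftover increments are put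
  in front of the blocks and shift their starting point, so the block bound must be uniform in
  u.\<close>

lemma walk_expect_decay:
  fixes P :: "('a \<Rightarrow> 'a) pmf"
  assumes P: "\<And>g. g \<in> set_pmf P \<Longrightarrow> isometry g"
    and N: "\<And>a b. a \<in> S \<Longrightarrow> b \<in> S \<Longrightarrow> a \<circ> b \<in> set_pmf (walk_pmf P N)" and N0: "0 < N"
  shows "\<exists>K c. 0 < c \<and> c < 1 \<and> (\<forall>n u. isometry u \<longrightarrow>
    walk_expect P (\<lambda>u. ennreal (2 powr - dist x0 (u x0))) n u \<le> ennreal (K * c ^ n))"
proof -
  define \<Phi> where "\<Phi> u = 2 powr - dist x0 (u x0)" for u :: "'a \<Rightarrow> 'a"
  define \<sigma> where "\<sigma> = map_pmf (\<lambda>(a, b). a \<circ> b) (pmf_of_set (S \<times> S))"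
  have "finite (set_pmf \<sigma>)" "set_pmf \<sigma> \<subseteq> set_pmf (walk_pmf P N)"
    using finite_SS N by (auto simp: \<sigma>_def)
  then obtain p \<nu> where p: "0 < p" "p < 1" and \<nu>: "set_pmf \<nu> \<subseteq> set_pmf (walk_pmf P N)"
    and Q: "walk_pmf P N = bind_pmf (bernoulli_pmf p) (\<lambda>c. if c then \<sigma> else \<nu>)"
    by (rule pmf_split)
  define \<rho> where "\<rho> = 1 - p / 4"
  have \<rho>: "0 < \<rho>" "\<rho> < 1" using p by (auto simp: \<rho>_def)
  define c where "c = root N \<rho>"
  have c: "0 < c" "c < 1" "c ^ N = \<rho>"
    using \<rho> N0 by (auto simp: c_def real_root_lt_1_iff)
  have \<nu>_iso: "isometry g" if "g \<in> set_pmf \<nu>" for g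
    using set_walk_pmf_isometry[of P g N] P \<nu> that by blast
  have block: "walk_expect P (\<lambda>u. ennreal (\<Phi> u)) (q * N) u \<le> ennreal (\<rho> ^ q)" if "isometry u" for q u
    using walk_expect_schottky_walk[OF p \<nu>_iso Q[unfolded \<sigma>_def] bounded_by_distance schottky_walk.zero[OF that], of q]
    by (simp add: walk_expect_mult \<rho>_def \<Phi>_def[abs_def])
  have "walk_expect P (\<lambda>u. ennreal (\<Phi> u)) n u \<le> ennreal (1 / \<rho> * c ^ n)" if u: "isometry u" for n u
  proof -
    define q r where "q = n div N" and "r = n mod N"
    have n: "n = r + q * N" and r: "r < N" using N0 by (simp_all add: q_def r_def)
    have "walk_expect P (\<lambda>u. ennreal (\<Phi> u)) n u
        = (\<integral>\<^sup>+g. walk_expect P (\<lambda>u. ennreal (\<Phi> u)) (q * N) (u \<circ> g) \<partial>walk_pmf P r)"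
      unfolding n by (rule walk_expect_add)
    also have "\<dots> \<le> (\<integral>\<^sup>+g. ennreal (\<rho> ^ q) \<partial>walk_pmf P r)"
      using set_walk_pmf_isometry[of P] P u
      by (intro nn_integral_mono_AE) (auto simp: AE_measure_pmf_iff simp del: walk_expect.simps intro!: block isometry_comp)
    also have "\<dots> = ennreal (\<rho> ^ q)" by simp
    \<comment> \<open>The r < N leftover steps cost at most a factor 1/\<rho>, because c^N =
      \<rho>.\<close>
    also have "\<rho> ^ q \<le> 1 / \<rho> * c ^ n"
    proof -
      have "\<rho> ^ q = c ^ (q * N)" by (simp add: c(3)[symmetric] power_mult[symmetric] mult.commute)
      moreover have "\<rho> \<le> c ^ r" unfolding c(3)[symmetric] using c r by (intro power_decreasing) auto
      ultimately have "\<rho> * \<rho> ^ q \<le> c ^ n"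
        unfolding n power_add using c(1) by (simp add: mult_right_mono)
      then show ?thesis using \<rho> by (simp add: field_simps)
    qed
    finally show ?thesis by (simp add: ennreal_leI)
  qed
  then show ?thesis using c(1,2) unfolding \<Phi>_def by blast
qed

end

section \<open>Schottky sets from independent loxodromic isometries\<close>

lemma funpow_left_inverse:
  fixes f f' :: "'a \<Rightarrow> 'a"
  assumes "\<And>x. f' (f x) = x" shows "(f' ^^ n) ((f ^^ n) x) = x"
proof (induction n)
  case (Suc n)
  have "(f' ^^ Suc n) ((f ^^ Suc n) x) = (f' ^^ n) (f' (f ((f ^^ n) x)))"
    by (simp add: funpow_swap1)
  then show ?case using assms Suc by simp
qed simp

lemma filterlim_at_top_minus_bound:
  fixes f g :: "'b \<Rightarrow> real"
  assumes "filterlim f at_top F" "\<And>x. f x - c \<le> g x"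
  shows "filterlim g at_top F"
  unfolding filterlim_at_top
proof
  fix Z
  have "\<forall>\<^sub>F x in F. Z + c \<le> f x" using assms(1) unfolding filterlim_at_top by blast
  then show "\<forall>\<^sub>F x in F. Z \<le> g x"
    by eventually_elim (use assms(2) in \<open>smt (verit)\<close>)
qed

lemma card_le_one_if_no_pair:
  assumes "\<And>i j. i \<in> I \<Longrightarrow> j \<in> I \<Longrightarrow> i < j \<Longrightarrow> \<not> (P i \<and> P j)" and "finite (I :: nat set)"
  shows "card {s \<in> f ` I. \<exists>i\<in>I. s = f i \<and> P i} \<le> 1"
proof -
  have "{s \<in> f ` I. \<exists>i\<in>I. s = f i \<and> P i} = f ` {i\<in>I. P i}" by auto
  moreover have "card (f ` {i\<in>I. P i}) \<le> card {i\<in>I. P i}" using assms(2) by (intro card_image_le) auto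
  moreover have "card {i\<in>I. P i} \<le> 1"
    using assms by (subst card_le_Suc0_iff_eq[simplified One_nat_def[symmetric]]) (auto, metis linorder_neqE_nat)
  ultimately show ?thesis by simp
qed

text \<open>The inverse is kept as an explicit partner, so that each statement can be applied with f
  and f' exchanged.\<close>

definition inverse_isometries :: "('a::metric_space \<Rightarrow> 'a) \<Rightarrow> ('a \<Rightarrow> 'a) \<Rightarrow> bool" where
  "inverse_isometries f f' \<longleftrightarrow> isometry f \<and> isometry f' \<and> (\<forall>x. f (f' x) = x) \<and> (\<forall>x. f' (f x) = x)"

lemma inverse_isometries_sym: "inverse_isometries f f' \<Longrightarrow> inverse_isometries f' f"
  by (simp add: inverse_isometries_def)

lemma inverse_isometries_ex: "isometry f \<Longrightarrow> \<exists>f'. inverse_isometries f f'"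
  unfolding inverse_isometries_def by (metis isometry_inverse comp_apply id_apply)

lemma inverse_isometries_comp:
  "inverse_isometries f f' \<Longrightarrow> inverse_isometries g g' \<Longrightarrow> inverse_isometries (f \<circ> g) (g' \<circ> f')"
  by (simp add: inverse_isometries_def)

lemma inverse_isometries_funpow: "inverse_isometries f f' \<Longrightarrow> inverse_isometries (f ^^ n) (f' ^^ n)"
  by (auto simp: inverse_isometries_def funpow_left_inverse)

lemma inverse_isometries_gromov_product:
  assumes "inverse_isometries f f'"
  shows "gromov_product (f p) x (f y) = gromov_product p (f' x) y"
proof -
  have "gromov_product (f p) (f (f' x)) (f y) = gromov_product p (f' x) y"
    using assms by (intro isometry_gromov_product) (simp add: inverse_isometries_def)
  then show ?thesis using assms by (simp add: inverse_isometries_def)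
qed

lemma inverse_isometries_dist:
  assumes "inverse_isometries f f'"
  shows "dist p (f' q) = dist q (f p)"
proof -
  have "dist (f p) (f (f' q)) = dist p (f' q)"
    using assms by (intro isometry_dist) (simp add: inverse_isometries_def)
  then show ?thesis using assms by (simp add: inverse_isometries_def dist_commute)
qed

context hyperbolic begin

section \<open>Orbits of loxodromic isometries\<close>

text \<open>The turn of the orbit at \<open>a x0\<close> is the turn at \<open>x0\<close> of an
  orbit shorter by one step. By induction all later orbit points therefore lie in the direction of
  \<open>a x0\<close>, and the error stays at \<delta>.\<close>

lemma axis_step:
  assumes inv: "inverse_isometries a a'"
    and c: "gromov_product x0 (a' x0) (a x0) \<le> c" and D: "2 * c + 4 * \<delta> + 1 \<le> dist x0 (a x0)"
  shows "gromov_product x0 (a' x0) ((a ^^ Suc m) x0) \<le> c + \<delta>"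
proof (induction m)
  case 0
  show ?case using c delta_nonneg by simp
next
  case (Suc m)
  have "gromov_product (a x0) x0 ((a ^^ Suc (Suc m)) x0) = gromov_product x0 (a' x0) ((a ^^ Suc m) x0)"
    using inverse_isometries_gromov_product[OF inv, of x0 x0 "(a ^^ Suc m) x0"] by simp
  then have "c + \<delta> < gromov_product x0 (a x0) ((a ^^ Suc (Suc m)) x0)"
    using Suc D delta_nonneg gromov_product_complement[of x0 "a x0" "(a ^^ Suc (Suc m)) x0"] 
      order_trans[OF gromov_product_nonneg c] by linarith
  from gromov_product_transfer[OF c this] show ?case .
qed

text \<open>Each half of the orbit is compared with its first point, at a cost of \<delta> per half.
  Distances grow by at least 1 per step, since \<open>dist x0 (a x0)\<close> exceeds twice the turn
  c + \<delta> by that much.\<close>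

lemma axis_two_sided:
  assumes inv: "inverse_isometries a a'"
    and c: "gromov_product x0 (a' x0) (a x0) \<le> c" and D: "2 * c + 4 * \<delta> + 1 \<le> dist x0 (a x0)"
  shows "gromov_product x0 ((a' ^^ i) x0) ((a ^^ j) x0) \<le> c + 2 * \<delta>"
    and "real i \<le> dist x0 ((a ^^ i) x0)"
proof -
  have c0: "0 \<le> c" using order_trans[OF gromov_product_nonneg c] .
  note inv' = inverse_isometries_sym[OF inv]
  have D': "dist x0 (a' x0) = dist x0 (a x0)" by (rule inverse_isometries_dist[OF inv])
  have c': "gromov_product x0 (a x0) (a' x0) \<le> c" using c by (simp add: gromov_product_commute)
  show "gromov_product x0 ((a' ^^ i) x0) ((a ^^ j) x0) \<le> c + 2 * \<delta>"
  proof (cases "i = 0 \<or> j = 0")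
    case False
    then obtain k l where i: "i = Suc k" and j: "j = Suc l" by (metis not0_implies_Suc)
    have "gromov_product (a' x0) x0 ((a' ^^ Suc k) x0) \<le> c + \<delta>"
    proof (cases k)
      case (Suc k')
      then show ?thesis
        using axis_step[OF inv' c', of k'] D D'
          inverse_isometries_gromov_product[OF inv', of x0 x0 "(a' ^^ k) x0"] by simp
    qed (use c0 delta_nonneg in simp)
    then have "c + \<delta> + \<delta> < gromov_product x0 (a' x0) ((a' ^^ Suc k) x0)"
      using gromov_product_complement[of x0 "a' x0" "(a' ^^ Suc k) x0"] D D' delta_nonneg c0 by linarith
    moreover have "gromov_product x0 ((a ^^ Suc l) x0) (a' x0) \<le> c + \<delta>"
      using axis_step[OF inv c D, of l] by (simp add: gromov_product_commute)
    ultimately have "gromov_product x0 ((a ^^ Suc l) x0) ((a' ^^ Suc k) x0) \<le> c + \<delta> + \<delta>"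
      using gromov_product_transfer by blast
    then show ?thesis by (simp add: i j gromov_product_commute)
  qed (use c0 delta_nonneg in auto)
  show "real i \<le> dist x0 ((a ^^ i) x0)"
  proof (induction i)
    case (Suc i)
    show ?case
    proof (cases i)
      case 0
      then show ?thesis using D c0 delta_nonneg by simp
    next
      case (Suc k)
      have "gromov_product (a x0) x0 ((a ^^ Suc i) x0) \<le> c + \<delta>"
        using axis_step[OF inv c D, of k] Suc
          inverse_isometries_gromov_product[OF inv, of x0 x0 "(a ^^ i) x0"] by simp
      moreover have "dist (a x0) ((a ^^ Suc i) x0) = dist x0 ((a ^^ i) x0)"
        using inv by (simp add: inverse_isometries_def)
      ultimately show ?thesis
        using dist_gromov_product[of x0 "(a ^^ Suc i) x0" "a x0"] Suc.IH D delta_nonneg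
        by (simp add: dist_commute)
    qed
  qed simp
qed

text \<open>Since \<open>d(x\<^sub>0, g\<^sup>n x\<^sub>0)\<close> grows like \<open>\<tau> n\<close>, its defect of additivity between \<open>n\<close> and \<open>2 n\<close> is
  \<open>o(n)\<close>; so some power of \<open>g\<close> has a local, and hence global, quasi-geodesic as orbit.\<close>

lemma loxodromic_axis:
  assumes lox: "loxodromic x0 g" and inv: "inverse_isometries g g'"
  obtains n E where "0 < n"
    "\<And>i j. gromov_product x0 ((g' ^^ (n * i)) x0) ((g ^^ (n * j)) x0) \<le> E"
    "\<And>i. real i \<le> dist x0 ((g ^^ (n * i)) x0)"
proof -
  define l where "l n = dist x0 ((g ^^ n) x0)" for n
  obtain \<tau> where \<tau>: "0 < \<tau>" "(\<lambda>n. l n / real n) \<longlonglongrightarrow> \<tau>"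
    using lox unfolding loxodromic_def l_def by blast
  have "(\<lambda>n. l (2 * n) / real (2 * n)) \<longlonglongrightarrow> \<tau>"
    using LIMSEQ_subseq_LIMSEQ[OF \<tau>(2), of "\<lambda>n. 2 * n"] by (simp add: strict_mono_def comp_def)
  \<comment> \<open>The turn at \<open>(g ^^ n) x0\<close> is \<open>l n - l (2 * n) / 2\<close>,
    below (17/16 - 15/16) \<tau> n = \<tau> n / 8. Twice this plus 4\<delta> + 1, at most \<tau> n /
    2, stays below 15/16 \<tau> n and so below \<open>l n\<close>, as \<open>axis_two_sided\<close>
    requires.\<close>
  then have "\<forall>\<^sub>F n in sequentially. l (2 * n) / real (2 * n) > \<tau> * (15/16)"
    using \<tau>(1) by (intro order_tendstoD(1)) auto
  moreover have "\<forall>\<^sub>F n in sequentially. l n / real n < \<tau> * (17/16)"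
    using \<tau> by (intro order_tendstoD(2)) auto
  moreover have "\<forall>\<^sub>F n in sequentially. l n / real n > \<tau> * (15/16)"
    using \<tau> by (intro order_tendstoD(1)) auto
  moreover have "\<forall>\<^sub>F n in sequentially. (4 * \<delta> + 1) / (\<tau> / 2) \<le> real n"
    by real_asymp
  ultimately have "\<forall>\<^sub>F n in sequentially. 0 < n \<and> l (2 * n) / real (2 * n) > \<tau> * (15/16) \<and>
      l n / real n < \<tau> * (17/16) \<and> l n / real n > \<tau> * (15/16) \<and> (4 * \<delta> + 1) / (\<tau> / 2) \<le> real n"
    using eventually_gt_at_top[of 0] by eventually_elim auto
  then obtain n where n: "0 < n" "l (2 * n) / real (2 * n) > \<tau> * (15/16)"
      "l n / real n < \<tau> * (17/16)" "l n / real n > \<tau> * (15/16)" "(4 * \<delta> + 1) / (\<tau> / 2) \<le> real n"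
    by (auto simp: eventually_sequentially)
  have "0 < 2 * n" using n(1) by simp
  then have "l (2 * n) > \<tau> * (15/16) * real (2 * n)" using n(2) by (simp only: pos_less_divide_eq of_nat_0_less_iff)
  moreover have "l n < \<tau> * (17/16) * real n" "l n > \<tau> * (15/16) * real n"
    using n by (simp_all only: pos_less_divide_eq pos_divide_less_eq of_nat_0_less_iff)
  moreover have "4 * \<delta> + 1 \<le> \<tau> / 2 * real n"
    using n(5) \<tau>(1) by (subst (asm) pos_divide_le_eq) (auto simp: mult.commute)
  ultimately have b: "l n - l (2 * n) / 2 \<le> 1/8 * (\<tau> * real n)" "15/16 * (\<tau> * real n) \<le> l n"
      "4 * \<delta> + 1 \<le> 1/2 * (\<tau> * real n)"
    by auto
  have tn: "0 \<le> \<tau> * real n" using \<tau>(1) by simp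
  have inv_n: "inverse_isometries (g ^^ n) (g' ^^ n)" by (rule inverse_isometries_funpow[OF inv])
  have "gromov_product x0 ((g' ^^ n) x0) ((g ^^ n) x0) = gromov_product ((g ^^ n) x0) x0 ((g ^^ n) ((g ^^ n) x0))"
    by (rule inverse_isometries_gromov_product[OF inv_n, symmetric])
  also have "\<dots> = l n - l (2 * n) / 2"
  proof -
    have "dist ((g ^^ n) x0) ((g ^^ n) ((g ^^ n) x0)) = l n"
      using inv_n by (simp add: inverse_isometries_def l_def)
    moreover have "dist x0 ((g ^^ n) ((g ^^ n) x0)) = l (2 * n)"
      by (simp add: l_def mult_2 funpow_add)
    ultimately show ?thesis
      unfolding gromov_product_def by (simp add: l_def dist_commute field_simps)
  qed
  finally have c: "gromov_product x0 ((g' ^^ n) x0) ((g ^^ n) x0) \<le> 1/8 * (\<tau> * real n)" using b by simp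
  have "2 * (1/8 * (\<tau> * real n)) + 4 * \<delta> + 1 \<le> dist x0 ((g ^^ n) x0)"
    using b tn unfolding l_def by linarith
  note axis = axis_two_sided[OF inv_n c this]
  show thesis
    by (rule that[OF n(1)]) (use axis in \<open>simp_all only: funpow_mult\<close>)
qed

section \<open>Rays and points of the Gromov boundary\<close>

text \<open>A coarse geodesic ray: by \<open>gromov_product_complement\<close> the first clause
  bounds the turn at \<open>u k\<close> between \<open>x0\<close> and \<open>u m\<close> by
  E.\<close>

definition ray :: "real \<Rightarrow> (nat \<Rightarrow> 'a) \<Rightarrow> bool" where
  "ray E u \<longleftrightarrow> (\<forall>k m. k \<le> m \<longrightarrow> dist x0 (u k) - E \<le> gromov_product x0 (u k) (u m)) \<and>
     (\<forall>k. real k \<le> dist x0 (u k))"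

lemma axis_ray:
  assumes inv: "inverse_isometries g g'"
    and E: "\<And>i j. gromov_product x0 ((g' ^^ (n * i)) x0) ((g ^^ (n * j)) x0) \<le> E"
    and d: "\<And>i. real i \<le> dist x0 ((g ^^ (n * i)) x0)"
  shows "ray E (\<lambda>k. (g ^^ (n * k)) x0)"
  unfolding ray_def
proof (intro conjI allI impI d)
  fix k m :: nat assume "k \<le> m"
  then obtain j where m: "m = k + j" using le_Suc_ex by blast
  have "(g ^^ (n * m)) x0 = (g ^^ (n * k)) ((g ^^ (n * j)) x0)"
    by (simp add: m funpow_add distrib_left)
  then have "gromov_product ((g ^^ (n * k)) x0) x0 ((g ^^ (n * m)) x0) \<le> E"
    using inverse_isometries_gromov_product[OF inverse_isometries_funpow[OF inv], of "n * k" x0 x0] E by simp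
  then show "dist x0 ((g ^^ (n * k)) x0) - E \<le> gromov_product x0 ((g ^^ (n * k)) x0) ((g ^^ (n * m)) x0)"
    using gromov_product_complement[of x0 "(g ^^ (n * k)) x0" "(g ^^ (n * m)) x0"] by linarith
qed

lemma ray_gromov_sequence:
  assumes "ray E u" shows "u \<in> gromov_sequences x0"
proof -
  have "min (real k) (real m) - E \<le> gromov_product x0 (u k) (u m)" for k m
    using assms unfolding ray_def
    by (cases "k \<le> m") (smt (verit, best) gromov_product_commute nat_le_linear)+
  then have ge: "real (min k m) - E \<le> gromov_product x0 (u k) (u m)" for k m by (simp add: of_nat_min)
  show ?thesis
    unfolding gromov_sequences_def mem_Collect_eq filterlim_at_top eventually_prod_sequentially
  proof
    fix Z :: real
    obtain N :: nat where N: "Z + E \<le> real N" using real_arch_simple by blast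
    have "Z \<le> gromov_product x0 (u m) (u n)" if "N \<le> m" "N \<le> n" for m n
    proof -
      have "real N \<le> real (min m n)" using that by simp
      then show ?thesis using ge[of m n] N by linarith
    qed
    then show "\<exists>N. \<forall>m\<ge>N. \<forall>n\<ge>N. Z \<le> (case (n, m) of (m, n) \<Rightarrow> gromov_product x0 (u m) (u n))"
      by (intro exI[of _ N]) auto
  qed
qed

lemma gromov_product_tendsto_trans:
  assumes "filterlim (\<lambda>n. gromov_product x0 (x n) (y n)) at_top sequentially"
    "filterlim (\<lambda>n. gromov_product x0 (y n) (z n :: 'a)) at_top sequentially"
  shows "filterlim (\<lambda>n. gromov_product x0 (x n) (z n)) at_top sequentially"
  unfolding filterlim_at_top
proof
  fix Z :: real
  have "\<forall>\<^sub>F n in sequentially. Z + \<delta> \<le> gromov_product x0 (x n) (y n)"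
       "\<forall>\<^sub>F n in sequentially. Z + \<delta> \<le> gromov_product x0 (y n) (z n)"
    using assms unfolding filterlim_at_top by blast+
  then show "\<forall>\<^sub>F n in sequentially. Z \<le> gromov_product x0 (x n) (z n)"
  proof eventually_elim
    case (elim n)
    then show ?case using gromov_product_min[of x0 "x n" "y n" "z n"] by linarith
  qed
qed

text \<open>f changes Gromov products at \<open>x0\<close> by a bounded amount and moves the ray by
  at most B; so u is linked to f u, and f u to f x.\<close>

lemma ray_class_translate:
  assumes u: "ray E u" and inv: "inverse_isometries f f'" and B: "\<And>k. dist (u k) (f (u k)) \<le> B"
    and x: "(u, x) \<in> gromov_equiv x0"
  shows "(u, f \<circ> x) \<in> gromov_equiv x0"
proof -
  have fgp: "gromov_product x0 y z - dist x0 (f' x0) \<le> gromov_product x0 (f y) (f z)" for y z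
  proof -
    have "gromov_product (f (f' x0)) (f y) (f z) = gromov_product (f' x0) y z"
      using inv by (intro isometry_gromov_product) (simp add: inverse_isometries_def)
    then have "gromov_product x0 (f y) (f z) = gromov_product (f' x0) y z"
      using inv by (simp add: inverse_isometries_def)
    then show ?thesis using gromov_product_change_base[of x0 y z "f' x0"] by linarith
  qed
  have x': "x \<in> gromov_sequences x0" "u \<in> gromov_sequences x0"
      "filterlim (\<lambda>n. gromov_product x0 (u n) (x n)) at_top sequentially"
    using x by (auto simp: gromov_equiv_def)
  have "f \<circ> x \<in> gromov_sequences x0"
    using x'(1) unfolding gromov_sequences_def mem_Collect_eq
    by (rule filterlim_at_top_minus_bound[where c = "dist x0 (f' x0)"]) (auto simp: fgp)
  moreover have "filterlim (\<lambda>n. gromov_product x0 (u n) ((f \<circ> x) n)) at_top sequentially"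
  proof (rule gromov_product_tendsto_trans)
    show "filterlim (\<lambda>n. gromov_product x0 (u n) (f (u n))) at_top sequentially"
    proof (rule filterlim_at_top_minus_bound[OF filterlim_real_sequentially, where c = B])
      fix n
      have "real n \<le> gromov_product x0 (u n) (u n)" using u by (simp add: ray_def)
      then show "real n - B \<le> gromov_product x0 (u n) (f (u n))"
        using gromov_product_perturb[of x0 "u n" "u n" "u n" "f (u n)"] B[of n] by simp
    qed
    show "filterlim (\<lambda>n. gromov_product x0 (f (u n)) ((f \<circ> x) n)) at_top sequentially"
      using x'(3) by (rule filterlim_at_top_minus_bound[where c = "dist x0 (f' x0)"]) (simp add: fgp)
  qed
  ultimately show ?thesis using x'(2) by (simp add: gromov_equiv_def)
qed

lemma ray_class_fixed:
  assumes u: "ray E u" and inv: "inverse_isometries f f'" and B: "\<And>k. dist (u k) (f (u k)) \<le> B"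
  shows "gromov_equiv x0 `` {u} \<in> boundary_fixed_points x0 f"
proof -
  have B': "dist (u k) (f' (u k)) \<le> B" for k
    using B[of k] inverse_isometries_dist[OF inv, of "u k" "u k"] by simp
  have "(\<lambda>x. f \<circ> x) ` (gromov_equiv x0 `` {u}) = gromov_equiv x0 `` {u}"
  proof (intro equalityI subsetI)
    fix x assume "x \<in> gromov_equiv x0 `` {u}"
    then have "(u, f' \<circ> x) \<in> gromov_equiv x0"
      using ray_class_translate[OF u inverse_isometries_sym[OF inv] B'] by simp
    moreover have "x = f \<circ> (f' \<circ> x)" using inv by (auto simp: inverse_isometries_def)
    ultimately show "x \<in> (\<lambda>x. f \<circ> x) ` (gromov_equiv x0 `` {u})" by blast
  qed (use ray_class_translate[OF u inv B] in auto)
  then show ?thesis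
    using ray_gromov_sequence[OF u]
    unfolding boundary_fixed_points_def gromov_boundary_def by (auto intro: quotientI)
qed

lemma gromov_equiv_class_eq:
  assumes "(u, v) \<in> gromov_equiv x0"
  shows "gromov_equiv x0 `` {u} = gromov_equiv x0 `` {v}"
proof -
  have sub: "gromov_equiv x0 `` {u} \<subseteq> gromov_equiv x0 `` {v}" if "(u, v) \<in> gromov_equiv x0" for u v
    using that gromov_product_tendsto_trans[of v u] unfolding gromov_equiv_def
    by (auto simp: gromov_product_commute[of x0 "v _"])
  have "(v, u) \<in> gromov_equiv x0"
    using assms by (auto simp: gromov_equiv_def gromov_product_commute[of x0 "v _"])
  with sub[OF assms] sub[of v u] show ?thesis by blast
qed

text \<open>Each ray keeps the direction of its earlier points, so one large product forces all
  later products to be large. Unbounded products thus mean equivalent rays.\<close>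

lemma rays_separated:
  assumes u: "ray E u" and v: "ray E' v"
    and neq: "gromov_equiv x0 `` {u} \<noteq> gromov_equiv x0 `` {v}"
  shows "\<exists>B. \<forall>i j. gromov_product x0 (u i) (v j) \<le> B"
proof (rule ccontr)
  assume "\<not> ?thesis"
  then have unb: "\<exists>i j. B < gromov_product x0 (u i) (v j)" for B by (meson not_le)
  have "filterlim (\<lambda>n. gromov_product x0 (u n) (v n)) at_top sequentially"
    unfolding filterlim_at_top
  proof
    fix Z :: real
    define W where "W = Z + \<bar>E\<bar> + \<bar>E'\<bar> + 2 * \<delta>"
    obtain i j where ij: "W < gromov_product x0 (u i) (v j)" using unb by blast
    have "Z \<le> gromov_product x0 (u n) (v n)" if n: "max i j \<le> n" for n
    proof -
      have "dist x0 (u i) - E \<le> gromov_product x0 (u i) (u n)"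
           "dist x0 (v j) - E' \<le> gromov_product x0 (v j) (v n)"
        using u v n by (simp_all add: ray_def)
      then have "W - \<bar>E\<bar> \<le> gromov_product x0 (u n) (u i)" "W - \<bar>E'\<bar> \<le> gromov_product x0 (v j) (v n)"
        using ij gromov_product_le_dist[of x0 "u i" "v j"] gromov_product_commute[of x0 "u n" "u i"] by linarith+
      then show ?thesis
        using gromov_product_min[of x0 "u n" "u i" "v n"] gromov_product_min[of x0 "u i" "v j" "v n"] ij
          delta_nonneg unfolding W_def by linarith
    qed
    then show "\<forall>\<^sub>F n in sequentially. Z \<le> gromov_product x0 (u n) (v n)"
      unfolding eventually_sequentially by blast
  qed
  then have "(u, v) \<in> gromov_equiv x0"
    using ray_gromov_sequence[OF u] ray_gromov_sequence[OF v] by (simp add: gromov_equiv_def)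
  with gromov_equiv_class_eq neq show False by blast
qed

section \<open>Ping-pong and the Schottky words\<close>

text \<open>Cancelling the common power \<open>a ^^ i\<close>, which costs its length, leaves one
  word starting with \<open>b ^^ K\<close> and one starting with a positive power of a. Their first
  factors point in different directions by \<open>ba\<close>, and each word keeps the direction of
  its first factor because the powers are long. The first bound is independent of K.\<close>

lemma pingpong_separation:
  assumes a: "inverse_isometries a a'" and b: "inverse_isometries b b'"
    and ba: "\<And>i j. gromov_product x0 ((b ^^ i) x0) ((a ^^ j) x0) \<le> c"
    and b'a: "\<And>i j. gromov_product x0 ((b' ^^ i) x0) ((a ^^ j) x0) \<le> c"
    and a'b: "\<And>i j. gromov_product x0 ((a' ^^ i) x0) ((b ^^ j) x0) \<le> c"
    and la: "\<And>i. 0 < i \<Longrightarrow> 2 * c + 4 * \<delta> + 1 \<le> dist x0 ((a ^^ i) x0)"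
    and lb: "\<And>i. 0 < i \<Longrightarrow> 2 * c + 4 * \<delta> + 1 \<le> dist x0 ((b ^^ i) x0)"
    and K: "0 < K"
  shows "i < j \<Longrightarrow> gromov_product x0 ((a ^^ i) ((b ^^ K) ((a ^^ k) x0))) ((a ^^ j) ((b ^^ K) ((a ^^ l) x0)))
      \<le> c + 2 * \<delta> + dist x0 ((a ^^ i) x0)"
    and "0 < i \<Longrightarrow> 0 < k \<Longrightarrow> dist x0 ((b ^^ K) x0) \<le> dist x0 ((a ^^ i) ((b ^^ K) ((a ^^ k) x0)))"
proof -
  have c0: "0 \<le> c" using order_trans[OF gromov_product_nonneg ba] .
  have fa: "inverse_isometries (a ^^ i) (a' ^^ i)" for i by (rule inverse_isometries_funpow[OF a])
  have fb: "inverse_isometries (b ^^ i) (b' ^^ i)" for i by (rule inverse_isometries_funpow[OF b])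
  have bK: "gromov_product ((b ^^ K) x0) x0 ((b ^^ K) ((a ^^ k) x0)) \<le> c" for k
    using b'a by (simp add: inverse_isometries_gromov_product[OF fb])
  have far_b: "c + \<delta> < gromov_product x0 ((b ^^ K) x0) ((b ^^ K) ((a ^^ k) x0))" for k
    using bK[of k] gromov_product_complement[of x0 "(b ^^ K) x0" "(b ^^ K) ((a ^^ k) x0)"] lb[OF K]
      c0 delta_nonneg by linarith
  have turn: "gromov_product ((a ^^ i) x0) x0 ((a ^^ i) ((b ^^ K) ((a ^^ k) x0))) \<le> c + \<delta>" for i k
    using gromov_product_transfer[OF a'b far_b, of i k] by (simp add: inverse_isometries_gromov_product[OF fa])
  show "gromov_product x0 ((a ^^ i) ((b ^^ K) ((a ^^ k) x0))) ((a ^^ j) ((b ^^ K) ((a ^^ l) x0)))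
      \<le> c + 2 * \<delta> + dist x0 ((a ^^ i) x0)" if ij: "i < j"
  proof -
    obtain d where d: "0 < d" "j = i + d" using ij less_imp_add_positive by metis
    define X where "X = (b ^^ K) ((a ^^ k) x0)"
    define Y where "Y = (a ^^ d) ((b ^^ K) ((a ^^ l) x0))"
    have "gromov_product x0 ((a ^^ d) x0) ((b ^^ K) x0) \<le> c"
      using ba[of K d] by (simp add: gromov_product_commute)
    from gromov_product_transfer[OF this far_b]
    have "gromov_product x0 X ((a ^^ d) x0) \<le> c + \<delta>" by (simp add: X_def gromov_product_commute)
    moreover have "c + \<delta> + \<delta> < gromov_product x0 ((a ^^ d) x0) Y"
      using turn[of d l] gromov_product_complement[of x0 "(a ^^ d) x0" Y] la[OF d(1)] c0 delta_nonneg
      unfolding Y_def by linarith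
    ultimately have XY: "gromov_product x0 X Y \<le> c + \<delta> + \<delta>"
      by (rule gromov_product_transfer)
    have "gromov_product x0 ((a ^^ i) X) ((a ^^ i) Y) \<le>
        gromov_product ((a ^^ i) x0) ((a ^^ i) X) ((a ^^ i) Y) + dist x0 ((a ^^ i) x0)"
      by (rule gromov_product_change_base)
    also have "gromov_product ((a ^^ i) x0) ((a ^^ i) X) ((a ^^ i) Y) = gromov_product x0 X Y"
      using fa by (intro isometry_gromov_product) (simp add: inverse_isometries_def)
    finally show ?thesis using XY by (simp add: X_def Y_def d(2) funpow_add)
  qed
  show "dist x0 ((b ^^ K) x0) \<le> dist x0 ((a ^^ i) ((b ^^ K) ((a ^^ k) x0)))" if "0 < i" "0 < k"
  proof -
    define X where "X = (b ^^ K) ((a ^^ k) x0)"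
    have "dist ((b ^^ K) x0) X = dist x0 ((a ^^ k) x0)"
      unfolding X_def using fb[of K] by (intro isometry_dist) (simp add: inverse_isometries_def)
    then have "dist x0 ((b ^^ K) x0) \<le> dist x0 X"
      using bK[of k] la[OF \<open>0 < k\<close>] dist_gromov_product[of x0 X "(b ^^ K) x0"] delta_nonneg
      unfolding X_def by (simp add: dist_commute)
    moreover have "dist ((a ^^ i) x0) ((a ^^ i) X) = dist x0 X"
      using fa[of i] by (intro isometry_dist) (simp add: inverse_isometries_def)
    ultimately show ?thesis
      using turn[of i k] la[OF \<open>0 < i\<close>] dist_gromov_product[of x0 "(a ^^ i) X" "(a ^^ i) x0"] delta_nonneg
      unfolding X_def by (simp add: dist_commute)
  qed
qed

text \<open>The words \<open>a\<^sup>i b\<^sup>K a\<^sup>4\<^sup>9\<^sup>-\<^sup>i\<close>: they have the same letter counts, so that all are reached by the walk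
  at the same time; \<open>i\<close> determines the direction of the word and \<open>49 - i\<close> that of its inverse,
  up to an error independent of \<open>K\<close>.\<close>

lemma schottky_exists:
  assumes a: "inverse_isometries a a'" and b: "inverse_isometries b b'"
    and sep: "\<And>u v i j. u \<in> {a, a'} \<Longrightarrow> v \<in> {b, b'} \<Longrightarrow>
      gromov_product x0 ((u ^^ i) x0) ((v ^^ j) x0) \<le> c"
    and la: "\<And>i. 0 < i \<Longrightarrow> 2 * c + 4 * \<delta> + 1 \<le> dist x0 ((a ^^ i) x0)"
    and lb: "\<And>i. 0 < i \<Longrightarrow> 2 * c + 4 * \<delta> + 1 \<le> dist x0 ((b ^^ i) x0)"
    and lb': "\<And>i. real i \<le> dist x0 ((b ^^ i) x0)"
  shows "\<exists>K C D. 0 < K \<and> schottky \<delta> x0 ((\<lambda>i. (a ^^ i) \<circ> (b ^^ K) \<circ> (a ^^ (49 - i))) ` {1..48}) C D"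
proof -
  define M where "M = (\<Sum>i\<le>49. dist x0 ((a ^^ i) x0))"
  \<comment> \<open>Products of two different words are at most c + 2\<delta> + M; one more \<delta>
    ensures that at most one word exceeds C against a given z.\<close>
  define C where "C = c + 3 * \<delta> + M"
  define D where "D = 4 * C + 4 * \<delta> + 1"
  \<comment> \<open>K is chosen last: neither C nor D depends on it, and it makes all words at least
    D long.\<close>
  obtain K0 :: nat where K0: "D \<le> real K0" using real_arch_simple by blast
  define K where "K = Suc K0"
  have K: "0 < K" "D \<le> real K" using K0 by (simp_all add: K_def)
  have c0: "0 \<le> c" using order_trans[OF gromov_product_nonneg sep[of a b]] by simp
  have M: "dist x0 ((a ^^ i) x0) \<le> M" if "i \<le> 49" for i
    unfolding M_def using that by (intro member_le_sum) auto
  have C0: "0 \<le> C" using c0 delta_nonneg M[of 0] by (simp add: C_def)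
  have sep': "gromov_product x0 ((v ^^ j) x0) ((u ^^ i) x0) \<le> c" if "u \<in> {a, a'}" "v \<in> {b, b'}" for u v i j
    using sep[OF that] by (simp add: gromov_product_commute)
  have da: "dist x0 ((a' ^^ i) x0) = dist x0 ((a ^^ i) x0)" for i
    by (rule inverse_isometries_dist[OF inverse_isometries_funpow[OF a]])
  have db: "dist x0 ((b' ^^ i) x0) = dist x0 ((b ^^ i) x0)" for i
    by (rule inverse_isometries_dist[OF inverse_isometries_funpow[OF b]])
  define s where "s i = (a ^^ i) \<circ> (b ^^ K) \<circ> (a ^^ (49 - i))" for i
  define s' where "s' i = (a' ^^ (49 - i)) \<circ> ((b' ^^ K) \<circ> (a' ^^ i))" for i
  have inv: "inverse_isometries (s i) (s' i)" for i
    unfolding s_def s'_def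
    by (intro inverse_isometries_comp inverse_isometries_funpow a b)
  have src: "gromov_product x0 (s i x0) (s j x0) \<le> C - \<delta>" if "i < j" "j \<le> 49" for i j
  proof -
    have "gromov_product x0 (s i x0) (s j x0) \<le> c + 2 * \<delta> + dist x0 ((a ^^ i) x0)"
      unfolding s_def comp_apply
      by (rule pingpong_separation(1)[OF a b]) (use sep sep' la lb K that in auto)
    then show ?thesis using M[of i] that by (simp add: C_def)
  qed
  \<comment> \<open>Inverse words have the same shape with \<open>49 - i\<close> in place of i,
    which reverses the order of the indices.\<close>
  have tgt: "gromov_product x0 (s' i x0) (s' j x0) \<le> C - \<delta>" if "i < j" "j \<le> 49" for i j
  proof -
    have "gromov_product x0 (s' j x0) (s' i x0) \<le> c + 2 * \<delta> + dist x0 ((a' ^^ (49 - j)) x0)"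
      unfolding s'_def comp_apply
      by (rule pingpong_separation(1)[OF inverse_isometries_sym[OF a] inverse_isometries_sym[OF b]])
        (use sep sep' la lb K that in \<open>auto simp: da db\<close>)
    then show ?thesis using M[of "49 - j"] by (simp add: C_def da gromov_product_commute)
  qed
  \<comment> \<open>Both exponents i and 49 - i are positive in this range, as the distance estimate
    requires.\<close>
  have long: "D \<le> dist x0 (s i x0)" if "i \<in> {1..48}" for i
  proof -
    have "dist x0 ((b ^^ K) x0) \<le> dist x0 (s i x0)"
      unfolding s_def comp_apply
      by (rule pingpong_separation(2)[OF a b]) (use sep sep' la lb K that in auto)
    then show ?thesis using lb'[of K] K(2) by linarith
  qed
  have inj: "inj_on s {1..48}"
  proof (rule linorder_inj_onI')
    fix i j :: nat assume ij: "i \<in> {1..48}" "j \<in> {1..48}" "i < j"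
    have "C < dist x0 (s i x0)" using long[OF ij(1)] C0 delta_nonneg by (simp add: D_def)
    then show "s i \<noteq> s j" using src[of i j] ij delta_nonneg by auto
  qed
  have card: "card (s ` {1..48}) = 48" using card_image[OF inj] by simp
  \<comment> \<open>One exception among 48 words is exactly the fraction allowed by the
    locale.\<close>
  have few: "card {g \<in> s ` {1..48}. P g} \<le> 1"
    if "\<And>i j. i \<in> {1..48} \<Longrightarrow> j \<in> {1..48} \<Longrightarrow> i < j \<Longrightarrow> \<not> (P (s i) \<and> P (s j))" for P
  proof -
    have "{g \<in> s ` {1..48}. P g} = {g \<in> s ` {1..48}. \<exists>i\<in>{1..48}. g = s i \<and> P (s i)}" by auto
    then show ?thesis using card_le_one_if_no_pair[of "{1..48}" "\<lambda>i. P (s i)" s] that by simp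
  qed
  have excl: "\<not> (\<not> gromov_product x0 z x \<le> C \<and> \<not> gromov_product x0 z y \<le> C)"
    if "gromov_product x0 x y \<le> C - \<delta>" for x y z
    using gromov_product_min[of x0 x z y] that by (auto simp: gromov_product_commute)
  have "schottky \<delta> x0 (s ` {1..48}) C D"
  proof (unfold_locales)
    fix g assume "g \<in> s ` {1..48}"
    then show "isometry g" "D \<le> dist x0 (g x0)"
      using inv long by (auto simp: inverse_isometries_def)
  next
    fix z
    have "card {g \<in> s ` {1..48}. \<not> gromov_product x0 z (g x0) \<le> C} \<le> 1"
      using src excl by (intro few) auto
    then show "real (card {g \<in> s ` {1..48}. \<not> gromov_product x0 z (g x0) \<le> C}) \<le> real (card (s ` {1..48})) / 48"
      unfolding card by simp
    have eq: "gromov_product (s i x0) x0 (s i z) = gromov_product x0 z (s' i x0)" for i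
      by (simp add: inverse_isometries_gromov_product[OF inv] gromov_product_commute)
    have "card {g \<in> s ` {1..48}. \<not> gromov_product (g x0) x0 (g z) \<le> C} \<le> 1"
      using tgt excl by (intro few) (auto simp: eq)
    then show "real (card {g \<in> s ` {1..48}. \<not> gromov_product (g x0) x0 (g z) \<le> C}) \<le> real (card (s ` {1..48})) / 48"
      unfolding card by simp
  qed (use C0 in \<open>auto simp: D_def\<close>)
  then show ?thesis using K(1) unfolding s_def by blast
qed

text \<open>g commutes with its powers, so it moves all points of its orbit by the same distance and
  fixes the end of the orbit.\<close>

lemma axis_class_fixed:
  assumes inv: "inverse_isometries g g'" and ray: "ray E (\<lambda>k. (g ^^ (n * k)) x0)"
  shows "gromov_equiv x0 `` {\<lambda>k. (g ^^ (n * k)) x0} \<in> boundary_fixed_points x0 g"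
    and "gromov_equiv x0 `` {\<lambda>k. (g ^^ (n * k)) x0} \<in> boundary_fixed_points x0 g'"
proof -
  have d: "dist ((g ^^ j) x0) (g ((g ^^ j) x0)) = dist x0 (g x0)" for j
    using inverse_isometries_funpow[OF inv, of j]
    by (simp add: funpow_swap1 inverse_isometries_def)
  have d': "dist ((g ^^ j) x0) (g' ((g ^^ j) x0)) = dist x0 (g x0)" for j
    using d[of j] inverse_isometries_dist[OF inv] by simp
  show "gromov_equiv x0 `` {\<lambda>k. (g ^^ (n * k)) x0} \<in> boundary_fixed_points x0 g"
    by (rule ray_class_fixed[OF ray inv, of "dist x0 (g x0)"]) (simp add: d)
  show "gromov_equiv x0 `` {\<lambda>k. (g ^^ (n * k)) x0} \<in> boundary_fixed_points x0 g'"
    by (rule ray_class_fixed[OF ray inverse_isometries_sym[OF inv], of "dist x0 (g x0)"]) (simp add: d')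
qed

lemma set_walk_pmf_funpow:
  "g \<in> set_pmf (walk_pmf P m) \<Longrightarrow> g ^^ k \<in> set_pmf (walk_pmf P (k * m))"
  by (induction k) (auto intro: set_walk_pmf_mult)

text \<open>Both ends of the orbit of g are fixed points of g, and likewise for h. Disjointness
  therefore separates each end of g from each end of h, which gives one bound c for all
  products.\<close>

lemma schottky_in_walk:
  assumes g: "g \<in> set_pmf (walk_pmf P m)" "loxodromic x0 g"
    and h: "h \<in> set_pmf (walk_pmf P l)" "loxodromic x0 h" and m: "0 < m"
    and disj: "boundary_fixed_points x0 g \<inter> boundary_fixed_points x0 h = {}"
  shows "\<exists>S C D N. 0 < N \<and> schottky \<delta> x0 S C D \<and>
    (\<forall>s\<in>S. \<forall>t\<in>S. s \<circ> t \<in> set_pmf (walk_pmf P N))"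
proof -
  obtain g' h' where inv: "inverse_isometries g g'" "inverse_isometries h h'"
    using g(2) h(2) inverse_isometries_ex unfolding loxodromic_def by blast
  note inv' = inv[THEN inverse_isometries_sym]
  obtain n E where n: "0 < n" "\<And>i j. gromov_product x0 ((g' ^^ (n * i)) x0) ((g ^^ (n * j)) x0) \<le> E"
      "\<And>i. real i \<le> dist x0 ((g ^^ (n * i)) x0)"
    using loxodromic_axis[OF g(2) inv(1)] by metis
  obtain k F where k: "0 < k" "\<And>i j. gromov_product x0 ((h' ^^ (k * i)) x0) ((h ^^ (k * j)) x0) \<le> F"
      "\<And>i. real i \<le> dist x0 ((h ^^ (k * i)) x0)"
    using loxodromic_axis[OF h(2) inv(2)] by metis
  have n': "gromov_product x0 ((g ^^ (n * i)) x0) ((g' ^^ (n * j)) x0) \<le> E"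
      "real i \<le> dist x0 ((g' ^^ (n * i)) x0)" for i j
    using n(2)[of j i] n(3)[of i] inverse_isometries_dist[OF inverse_isometries_funpow[OF inv(1)]]
    by (simp_all add: gromov_product_commute)
  have k': "gromov_product x0 ((h ^^ (k * i)) x0) ((h' ^^ (k * j)) x0) \<le> F"
      "real i \<le> dist x0 ((h' ^^ (k * i)) x0)" for i j
    using k(2)[of j i] k(3)[of i] inverse_isometries_dist[OF inverse_isometries_funpow[OF inv(2)]]
    by (simp_all add: gromov_product_commute)
  have ray: "ray E (\<lambda>i. (u ^^ (n * i)) x0)" "ray F (\<lambda>i. (v ^^ (k * i)) x0)"
    if "u \<in> {g, g'}" "v \<in> {h, h'}" for u v
    using that axis_ray[OF inv(1) n(2,3)] axis_ray[OF inv'(1) n'] axis_ray[OF inv(2) k(2,3)]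
      axis_ray[OF inv'(2) k'] by auto
  have fixed: "gromov_equiv x0 `` {\<lambda>i. (u ^^ (n * i)) x0} \<in> boundary_fixed_points x0 g"
      "gromov_equiv x0 `` {\<lambda>i. (v ^^ (k * i)) x0} \<in> boundary_fixed_points x0 h"
    if "u \<in> {g, g'}" "v \<in> {h, h'}" for u v
    using that axis_class_fixed(1)[OF inv(1)] axis_class_fixed(2)[OF inv'(1)]
      axis_class_fixed(1)[OF inv(2)] axis_class_fixed(2)[OF inv'(2)] ray[OF that] by blast+
  have "\<exists>B. \<forall>i j. gromov_product x0 ((u ^^ (n * i)) x0) ((v ^^ (k * j)) x0) \<le> B"
    if "u \<in> {g, g'}" "v \<in> {h, h'}" for u v
    using rays_separated[OF ray[OF that]] fixed[OF that] disj by (metis IntI empty_iff)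
  then obtain B where B: "\<And>u v i j. u \<in> {g, g'} \<Longrightarrow> v \<in> {h, h'} \<Longrightarrow>
      gromov_product x0 ((u ^^ (n * i)) x0) ((v ^^ (k * j)) x0) \<le> B u v" by metis
  define c where "c = Max ((\<lambda>(u, v). B u v) ` ({g, g'} \<times> {h, h'}))"
  have c: "gromov_product x0 ((u ^^ (n * i)) x0) ((v ^^ (k * j)) x0) \<le> c"
    if "u \<in> {g, g'}" "v \<in> {h, h'}" for u v i j
  proof -
    have "B u v \<le> c" unfolding c_def using that by (intro Max_ge) auto
    then show ?thesis using B[OF that, of i j] by linarith
  qed
  \<comment> \<open>c bounds the products for all powers, so passing to R-th powers makes the
    translations long without changing c.\<close>
  obtain R0 :: nat where R0: "2 * c + 4 * \<delta> + 1 \<le> real R0" using real_arch_simple by blast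
  define R where "R = Suc R0"
  have R: "2 * c + 4 * \<delta> + 1 \<le> real R" "1 \<le> R" using R0 by (auto simp: R_def)
  define a a' b b' where ab: "a = g ^^ (n * R)" "a' = g' ^^ (n * R)" "b = h ^^ (k * R)" "b' = h' ^^ (k * R)"
  have pow: "a ^^ i = g ^^ (n * (R * i))" "a' ^^ i = g' ^^ (n * (R * i))"
     "b ^^ i = h ^^ (k * (R * i))" "b' ^^ i = h' ^^ (k * (R * i))" for i
    by (simp_all add: ab funpow_mult mult.assoc)
  have big: "2 * c + 4 * \<delta> + 1 \<le> real (R * i)" if "0 < i" for i
  proof -
    have "R \<le> R * i" using that by simp
    then have "real R \<le> real (R * i)" by (simp only: of_nat_le_iff)
    then show ?thesis using R(1) by linarith
  qed
  have small: "real i \<le> real (R * i)" for i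
  proof -
    have "1 * i \<le> R * i" using R(2) by (rule mult_right_mono) simp
    then show ?thesis by (simp only: of_nat_le_iff mult_1)
  qed
  have "\<exists>K C D. 0 < K \<and> schottky \<delta> x0 ((\<lambda>i. (a ^^ i) \<circ> (b ^^ K) \<circ> (a ^^ (49 - i))) ` {1..48}) C D"
  proof (rule schottky_exists)
    show "inverse_isometries a a'" "inverse_isometries b b'"
      unfolding ab using inv by (intro inverse_isometries_funpow; simp)+
    show "gromov_product x0 ((u ^^ i) x0) ((v ^^ j) x0) \<le> c" if "u \<in> {a, a'}" "v \<in> {b, b'}" for u v i j
      using that c by (auto simp: pow)
    show "2 * c + 4 * \<delta> + 1 \<le> dist x0 ((a ^^ i) x0)" if "0 < i" for i
      unfolding pow using big[OF that] n(3)[of "R * i"] by linarith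
    show "2 * c + 4 * \<delta> + 1 \<le> dist x0 ((b ^^ i) x0)" if "0 < i" for i
      unfolding pow using big[OF that] k(3)[of "R * i"] by linarith
    show "real i \<le> dist x0 ((b ^^ i) x0)" for i
      unfolding pow using small[of i] k(3)[of "R * i"] by linarith
  qed
  then obtain K C D where K: "0 < K"
    "schottky \<delta> x0 ((\<lambda>i. (a ^^ i) \<circ> (b ^^ K) \<circ> (a ^^ (49 - i))) ` {1..48}) C D" by blast
  define N where "N = 49 * (n * R * m) + K * (k * R * l)"
  have "(a ^^ i) \<circ> (b ^^ K) \<circ> (a ^^ (49 - i)) \<in> set_pmf (walk_pmf P N)" if "i \<in> {1..48}" for i
  proof -
    have "a \<in> set_pmf (walk_pmf P (n * R * m))" "b \<in> set_pmf (walk_pmf P (k * R * l))"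
      unfolding ab using set_walk_pmf_funpow g(1) h(1) by blast+
    then have "(a ^^ i) \<circ> (b ^^ K) \<circ> (a ^^ (49 - i)) \<in>
        set_pmf (walk_pmf P (i * (n * R * m) + K * (k * R * l) + (49 - i) * (n * R * m)))"
      by (intro set_walk_pmf_mult set_walk_pmf_funpow)
    also have "i * (n * R * m) + K * (k * R * l) + (49 - i) * (n * R * m) = (i + (49 - i)) * (n * R * m) + K * (k * R * l)"
      by (simp add: add_mult_distrib)
    also have "i + (49 - i) = 49" using that by simp
    finally show ?thesis by (simp only: N_def)
  qed
  then have "\<forall>s\<in>(\<lambda>i. (a ^^ i) \<circ> (b ^^ K) \<circ> (a ^^ (49 - i))) ` {1..48}.
      \<forall>t\<in>(\<lambda>i. (a ^^ i) \<circ> (b ^^ K) \<circ> (a ^^ (49 - i))) ` {1..48}. s \<circ> t \<in> set_pmf (walk_pmf P (N + N))"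
    by (blast intro: set_walk_pmf_mult)
  moreover have "0 < N + N" using n(1) m R(2) by (simp add: N_def)
  ultimately show ?thesis using K(2) by blast
qed

end

section \<open>Ergodic averages\<close>

lemma liminf_limsup_le_asymp:
  fixes u v p q :: "nat \<Rightarrow> real"
  assumes le: "\<And>n. 0 < n \<Longrightarrow> u n \<le> p n * v n + q n" and p: "p \<longlonglongrightarrow> 1" and q: "q \<longlonglongrightarrow> 0"
  shows "liminf (\<lambda>n. ereal (u n)) \<le> liminf (\<lambda>n. ereal (v n))"
    and "limsup (\<lambda>n. ereal (u n)) \<le> limsup (\<lambda>n. ereal (v n))"
proof -
  have ev: "\<forall>\<^sub>F n in sequentially. ereal (u n) \<le> ereal (q n) + ereal (p n) * ereal (v n)"
    using eventually_gt_at_top[of 0] by eventually_elim (use le in \<open>simp add: add.commute\<close>)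
  have p': "(\<lambda>n. ereal (p n)) \<longlonglongrightarrow> 1" and q': "(\<lambda>n. ereal (q n)) \<longlonglongrightarrow> 0"
    using p q by (simp_all add: one_ereal_def zero_ereal_def)
  have "liminf (\<lambda>n. ereal (u n)) \<le> liminf (\<lambda>n. ereal (q n) + ereal (p n) * ereal (v n))"
    by (rule Liminf_mono[OF ev])
  also have "\<dots> = 0 + liminf (\<lambda>n. ereal (p n) * ereal (v n))"
    by (rule ereal_liminf_lim_add[OF q']) simp
  also have "liminf (\<lambda>n. ereal (p n) * ereal (v n)) = 1 * liminf (\<lambda>n. ereal (v n))"
    by (rule ereal_liminf_lim_mult[OF p']) simp_all
  finally show "liminf (\<lambda>n. ereal (u n)) \<le> liminf (\<lambda>n. ereal (v n))" by simp
  have "limsup (\<lambda>n. ereal (u n)) \<le> limsup (\<lambda>n. ereal (q n) + ereal (p n) * ereal (v n))"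
    by (rule Limsup_mono[OF ev])
  also have "\<dots> = 0 + limsup (\<lambda>n. ereal (p n) * ereal (v n))"
    by (rule ereal_limsup_lim_add[OF q']) simp
  also have "limsup (\<lambda>n. ereal (p n) * ereal (v n)) = 1 * limsup (\<lambda>n. ereal (v n))"
    by (rule ereal_limsup_lim_mult[OF p']) simp_all
  finally show "limsup (\<lambda>n. ereal (u n)) \<le> limsup (\<lambda>n. ereal (v n))" by simp
qed

text \<open>Source of shift invariance: with a taken along an orbit and b along the shifted orbit,
  dropping one step changes the numerator by a bounded amount.\<close>

lemma liminf_limsup_average_shift:
  fixes a b :: "nat \<Rightarrow> real"
  assumes c: "\<And>n. \<bar>a (Suc n) - b n\<bar> \<le> c"
  shows "liminf (\<lambda>n. ereal (a n / real n)) = liminf (\<lambda>n. ereal (b n / real n))"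
    and "limsup (\<lambda>n. ereal (a n / real n)) = limsup (\<lambda>n. ereal (b n / real n))"
proof -
  define x where "x n = a (Suc n) / real (Suc n)" for n
  have 1: "b n / real n \<le> real (Suc n) / real n * x n + c / real n" if "0 < n" for n
    using c[of n] that by (simp add: x_def add_divide_distrib[symmetric] divide_right_mono abs_le_iff)
  have 2: "x n \<le> real n / real (Suc n) * (b n / real n) + c / real (Suc n)" if "0 < n" for n
    using c[of n] that
    by (simp add: x_def add_divide_distrib[symmetric] abs_le_iff del: of_nat_Suc) (auto intro!: divide_right_mono)
  have l: "(\<lambda>n. real (Suc n) / real n) \<longlonglongrightarrow> 1" "(\<lambda>n. real n / real (Suc n)) \<longlonglongrightarrow> 1"
    "(\<lambda>n. c / real n) \<longlonglongrightarrow> 0" "(\<lambda>n. c / real (Suc n)) \<longlonglongrightarrow> 0"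
    by real_asymp+
  note A = liminf_limsup_le_asymp[OF 1 l(1,3)] and B = liminf_limsup_le_asymp[OF 2 l(2,4)]
  have "liminf (\<lambda>n. ereal (a n / real n)) = liminf (\<lambda>n. ereal (x n))"
    "limsup (\<lambda>n. ereal (a n / real n)) = limsup (\<lambda>n. ereal (x n))"
    using liminf_shift[of "\<lambda>n. ereal (a n / real n)"] limsup_shift[of "\<lambda>n. ereal (a n / real n)"]
    by (simp_all add: x_def)
  then show "liminf (\<lambda>n. ereal (a n / real n)) = liminf (\<lambda>n. ereal (b n / real n))"
    "limsup (\<lambda>n. ereal (a n / real n)) = limsup (\<lambda>n. ereal (b n / real n))"
    using A B by (metis order_antisym)+
qed

lemma sum_lessThan_add:
  "(\<Sum>i<n + k. f i) = (\<Sum>i<n. f i) + (\<Sum>i<k. f (n + i) :: real)" for n k :: nat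
  by (induction k) (simp_all add: ac_simps)

text \<open>The greedy covering behind the ergodic theorems (Katznelson--Weiss): cut the orbit at times
  where \<open>Y\<close> is nonpositive; only the points of \<open>B\<close> and the last \<open>N\<close> steps contribute.\<close>

lemma greedy_covering:
  fixes Y :: "nat \<Rightarrow> 'b \<Rightarrow> real" and b :: "'b \<Rightarrow> real"
  assumes T: "\<And>\<omega>. \<omega> \<in> \<Omega> \<Longrightarrow> T \<omega> \<in> \<Omega>"
    and sub: "\<And>n m \<omega>. \<omega> \<in> \<Omega> \<Longrightarrow> 0 < n \<Longrightarrow> Y (n + m) \<omega> \<le> Y n \<omega> + Y m ((T ^^ n) \<omega>)"
    and Y0: "\<And>\<omega>. Y 0 \<omega> \<le> 0"
    and Y1: "\<And>\<omega>. \<omega> \<in> \<Omega> \<Longrightarrow> Y 1 \<omega> \<le> b \<omega>" and b: "\<And>\<omega>. \<omega> \<in> \<Omega> \<Longrightarrow> 0 \<le> b \<omega>"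
    and good: "\<And>\<omega>. \<omega> \<in> \<Omega> \<Longrightarrow> \<omega> \<notin> B \<Longrightarrow> \<exists>n. 0 < n \<and> n \<le> N \<and> Y n \<omega> \<le> 0"
  shows "\<omega> \<in> \<Omega> \<Longrightarrow> Y m \<omega> \<le>
    (\<Sum>i<m. (indicator B ((T ^^ i) \<omega>) + (if m - i \<le> N then 1 else 0)) * b ((T ^^ i) \<omega>))"
proof (induction m arbitrary: \<omega> rule: less_induct)
  case (less m)
  define \<phi> where "\<phi> k \<omega> = (indicator B \<omega> + (if k \<le> N then 1 else 0)) * b \<omega>" for k :: nat and \<omega>
  have \<phi>: "0 \<le> \<phi> k \<omega>" if "\<omega> \<in> \<Omega>" for k \<omega> using b[OF that] by (simp add: \<phi>_def)
  have Tn: "(T ^^ n) \<omega> \<in> \<Omega>" if "\<omega> \<in> \<Omega>" for n \<omega> using that by (induction n) (auto intro: T)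
  have cut: "Y m \<omega> \<le> (\<Sum>i<m. \<phi> (m - i) ((T ^^ i) \<omega>))"
    if n: "0 < n" "n \<le> m" and Y: "Y n \<omega> \<le> (\<Sum>i<n. \<phi> (m - i) ((T ^^ i) \<omega>))" for n
  proof -
    obtain k where m: "m = n + k" using n(2) le_Suc_ex by blast
    have "Y m \<omega> \<le> Y n \<omega> + Y k ((T ^^ n) \<omega>)" unfolding m using sub less.prems n(1) by blast
    also have "Y k ((T ^^ n) \<omega>) \<le> (\<Sum>i<k. \<phi> (k - i) ((T ^^ i) ((T ^^ n) \<omega>)))"
      using less.IH[of k "(T ^^ n) \<omega>"] Tn less.prems m n(1) by (simp add: \<phi>_def)
    also have "\<dots> = (\<Sum>i<k. \<phi> (m - (n + i)) ((T ^^ (n + i)) \<omega>))"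
    proof -
      have "(T ^^ (n + i)) \<omega> = (T ^^ i) ((T ^^ n) \<omega>)" for i
        by (metis add.commute comp_apply funpow_add)
      then show ?thesis by (simp add: m)
    qed
    finally show ?thesis using Y unfolding m sum_lessThan_add by simp
  qed
  have "Y m \<omega> \<le> (\<Sum>i<m. \<phi> (m - i) ((T ^^ i) \<omega>))"
  proof (cases "m = 0")
    case False
    \<comment> \<open>A point of B, or a stretch of length at most N, is passed by a single step
      that pays b; from any other point one jumps to a time at most N < m at which Y is
      nonpositive.\<close>
    show ?thesis
    proof (cases "\<omega> \<in> B \<or> m \<le> N")
      case True
      then have "b \<omega> \<le> \<phi> m \<omega>" using b[OF less.prems] by (auto simp: \<phi>_def indicator_def)
      then have "Y 1 \<omega> \<le> (\<Sum>i<1. \<phi> (m - i) ((T ^^ i) \<omega>))" using Y1[OF less.prems] by simp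
      with cut[of 1] False show ?thesis by simp
    next
      case False
      then obtain n where n: "0 < n" "n \<le> N" "Y n \<omega> \<le> 0" using good less.prems by blast
      have "0 \<le> (\<Sum>i<n. \<phi> (m - i) ((T ^^ i) \<omega>))" by (intro sum_nonneg \<phi> Tn less.prems)
      with cut[of n] n False show ?thesis by simp
    qed
  qed (use Y0 in simp)
  then show ?case by (simp add: \<phi>_def)
qed

section \<open>Measure-preserving maps\<close>

locale measure_preserving_map = prob_space M for M :: "'b measure" +
  fixes T :: "'b \<Rightarrow> 'b"
  assumes T_measurable [measurable]: "T \<in> measurable M M"
    and T_preserves: "distr M M T = M"
begin

lemma T_space: "\<omega> \<in> space M \<Longrightarrow> T \<omega> \<in> space M"
  using T_measurable by (rule measurable_space)

lemma funpow_measurable [measurable]: "T ^^ n \<in> measurable M M"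
proof (induction n)
  case (Suc n)
  then show ?case using measurable_comp[OF Suc T_measurable] by simp
qed simp

lemma funpow_space: "\<omega> \<in> space M \<Longrightarrow> (T ^^ n) \<omega> \<in> space M"
  using funpow_measurable by (rule measurable_space)

lemma funpow_preserves: "distr M M (T ^^ n) = M"
proof (induction n)
  case (Suc n)
  have "distr M M (T ^^ Suc n) = distr (distr M M (T ^^ n)) M T"
    by (simp add: distr_distr)
  then show ?case by (simp only: Suc T_preserves)
qed (simp add: distr_id[unfolded id_def] id_def)

lemma integrable_funpow:
  "integrable M f \<Longrightarrow> integrable M (\<lambda>\<omega>. f ((T ^^ n) \<omega>) :: real)"
  using integrable_distr[of "T ^^ n" M M f] funpow_preserves by simp

lemma integral_funpow:
  "f \<in> borel_measurable M \<Longrightarrow> (\<integral>\<omega>. f ((T ^^ n) \<omega>) \<partial>M) = (\<integral>\<omega>. f \<omega> \<partial>M :: real)"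
  using integral_distr[of "T ^^ n" M M f] funpow_preserves by simp

text \<open>The covering bound is integrated. By invariance each of the m steps pays the integral of
  b over \<open>B N\<close>, below \<epsilon>/2 for large N by dominated convergence; the last N
  steps pay at most N times the expectation of b, which a large m absorbs.\<close>

lemma subadditive_expectation_le:
  fixes Y :: "nat \<Rightarrow> 'b \<Rightarrow> real"
  assumes Y: "\<And>n. integrable M (Y n)" and bi: "integrable M b"
    and sub: "\<And>n m \<omega>. \<omega> \<in> space M \<Longrightarrow> 0 < n \<Longrightarrow> Y (n + m) \<omega> \<le> Y n \<omega> + Y m ((T ^^ n) \<omega>)"
    and Y0: "\<And>\<omega>. Y 0 \<omega> \<le> 0"
    and Y1: "\<And>\<omega>. \<omega> \<in> space M \<Longrightarrow> Y 1 \<omega> \<le> b \<omega>" and b: "\<And>\<omega>. \<omega> \<in> space M \<Longrightarrow> 0 \<le> b \<omega>"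
    and ae: "AE \<omega> in M. \<exists>n>0. Y n \<omega> \<le> 0" and \<epsilon>: "0 < \<epsilon>"
  shows "\<exists>m>0. expectation (Y m) \<le> real m * \<epsilon>"
proof -
  have [measurable]: "\<And>n. Y n \<in> borel_measurable M" "b \<in> borel_measurable M"
    using Y bi by auto
  define B where "B N = {\<omega>\<in>space M. \<forall>n\<in>{1..N}. 0 < Y n \<omega>}" for N :: nat
  have B[measurable]: "B N \<in> sets M" for N unfolding B_def by measurable
  have "(\<lambda>N. \<integral>\<omega>. indicator (B N) \<omega> * b \<omega> \<partial>M) \<longlonglongrightarrow> (\<integral>\<omega>. 0 \<partial>M)"
  proof (rule integral_dominated_convergence[where w = b])
    show "AE \<omega> in M. (\<lambda>N. indicator (B N) \<omega> * b \<omega>) \<longlonglongrightarrow> 0"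
      using ae
    proof eventually_elim
      case (elim \<omega>)
      then obtain n where n: "0 < n" "Y n \<omega> \<le> 0" by blast
      have "\<forall>\<^sub>F N in sequentially. indicator (B N) \<omega> * b \<omega> = 0"
        using eventually_ge_at_top[of n]
      proof eventually_elim
        case (elim N)
        then have "\<omega> \<notin> B N" using n unfolding B_def by (auto intro!: bexI[of _ n])
        then show ?case by simp
      qed
      then show ?case by (rule tendsto_eventually)
    qed
    show "AE \<omega> in M. norm (indicator (B N) \<omega> * b \<omega>) \<le> b \<omega>" for N
      using b by (intro AE_I2) (auto simp: indicator_def)
  qed (use bi in auto)
  then have "(\<lambda>N. \<integral>\<omega>. indicator (B N) \<omega> * b \<omega> \<partial>M) \<longlonglongrightarrow> 0" by simp
  then have "\<forall>\<^sub>F N in sequentially. (\<integral>\<omega>. indicator (B N) \<omega> * b \<omega> \<partial>M) < \<epsilon> / 2"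
    using \<epsilon> by (intro order_tendstoD(2)) auto
  then obtain N where N: "(\<integral>\<omega>. indicator (B N) \<omega> * b \<omega> \<partial>M) < \<epsilon> / 2"
    by (auto simp: eventually_sequentially)
  define e where "e = (\<integral>\<omega>. indicator (B N) \<omega> * b \<omega> \<partial>M)"
  have e_int: "integrable M (\<lambda>\<omega>. indicator (B N) \<omega> * b \<omega>)"
    using integrable_mult_indicator[OF B bi] by simp
  have Eb: "0 \<le> expectation b" using b by (intro integral_nonneg_AE AE_I2) auto
  obtain m0 :: nat where m0: "real N * expectation b / (\<epsilon> / 2) \<le> real m0" using real_arch_simple by blast
  define m where "m = Suc m0"
  have m: "real N * expectation b \<le> real m * (\<epsilon> / 2)"
  proof -
    have "real N * expectation b \<le> real m0 * (\<epsilon> / 2)"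
      using m0 \<epsilon> by (subst (asm) pos_divide_le_eq) simp_all
    also have "\<dots> \<le> real m * (\<epsilon> / 2)" using \<epsilon> by (intro mult_right_mono) (simp_all add: m_def)
    finally show ?thesis .
  qed
  define \<phi> where "\<phi> k \<omega> = (indicator (B N) \<omega> + (if k \<le> N then 1 else 0)) * b \<omega>" for k :: nat and \<omega>
  have \<phi>_int: "integrable M (\<phi> k)" for k
    unfolding \<phi>_def distrib_right using e_int bi by (intro Bochner_Integration.integrable_add) auto
  have \<phi>_exp: "expectation (\<phi> k) = e + (if k \<le> N then expectation b else 0)" for k
    unfolding \<phi>_def distrib_right e_def using e_int bi by (subst Bochner_Integration.integral_add) auto
  have "Y m \<omega> \<le> (\<Sum>i<m. \<phi> (m - i) ((T ^^ i) \<omega>))" if "\<omega> \<in> space M" for \<omega>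
    unfolding \<phi>_def
  proof (rule greedy_covering[OF T_space sub Y0 Y1 b _ that])
    fix \<omega> assume "\<omega> \<in> space M" "\<omega> \<notin> B N"
    then obtain n where "n \<in> {1..N}" "\<not> 0 < Y n \<omega>" unfolding B_def by blast
    then show "\<exists>n. 0 < n \<and> n \<le> N \<and> Y n \<omega> \<le> 0" by (intro exI[of _ n]) auto
  qed
  then have "expectation (Y m) \<le> (\<integral>\<omega>. (\<Sum>i<m. \<phi> (m - i) ((T ^^ i) \<omega>)) \<partial>M)"
    using Y \<phi>_int by (intro integral_mono Bochner_Integration.integrable_sum integrable_funpow) auto
  also have "\<dots> = (\<Sum>i<m. expectation (\<phi> (m - i)))"
    using \<phi>_int integral_funpow[OF borel_measurable_integrable[OF \<phi>_int]]
    by (subst Bochner_Integration.integral_sum) (auto intro: integrable_funpow)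
  also have "\<dots> = real m * e + (\<Sum>i<m. if m - i \<le> N then expectation b else 0)"
    by (simp add: \<phi>_exp sum.distrib)
  also have "(\<Sum>i<m. if m - i \<le> N then expectation b else 0) = real (card {i\<in>{..<m}. m - i \<le> N}) * expectation b"
    by (subst sum.inter_filter[symmetric]) simp_all
  also have "\<dots> \<le> real N * expectation b"
  proof (intro mult_right_mono Eb)
    have "{i\<in>{..<m}. m - i \<le> N} \<subseteq> {m - N..<m}" by auto
    then have "card {i\<in>{..<m}. m - i \<le> N} \<le> card {m - N..<m}" by (intro card_mono) auto
    then show "real (card {i\<in>{..<m}. m - i \<le> N}) \<le> real N" by simp
  qed
  also have "real m * e + real N * expectation b \<le> real m * (\<epsilon> / 2) + real m * (\<epsilon> / 2)"
    using N m by (intro add_mono mult_left_mono) (auto simp: e_def)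
  also have "\<dots> = real m * \<epsilon>" by simp
  finally show ?thesis by (intro exI[of _ m]) (simp add: m_def)
qed

definition birkhoff_sum :: "('b \<Rightarrow> real) \<Rightarrow> nat \<Rightarrow> 'b \<Rightarrow> real" where
  "birkhoff_sum f n \<omega> = (\<Sum>i<n. f ((T ^^ i) \<omega>))"

lemma birkhoff_sum_add:
  "birkhoff_sum f (n + m) \<omega> = birkhoff_sum f n \<omega> + birkhoff_sum f m ((T ^^ n) \<omega>)"
proof -
  have "(T ^^ (n + i)) \<omega> = (T ^^ i) ((T ^^ n) \<omega>)" for i
    by (metis add.commute comp_apply funpow_add)
  then show ?thesis by (simp add: birkhoff_sum_def sum_lessThan_add)
qed

lemma birkhoff_sum_measurable [measurable]:
  assumes [measurable]: "f \<in> borel_measurable M" shows "birkhoff_sum f n \<in> borel_measurable M"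
  unfolding birkhoff_sum_def[abs_def] by measurable

lemma integrable_birkhoff_sum: "integrable M f \<Longrightarrow> integrable M (birkhoff_sum f n)"
  unfolding birkhoff_sum_def[abs_def] by (intro Bochner_Integration.integrable_sum integrable_funpow)

lemma expectation_birkhoff_sum:
  "integrable M f \<Longrightarrow> expectation (birkhoff_sum f n) = real n * expectation f"
  unfolding birkhoff_sum_def[abs_def]
  by (subst Bochner_Integration.integral_sum) (auto simp: integrable_funpow integral_funpow)

text \<open>A maximal inequality, obtained from the covering bound for the process nR minus the
  Birkhoff sum, with the constant R as b.\<close>

lemma expectation_ge_of_birkhoff_sum_ge:
  assumes f: "integrable M f" "\<And>\<omega>. \<omega> \<in> space M \<Longrightarrow> 0 \<le> f \<omega>" and R: "0 \<le> R"
    and ae: "AE \<omega> in M. \<exists>n>0. real n * R \<le> birkhoff_sum f n \<omega>"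
  shows "R \<le> expectation f"
proof (rule field_le_epsilon)
  fix \<epsilon> :: real assume \<epsilon>: "0 < \<epsilon>"
  have "\<exists>m>0. expectation (\<lambda>\<omega>. real m * R - birkhoff_sum f m \<omega>) \<le> real m * \<epsilon>"
  proof (rule subadditive_expectation_le[where b = "\<lambda>_. R"])
    show "AE \<omega> in M. \<exists>n>0. real n * R - birkhoff_sum f n \<omega> \<le> 0" using ae by simp
    show "real 1 * R - birkhoff_sum f 1 \<omega> \<le> R" if "\<omega> \<in> space M" for \<omega>
      using f(2)[OF that] by (simp add: birkhoff_sum_def)
    show "real 0 * R - birkhoff_sum f 0 \<omega> \<le> 0" for \<omega> by (simp add: birkhoff_sum_def)
  qed (use f R \<epsilon> in \<open>auto intro!: integrable_birkhoff_sum simp: birkhoff_sum_add algebra_simps\<close>)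
  then obtain m where m: "0 < m" "expectation (\<lambda>\<omega>. real m * R - birkhoff_sum f m \<omega>) \<le> real m * \<epsilon>" by blast
  have "expectation (\<lambda>\<omega>. real m * R - birkhoff_sum f m \<omega>) = real m * R - real m * expectation f"
    using f(1) by (subst Bochner_Integration.integral_diff)
      (auto intro: integrable_birkhoff_sum simp: expectation_birkhoff_sum prob_space)
  then have "real m * R \<le> real m * (expectation f + \<epsilon>)" using m(2) by (simp add: algebra_simps)
  then show "R \<le> expectation f + \<epsilon>" using m(1) by simp
qed

end

section \<open>Ergodic maps and the upper half of Birkhoff's theorem\<close>

locale ergodic_map = measure_preserving_map +
  assumes ergodic: "\<And>E. E \<in> sets M \<Longrightarrow> (\<And>\<omega>. \<omega> \<in> space M \<Longrightarrow> T \<omega> \<in> E \<longleftrightarrow> \<omega> \<in> E) \<Longrightarrow>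
    prob E = 0 \<or> prob E = 1"
begin

text \<open>Superlevel sets at rational thresholds are invariant, hence of measure 0 or 1; a point
  typical for all of these countably many sets has the almost sure value.\<close>

lemma invariant_AE_constant:
  fixes Z :: "'a \<Rightarrow> ereal"
  assumes [measurable]: "Z \<in> borel_measurable M" and inv: "\<And>\<omega>. \<omega> \<in> space M \<Longrightarrow> Z (T \<omega>) = Z \<omega>"
  shows "\<exists>c. AE \<omega> in M. Z \<omega> = c"
proof -
  define E where "E q = {\<omega>\<in>space M. ereal (of_rat q) < Z \<omega>}" for q
  have E[measurable]: "E q \<in> sets M" for q unfolding E_def by measurable
  have "prob (E q) = 0 \<or> prob (E q) = 1" for q
    using inv T_space by (intro ergodic E) (auto simp: E_def)
  then have "AE \<omega> in M. \<omega> \<in> E q \<longleftrightarrow> prob (E q) = 1" for q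
    using prob_eq_0[OF E, of q] AE_prob_1[of "E q"] by (cases "prob (E q) = 1") auto
  then have ae: "AE \<omega> in M. \<forall>q. \<omega> \<in> E q \<longleftrightarrow> prob (E q) = 1"
    by (subst AE_all_countable) blast
  have "\<exists>\<omega>0\<in>space M. \<forall>q. \<omega>0 \<in> E q \<longleftrightarrow> prob (E q) = 1"
  proof (rule ccontr)
    assume "\<not> ?thesis"
    then have no: "\<not> (\<forall>q. \<omega> \<in> E q \<longleftrightarrow> prob (E q) = 1)" if "\<omega> \<in> space M" for \<omega> using that by blast
    from ae AE_space have "AE \<omega> in M. False" by eventually_elim (use no in blast)
    then show False by simp
  qed
  then obtain \<omega>0 where \<omega>0: "\<omega>0 \<in> space M" "\<forall>q. \<omega>0 \<in> E q \<longleftrightarrow> prob (E q) = 1"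
    by blast
  have "AE \<omega> in M. Z \<omega> = Z \<omega>0"
    using ae AE_space
  proof eventually_elim
    case (elim \<omega>)
    then have "ereal (of_rat q) < Z \<omega> \<longleftrightarrow> ereal (of_rat q) < Z \<omega>0" for q
      using \<omega>0 by (auto simp: E_def)
    then show ?case by (metis ereal_dense3 less_asym linorder_neqE)
  qed
  then show ?thesis by blast
qed

text \<open>The limsup of the averages is almost surely constant. Were it above the expectation, any
  R in between would almost surely be reached by some average, against
  \<open>expectation_ge_of_birkhoff_sum_ge\<close>.\<close>

lemma birkhoff_sum_eventually_le:
  assumes f: "integrable M f" "\<And>\<omega>. \<omega> \<in> space M \<Longrightarrow> 0 \<le> f \<omega>" and \<epsilon>: "0 < \<epsilon>"
  shows "AE \<omega> in M. \<forall>\<^sub>F n in sequentially. birkhoff_sum f n \<omega> \<le> real n * (expectation f + \<epsilon>)"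
proof -
  have [measurable]: "f \<in> borel_measurable M" using f by auto
  define Z where "Z \<omega> = limsup (\<lambda>n. ereal (birkhoff_sum f n \<omega> / real n))" for \<omega>
  have [measurable]: "Z \<in> borel_measurable M" unfolding Z_def by measurable
  have "Z (T \<omega>) = Z \<omega>" if "\<omega> \<in> space M" for \<omega>
    unfolding Z_def
    by (rule liminf_limsup_average_shift(2)[symmetric, where c = "f \<omega>"])
      (use f(2)[OF that] birkhoff_sum_add[of f 1 _ \<omega>] in \<open>simp add: birkhoff_sum_def\<close>)
  then obtain c where c: "AE \<omega> in M. Z \<omega> = c" using invariant_AE_constant[of Z] by auto
  have Ef: "0 \<le> expectation f" using f(2) by (intro integral_nonneg_AE AE_I2) auto
  have "c \<le> ereal (expectation f)"
  proof (rule ccontr)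
    assume "\<not> ?thesis"
    then obtain R where R: "ereal (expectation f) < ereal R" "ereal R < c"
      using ereal_dense2[of "ereal (expectation f)" c] by (auto simp: not_le)
    have "AE \<omega> in M. \<exists>n>0. real n * R \<le> birkhoff_sum f n \<omega>"
      using c
    proof eventually_elim
      case (elim \<omega>)
      show ?case
      proof (rule ccontr)
        assume "\<not> ?thesis"
        then have "\<forall>\<^sub>F n in sequentially. ereal (birkhoff_sum f n \<omega> / real n) \<le> ereal R"
          by (intro eventually_mono[OF eventually_gt_at_top[of 0]])
            (auto simp: divide_le_eq mult.commute not_le, metis less_imp_le not_gr_zero)
        then have "Z \<omega> \<le> ereal R" unfolding Z_def by (rule Limsup_bounded)
        with R(2) elim show False by simp
      qed
    qed
    from expectation_ge_of_birkhoff_sum_ge[OF f _ this] R(1) Ef show False by simp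
  qed
  then have cl: "c < ereal (expectation f + \<epsilon>)" by (rule le_less_trans) (simp add: \<epsilon>)
  show ?thesis
    using c
  proof eventually_elim
    case (elim \<omega>)
    then have "\<forall>\<^sub>F n in sequentially. ereal (birkhoff_sum f n \<omega> / real n) < ereal (expectation f + \<epsilon>)"
      using cl unfolding Z_def by (intro Limsup_lessD) auto
    then show ?case
      using eventually_gt_at_top[of 0]
      by eventually_elim (simp add: divide_less_eq mult.commute)
  qed
qed

text \<open>f is at most a constant K plus a tail of small expectation, and a single value of the
  tail is bounded by its Birkhoff sum of n + 1 terms.\<close>

lemma orbit_eventually_small:
  assumes f: "integrable M f" "\<And>\<omega>. \<omega> \<in> space M \<Longrightarrow> 0 \<le> f \<omega>" and \<epsilon>: "0 < \<epsilon>"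
  shows "AE \<omega> in M. \<forall>\<^sub>F n in sequentially. f ((T ^^ n) \<omega>) \<le> real n * \<epsilon>"
proof -
  have [measurable]: "f \<in> borel_measurable M" using f by auto
  define g where "g K \<omega> = f \<omega> * indicator {\<omega>\<in>space M. real K < f \<omega>} \<omega>" for K :: nat and \<omega>
  have [measurable]: "g K \<in> borel_measurable M" for K unfolding g_def by measurable
  have g0: "0 \<le> g K \<omega>" "f \<omega> \<le> real K + g K \<omega>" if "\<omega> \<in> space M" for K \<omega>
    using f(2)[OF that] that by (auto simp: g_def indicator_def)
  have g_int: "integrable M (g K)" for K
    by (rule Bochner_Integration.integrable_bound[OF f(1)]) (auto intro!: AE_I2 simp: g_def indicator_def)
  have "(\<lambda>K. expectation (g K)) \<longlonglongrightarrow> (\<integral>\<omega>. 0 \<partial>M)"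
  proof (rule integral_dominated_convergence[where w = f])
    show "AE \<omega> in M. (\<lambda>K. g K \<omega>) \<longlonglongrightarrow> 0"
    proof (rule AE_I2)
      fix \<omega> assume "\<omega> \<in> space M"
      obtain K0 :: nat where "f \<omega> \<le> real K0" using real_arch_simple by blast
      then have "\<forall>\<^sub>F K in sequentially. g K \<omega> = 0"
        by (intro eventually_mono[OF eventually_ge_at_top[of K0]]) (auto simp: g_def indicator_def)
      then show "(\<lambda>K. g K \<omega>) \<longlonglongrightarrow> 0" by (rule tendsto_eventually)
    qed
  qed (use f in \<open>auto intro!: AE_I2 simp: g_def indicator_def\<close>)
  then have "(\<lambda>K. expectation (g K)) \<longlonglongrightarrow> 0" by simp
  then have "\<forall>\<^sub>F K in sequentially. expectation (g K) < \<epsilon> / 4"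
    using \<epsilon> by (intro order_tendstoD(2)) auto
  then obtain K where K: "expectation (g K) < \<epsilon> / 4" by (auto simp: eventually_sequentially)
  have "AE \<omega> in M. \<forall>\<^sub>F n in sequentially. birkhoff_sum (g K) n \<omega> \<le> real n * (expectation (g K) + \<epsilon> / 4)"
    using \<epsilon> by (intro birkhoff_sum_eventually_le g_int g0) auto
  then show ?thesis
    using AE_space
  proof eventually_elim
    case (elim \<omega>)
    have "\<forall>\<^sub>F n in sequentially. birkhoff_sum (g K) (Suc n) \<omega> \<le> real (Suc n) * (expectation (g K) + \<epsilon> / 4)"
      using elim(1) by (subst (asm) eventually_sequentially_Suc[symmetric])
    moreover have "\<forall>\<^sub>F n in sequentially. real K + real (Suc n) * (\<epsilon> / 2) \<le> real n * \<epsilon>"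
      using \<epsilon> by real_asymp
    ultimately show ?case
    proof eventually_elim
      case (elim n)
      have "f ((T ^^ n) \<omega>) \<le> real K + g K ((T ^^ n) \<omega>)" by (intro g0 funpow_space \<open>\<omega> \<in> space M\<close>)
      also have "g K ((T ^^ n) \<omega>) \<le> birkhoff_sum (g K) (Suc n) \<omega>"
        using sum_nonneg[of "{..<n}" "\<lambda>i. g K ((T ^^ i) \<omega>)"] g0(1)[OF funpow_space[OF \<open>\<omega> \<in> space M\<close>]]
        by (simp add: birkhoff_sum_def)
      also have "\<dots> \<le> real (Suc n) * (expectation (g K) + \<epsilon> / 4)" by (rule elim(1))
      also have "\<dots> \<le> real (Suc n) * (\<epsilon> / 2)" using K by (intro mult_left_mono) auto
      finally show ?case using elim(2) by simp
    qed
  qed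
qed

end

section \<open>The random walk\<close>

definition step_shift :: "nat \<Rightarrow> (nat \<Rightarrow> 'b) \<Rightarrow> nat \<Rightarrow> 'b" where
  "step_shift k \<omega> = (\<lambda>i. \<omega> (i + k))"

lemma step_shift_funpow: "step_shift k ^^ n = step_shift (n * k)"
  by (induction n) (auto simp: step_shift_def fun_eq_iff ac_simps)

text \<open>An invariant event depends, for every n, only on the coordinates from n on, so it is a
  tail event. General k is wanted for averaging over blocks, since powers of an ergodic map need not
  be ergodic.\<close>

lemma ergodic_step_shift:
  fixes \<mu> :: "'b measure"
  assumes "prob_space \<mu>" and k: "0 < k"
  shows "ergodic_map (step_space \<mu>) (step_shift k)"
proof -
  interpret \<mu>: prob_space \<mu> by fact
  interpret S: product_prob_space "\<lambda>_. \<mu>" "UNIV :: nat set" ..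
  let ?S = "step_space \<mu>"
  interpret prob_space ?S unfolding step_space_def by (rule prob_space_PiM) (rule assms)
  have comp: "(\<lambda>\<omega>. \<omega> i) \<in> measurable ?S \<mu>" for i :: nat
    unfolding step_space_def by simp
  have meas: "step_shift j \<in> measurable ?S ?S" for j
    unfolding step_shift_def step_space_def
    by (rule measurable_abs_UNIV) simp
  have pres: "distr ?S ?S (step_shift j) = ?S" for j
    using distr_PiM_reindex[of "UNIV :: nat set" "\<lambda>_. \<mu>" "\<lambda>i. i + j" UNIV] \<mu>.prob_space_axioms
    by (simp add: step_space_def step_shift_def[abs_def] inj_on_def restrict_UNIV)
  show ?thesis
  proof (unfold_locales)
    show "step_shift k \<in> measurable ?S ?S" "distr ?S ?S (step_shift k) = ?S" by (fact meas pres)+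
    fix E assume E: "E \<in> sets ?S" and inv: "\<And>\<omega>. \<omega> \<in> space ?S \<Longrightarrow> step_shift k \<omega> \<in> E \<longleftrightarrow> \<omega> \<in> E"
    define A where "A i = {(\<lambda>\<omega>. \<omega> i) -` B \<inter> space ?S | B. B \<in> sets \<mu>}" for i :: nat
    have A_vimage: "A i = sets (vimage_algebra (space ?S) (\<lambda>\<omega>. \<omega> i) \<mu>)" for i
      unfolding A_def using comp by (intro sets_vimage_algebra2[symmetric]) (auto dest: measurable_space)
    have A_sub: "A i \<subseteq> Pow (space ?S)" for i unfolding A_def by auto
    have "indep_vars (\<lambda>_. \<mu>) (\<lambda>i \<omega>. \<omega> i) (UNIV :: nat set)"
      by (subst indep_vars_iff_distr_eq_PiM') 
        (auto simp: comp step_space_def S.PiM_component restrict_UNIV distr_id[unfolded id_def])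
    then have indep: "indep_sets A UNIV" unfolding indep_vars_def2 A_def by simp
    have shift_inv: "step_shift (n * k) \<omega> \<in> E \<longleftrightarrow> \<omega> \<in> E" if "\<omega> \<in> space ?S" for n \<omega>
    proof (induction n)
      case 0
      show ?case by (simp add: step_shift_def)
    next
      case (Suc n)
      have "step_shift (n * k) \<omega> \<in> space ?S" using meas that by (rule measurable_space)
      moreover have "step_shift (Suc n * k) \<omega> = step_shift k (step_shift (n * k) \<omega>)"
        by (simp add: step_shift_def ac_simps)
      ultimately show ?case using inv Suc by simp
    qed
    have "E \<in> sigma_sets (space ?S) (\<Union> (A ` {n..}))" for n
    proof -
      define N where "N = sigma (space ?S) (\<Union> (A ` {n..}))"
      have sub: "\<Union> (A ` {n..}) \<subseteq> Pow (space ?S)" using A_sub by blast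
      have spN: "space N = space ?S" unfolding N_def by (rule space_measure_of[OF sub])
      have setsN: "sets N = sigma_sets (space ?S) (\<Union> (A ` {n..}))" unfolding N_def by (rule sets_measure_of[OF sub])
      have "step_shift (n * k) \<in> measurable N (\<Pi>\<^sub>M i\<in>UNIV. \<mu>)"
        unfolding step_shift_def
      proof (rule measurable_abs_UNIV, rule measurableI)
        fix i :: nat and \<omega> assume "\<omega> \<in> space N"
        then show "\<omega> (i + n * k) \<in> space \<mu>" using comp by (auto simp: spN dest: measurable_space)
      next
        fix i :: nat and B assume "B \<in> sets \<mu>"
        then have "(\<lambda>\<omega>. \<omega> (i + n * k)) -` B \<inter> space N \<in> A (i + n * k)" by (auto simp: A_def spN)
        moreover have "n \<le> i + n * k" using k by (metis One_nat_def Suc_leI mult.right_neutral mult_le_mono2 trans_le_add2)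
        ultimately show "(\<lambda>\<omega>. \<omega> (i + n * k)) -` B \<inter> space N \<in> sets N"
          unfolding setsN by (auto intro!: sigma_sets.Basic)
      qed
      then have "step_shift (n * k) -` E \<inter> space N \<in> sets N"
        using E unfolding step_space_def by (rule measurable_sets)
      moreover have "step_shift (n * k) -` E \<inter> space N = E"
        using shift_inv[of _ n] sets.sets_into_space[OF E] by (auto simp: spN)
      ultimately show ?thesis by (simp add: setsN)
    qed
    then have "E \<in> tail_events A" by (simp add: tail_events_def)
    moreover have "sigma_algebra (space ?S) (A i)" for i
      unfolding A_vimage using sets.sigma_algebra_axioms[of "vimage_algebra (space ?S) (\<lambda>\<omega>. \<omega> i) \<mu>"] by simp
    ultimately show "prob E = 0 \<or> prob E = 1"
      using kolmogorov_0_1_law[of A E] indep by blast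
  qed
qed

lemma walk_add: "walk \<omega> (n + m) = walk \<omega> n \<circ> walk (step_shift n \<omega>) m"
  by (induction m) (simp_all add: step_shift_def comp_assoc add.commute)

section \<open>Displacement of the walk and its rate\<close>

locale isometric_walk =
  fixes G :: "('a::metric_space \<Rightarrow> 'a) set" and \<mu> :: "('a \<Rightarrow> 'a) measure" and x0 :: 'a
  assumes G_group: "subgroup G isom_group" and G_countable: "countable G"
    and mu_prob: "prob_space \<mu>" and mu_on_G: "sets \<mu> = Pow G"
begin

sublocale mu: prob_space \<mu> by (rule mu_prob)

lemma space_mu: "space \<mu> = G"
  using sets_eq_imp_space_eq[of \<mu> "count_space G"] mu_on_G by simp

lemma G_isometry: "g \<in> G \<Longrightarrow> isometry g"
  using subgroup.subset[OF G_group] by blast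

lemma step_space_G: "\<omega> \<in> space (step_space \<mu>) \<Longrightarrow> \<omega> i \<in> G"
  by (auto simp: step_space_def space_PiM space_mu)

lemma walk_isometry: "\<omega> \<in> space (step_space \<mu>) \<Longrightarrow> isometry (walk \<omega> n)"
  by (induction n) (auto simp: G_isometry step_space_G)

sublocale E: ergodic_map "step_space \<mu>" "step_shift 1"
  by (rule ergodic_step_shift[OF mu_prob]) simp

text \<open>The walk takes values in \<open>G\<close> with all subsets measurable, so composition
  with any F is measurable.\<close>

lemma walk_comp_measurable: "(\<lambda>\<omega>. F (walk \<omega> n)) \<in> measurable (step_space \<mu>) N"
  if "\<And>g. F g \<in> space N"
  using walk_measurable[OF G_group G_countable mu_on_G, of n]
  by (rule measurable_compose) (auto simp: that)

definition displacement :: "nat \<Rightarrow> (nat \<Rightarrow> 'a \<Rightarrow> 'a) \<Rightarrow> real" where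
  "displacement n \<omega> = dist x0 (walk \<omega> n x0)"

lemma displacement_measurable [measurable]: "displacement n \<in> borel_measurable (step_space \<mu>)"
  unfolding displacement_def[abs_def] by (rule walk_comp_measurable) simp

lemma displacement_nonneg [simp]: "0 \<le> displacement n \<omega>" and displacement_0 [simp]: "displacement 0 \<omega> = 0"
  by (simp_all add: displacement_def)

lemma displacement_shift_dist:
  assumes "\<omega> \<in> space (step_space \<mu>)"
  shows "displacement m (step_shift n \<omega>) = dist (walk \<omega> n x0) (walk \<omega> (n + m) x0)"
  using walk_isometry[OF assms, of n] by (simp add: displacement_def walk_add)

lemma displacement_subadditive:
  assumes "\<omega> \<in> space (step_space \<mu>)"
  shows "displacement (n + m) \<omega> \<le> displacement n \<omega> + displacement m (step_shift n \<omega>)"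
  unfolding displacement_shift_dist[OF assms] unfolding displacement_def by (rule dist_triangle)

lemma liminf_displacement_constant:
  "\<exists>L. AE \<omega> in step_space \<mu>. liminf (\<lambda>n. ereal (displacement n \<omega> / real n)) = L"
proof (rule E.invariant_AE_constant)
  fix \<omega> assume \<omega>: "\<omega> \<in> space (step_space \<mu>)"
  have "\<bar>displacement (Suc n) \<omega> - displacement n (step_shift 1 \<omega>)\<bar> \<le> displacement 1 \<omega>" for n
    unfolding displacement_shift_dist[OF \<omega>] unfolding displacement_def
    using dist_triangle[of x0 "walk \<omega> (Suc n) x0" "walk \<omega> 1 x0"]
      dist_triangle[of "walk \<omega> 1 x0" "walk \<omega> (Suc n) x0" x0]
    by (simp add: dist_commute abs_le_iff)
  then show "liminf (\<lambda>n. ereal (displacement n (step_shift 1 \<omega>) / real n))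
      = liminf (\<lambda>n. ereal (displacement n \<omega> / real n))"
    by (intro liminf_limsup_average_shift(1)[symmetric])
qed measurable

lemma step_shift_1_funpow: "step_shift 1 ^^ n = step_shift n"
  by (simp add: step_shift_funpow)

lemma birkhoff_sum_step_shift: "E.birkhoff_sum f n \<omega> = (\<Sum>i<n. f (step_shift i \<omega>))"
  unfolding E.birkhoff_sum_def step_shift_1_funpow ..

lemma displacement_le_birkhoff_sum:
  "\<omega> \<in> space (step_space \<mu>) \<Longrightarrow> displacement n \<omega> \<le> E.birkhoff_sum (displacement 1) n \<omega>"
  unfolding birkhoff_sum_step_shift
proof (induction n)
  case (Suc n)
  then show ?case using displacement_subadditive[of \<omega> n 1] by simp
qed simp

lemma displacement_le_blocks:
  assumes \<omega>: "\<omega> \<in> space (step_space \<mu>)"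
  shows "displacement (q * m) \<omega> \<le> (\<Sum>i<q. displacement m (step_shift (i * m) \<omega>))"
proof (induction q)
  case (Suc q)
  then show ?case using displacement_subadditive[OF \<omega>, of "q * m" m] by (simp add: add.commute)
qed simp

text \<open>The liminf provides times with displacement at most n (l + \<epsilon>); the covering
  bound yields one m with expected displacement at most m (l + 2\<epsilon>). Over blocks of length
  m, Birkhoff averages cost a third \<epsilon> and the incomplete last block a fourth.\<close>

lemma displacement_eventually_le:
  assumes int1: "integrable (step_space \<mu>) (displacement 1)"
    and l: "0 \<le> l" "AE \<omega> in step_space \<mu>. liminf (\<lambda>n. ereal (displacement n \<omega> / real n)) = ereal l"
    and \<epsilon>: "0 < \<epsilon>"
  shows "AE \<omega> in step_space \<mu>. \<forall>\<^sub>F n in sequentially. displacement n \<omega> \<le> real n * (l + 4 * \<epsilon>)"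
proof -
  have int: "integrable (step_space \<mu>) (displacement n)" for n
    using E.integrable_birkhoff_sum[OF int1, of n]
    by (rule Bochner_Integration.integrable_bound)
      (use displacement_le_birkhoff_sum in \<open>auto intro!: AE_I2 intro: order_trans[OF _ abs_ge_self]\<close>)
  have ae: "AE \<omega> in step_space \<mu>. \<exists>n>0. displacement n \<omega> - real n * (l + \<epsilon>) \<le> 0"
    using l(2)
  proof eventually_elim
    case (elim \<omega>)
    show ?case
    proof (rule ccontr)
      assume "\<not> ?thesis"
      then have "\<forall>\<^sub>F n in sequentially. ereal (l + \<epsilon>) \<le> ereal (displacement n \<omega> / real n)"
        by (intro eventually_mono[OF eventually_gt_at_top[of 0]])
          (auto simp: le_divide_eq mult.commute not_le, metis less_imp_le not_gr_zero)
      then have "ereal (l + \<epsilon>) \<le> ereal l" unfolding elim[symmetric] by (rule Liminf_bounded)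
      with \<epsilon> show False by simp
    qed
  qed
  have "\<exists>m>0. E.expectation (\<lambda>\<omega>. displacement m \<omega> - real m * (l + \<epsilon>)) \<le> real m * \<epsilon>"
  proof (rule E.subadditive_expectation_le[where b = "displacement 1"])
    show "displacement (n + m) \<omega> - real (n + m) * (l + \<epsilon>) \<le> displacement n \<omega> - real n * (l + \<epsilon>) +
        (displacement m ((step_shift 1 ^^ n) \<omega>) - real m * (l + \<epsilon>))"
      if "\<omega> \<in> space (step_space \<mu>)" for n m \<omega>
      using displacement_subadditive[OF that, of n m] unfolding step_shift_1_funpow
      by (simp add: algebra_simps)
    show "displacement 1 \<omega> - real 1 * (l + \<epsilon>) \<le> displacement 1 \<omega>" for \<omega> using l(1) \<epsilon> by simp
  qed (use ae int \<epsilon> in auto)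
  then obtain m where m: "0 < m"
    "E.expectation (\<lambda>\<omega>. displacement m \<omega> - real m * (l + \<epsilon>)) \<le> real m * \<epsilon>" by blast
  have "E.expectation (\<lambda>\<omega>. displacement m \<omega> - real m * (l + \<epsilon>)) = E.expectation (displacement m) - real m * (l + \<epsilon>)"
    using int by (subst Bochner_Integration.integral_diff) (auto simp: E.prob_space)
  then have Em: "E.expectation (displacement m) \<le> real m * (l + 2 * \<epsilon>)"
    using m(2) by (simp add: algebra_simps)
  interpret B: ergodic_map "step_space \<mu>" "step_shift m"
    by (rule ergodic_step_shift[OF mu_prob m(1)])
  \<comment> \<open>W dominates the displacement over an incomplete block of any length; being
    integrable, it is o(q) at the q-th block.\<close>
  define W where "W = E.birkhoff_sum (displacement 1) m"
  have W_int: "integrable (step_space \<mu>) W"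
    unfolding W_def by (rule E.integrable_birkhoff_sum[OF int1])
  have W0: "0 \<le> W \<omega>" for \<omega> unfolding W_def birkhoff_sum_step_shift by (intro sum_nonneg) simp
  have "AE \<omega> in step_space \<mu>. \<forall>\<^sub>F q in sequentially.
      B.birkhoff_sum (displacement m) q \<omega> \<le> real q * (E.expectation (displacement m) + \<epsilon>)"
    by (rule B.birkhoff_sum_eventually_le[OF int _ \<epsilon>]) simp
  moreover have "AE \<omega> in step_space \<mu>. \<forall>\<^sub>F q in sequentially. W ((step_shift m ^^ q) \<omega>) \<le> real q * \<epsilon>"
    by (rule B.orbit_eventually_small[OF W_int W0 \<epsilon>])
  ultimately show ?thesis
    using AE_space
  proof eventually_elim
    case (elim \<omega>)
    have "\<forall>\<^sub>F q in sequentially. B.birkhoff_sum (displacement m) q \<omega> \<le> real q * (E.expectation (displacement m) + \<epsilon>)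
        \<and> W ((step_shift m ^^ q) \<omega>) \<le> real q * \<epsilon>"
      using elim(1,2) by (rule eventually_conj)
    then obtain Q where Q: "\<And>q. Q \<le> q \<Longrightarrow> B.birkhoff_sum (displacement m) q \<omega> \<le> real q * (E.expectation (displacement m) + \<epsilon>)"
        "\<And>q. Q \<le> q \<Longrightarrow> W ((step_shift m ^^ q) \<omega>) \<le> real q * \<epsilon>"
      by (auto simp: eventually_sequentially)
    show ?case
      unfolding eventually_sequentially
    proof (intro exI[of _ "Q * m"] allI impI)
      fix n assume n: "Q * m \<le> n"
      define q r where "q = n div m" and "r = n mod m"
      have qr: "n = q * m + r" "r \<le> m" using m(1) by (simp_all add: q_def r_def less_imp_le)
      have "Q \<le> q" unfolding q_def using n m(1) by (simp add: less_eq_div_iff_mult_less_eq)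
      have sp: "step_shift (q * m) \<omega> \<in> space (step_space \<mu>)"
        using B.funpow_space[OF elim(3), of q] by (simp add: step_shift_funpow)
      have "displacement n \<omega> \<le> displacement (q * m) \<omega> + displacement r (step_shift (q * m) \<omega>)"
        unfolding qr(1) by (rule displacement_subadditive[OF elim(3)])
      also have "displacement (q * m) \<omega> \<le> B.birkhoff_sum (displacement m) q \<omega>"
        using displacement_le_blocks[OF elim(3)] by (simp add: B.birkhoff_sum_def step_shift_funpow)
      also have "displacement r (step_shift (q * m) \<omega>) \<le> E.birkhoff_sum (displacement 1) r (step_shift (q * m) \<omega>)"
        by (rule displacement_le_birkhoff_sum[OF sp])
      also have "\<dots> \<le> W (step_shift (q * m) \<omega>)"
        unfolding W_def birkhoff_sum_step_shift using qr(2) by (intro sum_mono2) auto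
      also have "\<dots> \<le> real q * \<epsilon>" using Q(2)[OF \<open>Q \<le> q\<close>] by (simp add: step_shift_funpow)
      also have "B.birkhoff_sum (displacement m) q \<omega> \<le> real q * (E.expectation (displacement m) + \<epsilon>)"
        by (rule Q(1)[OF \<open>Q \<le> q\<close>])
      also have "\<dots> \<le> real q * (real m * (l + 2 * \<epsilon>) + \<epsilon>)" using Em by (intro mult_left_mono) auto
      finally have "displacement n \<omega> \<le> real (q * m) * (l + 2 * \<epsilon>) + real q * (2 * \<epsilon>)"
        by (simp add: algebra_simps)
      also have "\<dots> \<le> real n * (l + 2 * \<epsilon>) + real n * (2 * \<epsilon>)"
      proof (intro add_mono mult_right_mono)
        show "real (q * m) \<le> real n" unfolding of_nat_le_iff using qr(1) by simp
        show "real q \<le> real n" by (simp add: q_def)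
      qed (use l(1) \<epsilon> in auto)
      finally show "displacement n \<omega> \<le> real n * (l + 4 * \<epsilon>)" by (simp add: algebra_simps)
    qed
  qed
qed

text \<open>Birkhoff sums of \<open>displacement 1\<close> keep L finite; the upper bounds for
  \<epsilon> = 1/(k+1) then push the limsup down to the liminf.\<close>

lemma displacement_converges:
  assumes int1: "integrable (step_space \<mu>) (displacement 1)"
    and L: "AE \<omega> in step_space \<mu>. liminf (\<lambda>n. ereal (displacement n \<omega> / real n)) = L"
  shows "\<exists>l. L = ereal l \<and> (AE \<omega> in step_space \<mu>. (\<lambda>n. displacement n \<omega> / real n) \<longlonglongrightarrow> l)"
proof -
  define e where "e = E.expectation (displacement 1) + 1"
  have "AE \<omega> in step_space \<mu>. \<forall>\<^sub>F n in sequentially. E.birkhoff_sum (displacement 1) n \<omega> \<le> real n * e"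
    unfolding e_def by (rule E.birkhoff_sum_eventually_le[OF int1]) auto
  with L have "AE \<omega> in step_space \<mu>. L \<le> ereal e \<and> 0 \<le> L"
    using AE_space
  proof eventually_elim
    case (elim \<omega>)
    have "\<forall>\<^sub>F n in sequentially. ereal (displacement n \<omega> / real n) \<le> ereal e"
      using elim(2) eventually_gt_at_top[of 0]
    proof eventually_elim
      case (elim n)
      then show ?case using displacement_le_birkhoff_sum[OF \<open>\<omega> \<in> _\<close>, of n]
        by (simp add: divide_le_eq mult.commute)
    qed
    then have "limsup (\<lambda>n. ereal (displacement n \<omega> / real n)) \<le> ereal e" by (rule Limsup_bounded)
    then have "L \<le> ereal e"
      using Liminf_le_Limsup[OF sequentially_bot, of "\<lambda>n. ereal (displacement n \<omega> / real n)"] elim(1) by simp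
    moreover have "0 \<le> L" unfolding elim(1)[symmetric] by (intro Liminf_bounded always_eventually) simp
    ultimately show ?case by simp
  qed
  then have "L \<le> ereal e" "0 \<le> L" by simp_all
  then obtain l where l: "L = ereal l" "0 \<le> l" by (cases L) auto
  have "AE \<omega> in step_space \<mu>. \<forall>k. \<forall>\<^sub>F n in sequentially.
      displacement n \<omega> \<le> real n * (l + 4 * (1 / real (Suc k)))"
    unfolding AE_all_countable
    using L l by (intro allI displacement_eventually_le int1) auto
  with L have "AE \<omega> in step_space \<mu>. (\<lambda>n. displacement n \<omega> / real n) \<longlonglongrightarrow> l"
  proof eventually_elim
    case (elim \<omega>)
    show ?case
    proof (rule order_tendstoI)
      fix a assume "a < l"
      then have "ereal a < liminf (\<lambda>n. ereal (displacement n \<omega> / real n))" using elim(1) l(1) by simp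
      from less_LiminfD[OF this] show "\<forall>\<^sub>F n in sequentially. a < displacement n \<omega> / real n" by simp
    next
      fix a assume "l < a"
      then obtain k where "1 / real (Suc k) < (a - l) / 4"
        using reals_Archimedean[of "(a - l) / 4"] by (auto simp: inverse_eq_divide)
      then have k: "1 / real (Suc k) * 4 < a - l" by (subst (asm) pos_less_divide_eq) simp_all
      show "\<forall>\<^sub>F n in sequentially. displacement n \<omega> / real n < a"
        using elim(2)[rule_format, of k] eventually_gt_at_top[of 0]
      proof eventually_elim
        case (elim n)
        have "displacement n \<omega> / real n \<le> l + 4 * (1 / real (Suc k))"
          using elim by (simp only: pos_divide_le_eq of_nat_0_less_iff mult.commute)
        also have "\<dots> < a" using k by (simp only: mult.commute less_diff_eq add.commute)
        finally show ?case .
      qed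
    qed
  qed
  with l show ?thesis by blast
qed

section \<open>Exponential decay for the law of the walk\<close>

text \<open>\<mu> lives on subsets of \<open>G\<close>, a pmf on the whole type. Pushing forward
  along the identity bridges this, and countability of \<open>G\<close> makes the image
  discrete.\<close>

lemma step_pmf_exists:
  obtains P where "\<And>f. (\<integral>\<^sup>+g. f g \<partial>\<mu>) = (\<integral>\<^sup>+g. f g \<partial>measure_pmf P)" "set_pmf P = measure_support \<mu>"
proof -
  define M where "M = distr \<mu> (count_space UNIV) id"
  have id: "id \<in> measurable \<mu> (count_space UNIV)"
    using mu_on_G by (auto simp: measurable_def space_mu)
  interpret M: prob_space M unfolding M_def by (rule mu.prob_space_distr[OF id])
  have sM: "sets M = UNIV" by (simp add: M_def)
  have "AE g in M. g \<in> G"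
    unfolding M_def by (subst AE_distr_iff[OF id]) (auto simp: space_mu intro!: AE_I2)
  then have "AE g in M. measure M {g} \<noteq> 0"
    using M.AE_support_countable[OF sM] G_countable by blast
  then have P: "measure_pmf (Abs_pmf M) = M"
    using M.prob_space_axioms sM by (intro Abs_pmf_inverse) simp
  have m: "measure M {g} = measure \<mu> ({g} \<inter> G)" for g
    unfolding M_def by (subst measure_distr[OF id]) (simp_all add: space_mu Int_def)
  show thesis
  proof (rule that[of "Abs_pmf M"])
    show "(\<integral>\<^sup>+g. f g \<partial>\<mu>) = (\<integral>\<^sup>+g. f g \<partial>measure_pmf (Abs_pmf M))" for f
      unfolding P unfolding M_def by (subst nn_integral_distr[OF id]) auto
    show "set_pmf (Abs_pmf M) = measure_support \<mu>"
    proof (rule Set.set_eqI)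
      fix g
      show "g \<in> set_pmf (Abs_pmf M) \<longleftrightarrow> g \<in> measure_support \<mu>"
        unfolding set_pmf.rep_eq P m measure_support_def space_mu
        by (cases "g \<in> G") (simp_all add: zero_less_measure_iff)
    qed
  qed
qed

text \<open>\<open>walk\<close> appends increments on the right while \<open>walk_expect\<close>
  splits off the first one; writing the sequence as \<open>case_nat s \<omega>\<close> reconciles
  the two.\<close>

lemma nn_integral_walk:
  assumes P: "\<And>f. (\<integral>\<^sup>+g. f g \<partial>\<mu>) = (\<integral>\<^sup>+g. f g \<partial>measure_pmf P)"
  shows "(\<integral>\<^sup>+\<omega>. \<Phi> (u \<circ> walk \<omega> n) \<partial>step_space \<mu>) = walk_expect P \<Phi> n u"
proof (induction n arbitrary: u)
  case 0
  show ?case by (simp add: E.emeasure_space_1)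
next
  case (Suc n)
  interpret S: product_prob_space "\<lambda>_. \<mu>" "UNIV :: nat set" ..
  interpret S: sequence_space \<mu> ..
  have step: "walk (case_nat s \<omega>) (Suc n) = s \<circ> walk \<omega> n" for s \<omega>
  proof -
    have "step_shift 1 (case_nat s \<omega>) = \<omega>" by (simp add: step_shift_def)
    then show ?thesis using walk_add[of "case_nat s \<omega>" 1 n] by simp
  qed
  have meas: "(\<lambda>\<omega>. \<Phi> (u \<circ> walk \<omega> n)) \<in> borel_measurable (step_space \<mu>)" for u n
    by (rule walk_comp_measurable) simp
  have c: "(\<lambda>(s, \<omega>). case_nat s \<omega>) \<in> measurable (\<mu> \<Otimes>\<^sub>M step_space \<mu>) (step_space \<mu>)"
    unfolding step_space_def by measurable
  have "(\<integral>\<^sup>+\<omega>. \<Phi> (u \<circ> walk \<omega> (Suc n)) \<partial>step_space \<mu>) =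
      (\<integral>\<^sup>+\<omega>. \<Phi> (u \<circ> walk \<omega> (Suc n)) \<partial>distr (\<mu> \<Otimes>\<^sub>M step_space \<mu>) (step_space \<mu>) (\<lambda>(s, \<omega>). case_nat s \<omega>))"
    using S.PiM_iter by (simp only: step_space_def)
  also have "\<dots> = (\<integral>\<^sup>+z. \<Phi> (u \<circ> walk (case z of (s, \<omega>) \<Rightarrow> case_nat s \<omega>) (Suc n)) \<partial>(\<mu> \<Otimes>\<^sub>M step_space \<mu>))"
    by (rule nn_integral_distr[OF c]) (simp only: measurable_distr_eq1 meas)
  also have "\<dots> = (\<integral>\<^sup>+s. \<integral>\<^sup>+\<omega>. \<Phi> (u \<circ> walk (case (s, \<omega>) of (s, \<omega>) \<Rightarrow> case_nat s \<omega>) (Suc n)) \<partial>step_space \<mu> \<partial>\<mu>)"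
    by (rule E.nn_integral_fst[symmetric]) (rule measurable_compose[OF c meas])
  also have "\<dots> = (\<integral>\<^sup>+s. \<integral>\<^sup>+\<omega>. \<Phi> ((u \<circ> s) \<circ> walk \<omega> n) \<partial>step_space \<mu> \<partial>\<mu>)"
    by (simp only: split_conv step comp_assoc)
  also have "\<dots> = walk_expect P \<Phi> (Suc n) u"
    by (simp only: Suc P walk_expect.simps)
  finally show ?case .
qed

lemma semigroup_generated_walk_pmf:
  assumes "set_pmf P = measure_support \<mu>" "g \<in> semigroup_generated (measure_support \<mu>)"
  shows "\<exists>m>0. g \<in> set_pmf (walk_pmf P m)"
  using assms(2)
proof induction
  case (base g)
  then have "g \<in> set_pmf (walk_pmf P 1)" using assms(1) by (auto intro!: bexI[of _ g])
  then show ?case by blast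
next
  case (mult g h)
  then show ?case using set_walk_pmf_mult by (metis add_gr_0)
qed

text \<open>The decay of the expectation of 2^-d gives the tail bound by Markov's
  inequality.\<close>

lemma exponential_decay:
  assumes hyp: "gromov_hyperbolic TYPE('a)" and ne: "non_elementary_measure x0 G \<mu>"
  shows "\<exists>L K c. 0 < L \<and> 0 < c \<and> c < 1 \<and>
    (\<forall>n. \<P>(\<omega> in step_space \<mu>. displacement n \<omega> \<le> L * real n) \<le> K * c ^ n)"
proof -
  obtain \<delta> where "four_point \<delta> TYPE('a)" using gromov_hyperbolic_four_point[OF hyp] by blast
  then interpret hyperbolic \<delta> x0 by unfold_locales
  obtain P where P: "\<And>f. (\<integral>\<^sup>+g. f g \<partial>\<mu>) = (\<integral>\<^sup>+g. f g \<partial>measure_pmf P)" "set_pmf P = measure_support \<mu>"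
    using step_pmf_exists by blast
  have P_iso: "isometry g" if "g \<in> set_pmf P" for g
    using that by (auto simp: P(2) measure_support_def space_mu G_isometry)
  obtain g h where gh: "g \<in> semigroup_generated (measure_support \<mu>)" "h \<in> semigroup_generated (measure_support \<mu>)"
      "loxodromic x0 g" "loxodromic x0 h" "boundary_fixed_points x0 g \<inter> boundary_fixed_points x0 h = {}"
    using ne unfolding non_elementary_measure_def non_elementary_def by blast
  obtain m l where "0 < m" "g \<in> set_pmf (walk_pmf P m)" "h \<in> set_pmf (walk_pmf P l)"
    using semigroup_generated_walk_pmf[OF P(2)] gh(1,2) by blast
  from schottky_in_walk[OF this(2) gh(3) this(3) gh(4) this(1) gh(5)]
  obtain S C D N where S: "0 < N" "schottky \<delta> x0 S C D" "\<forall>s\<in>S. \<forall>t\<in>S. s \<circ> t \<in> set_pmf (walk_pmf P N)"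
    by blast
  interpret S: schottky \<delta> x0 S C D by fact
  obtain K c where c: "0 < c" "c < 1" and decay: "\<And>n u. isometry u \<Longrightarrow>
      walk_expect P (\<lambda>u. ennreal (2 powr - dist x0 (u x0))) n u \<le> ennreal (K * c ^ n)"
    using S.walk_expect_decay[OF P_iso _ S(1)] S(3) by blast
  define c' where "c' = (1 + c) / 2"
  have c': "c < c'" "c' < 1" "0 < c'" using c by (simp_all add: c'_def)
  \<comment> \<open>Then 2^L c = c', so the factor 2^(Ln) from Markov's inequality still leaves a
    rate below 1.\<close>
  define L where "L = log 2 (c' / c)"
  have L: "0 < L" "2 powr L = c' / c" using c c' by (simp_all add: L_def)
  \<comment> \<open>\<open>ennreal\<close> sends negative numbers to 0, whereas the expectation at
    time 0 is positive.\<close>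
  have K: "0 \<le> K"
  proof (rule ccontr)
    assume "\<not> 0 \<le> K"
    then have "walk_expect P (\<lambda>u. ennreal (2 powr - dist x0 (u x0))) 0 id \<le> 0"
      using decay[OF isometry_id, of 0] by (simp add: ennreal_neg)
    then show False by simp
  qed
  have "\<P>(\<omega> in step_space \<mu>. displacement n \<omega> \<le> L * real n) \<le> K * c' ^ n" for n
  proof -
    define A where "A = {\<omega>\<in>space (step_space \<mu>). displacement n \<omega> \<le> L * real n}"
    have A: "A \<in> sets (step_space \<mu>)" unfolding A_def by measurable
    have "ennreal (E.prob A) = (\<integral>\<^sup>+\<omega>. indicator A \<omega> \<partial>step_space \<mu>)"
      using A by (simp add: E.emeasure_eq_measure)
    also have "\<dots> \<le> (\<integral>\<^sup>+\<omega>. ennreal (2 powr (L * real n)) * ennreal (2 powr - displacement n \<omega>) \<partial>step_space \<mu>)"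
      by (intro nn_integral_mono)
        (auto simp: A_def indicator_def ennreal_mult[symmetric] powr_add[symmetric] simp flip: ennreal_1 intro!: ge_one_powr_ge_zero)
    also have "\<dots> = ennreal (2 powr (L * real n)) * (\<integral>\<^sup>+\<omega>. ennreal (2 powr - displacement n \<omega>) \<partial>step_space \<mu>)"
      by (intro nn_integral_cmult) measurable
    also have "(\<integral>\<^sup>+\<omega>. ennreal (2 powr - displacement n \<omega>) \<partial>step_space \<mu>) \<le> ennreal (K * c ^ n)"
      using nn_integral_walk[OF P(1), of "\<lambda>u. ennreal (2 powr - dist x0 (u x0))" id n] decay[OF isometry_id, of n]
      by (simp add: displacement_def)
    also have "ennreal (2 powr (L * real n)) * ennreal (K * c ^ n) = ennreal (2 powr (L * real n) * (K * c ^ n))"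
      using K c by (simp add: ennreal_mult)
    also have "2 powr (L * real n) * (K * c ^ n) = K * c' ^ n"
    proof -
      have "2 powr (L * real n) = (c' / c) ^ n"
        using c c' by (simp add: powr_powr[symmetric] L(2) powr_realpow)
      then show ?thesis using c by (simp add: power_divide)
    qed
    finally have "ennreal (E.prob A) \<le> ennreal (K * c' ^ n)" by (simp add: mult_left_mono)
    then have "E.prob A \<le> K * c' ^ n" using K c' by (subst (asm) ennreal_le_iff) auto
    then show ?thesis by (simp add: A_def)
  qed
  then show ?thesis using L(1) c' by blast
qed

lemma liminf_displacement_positive:
  assumes L: "0 < L" and c: "0 < c" "c < 1"
    and decay: "\<And>n. \<P>(\<omega> in step_space \<mu>. displacement n \<omega> \<le> L * real n) \<le> K * c ^ n"
  shows "AE \<omega> in step_space \<mu>. ereal L \<le> liminf (\<lambda>n. ereal (displacement n \<omega> / real n))"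
proof -
  define A where "A n = {\<omega>\<in>space (step_space \<mu>). displacement n \<omega> \<le> L * real n}" for n
  have A: "A n \<in> sets (step_space \<mu>)" for n unfolding A_def by measurable
  have "summable (\<lambda>n. E.prob (A n))"
  proof (rule summable_comparison_test')
    show "summable (\<lambda>n. K * c ^ n)" using c by (intro summable_mult summable_geometric) simp
    show "norm (E.prob (A n)) \<le> K * c ^ n" for n using decay[of n] by (simp add: A_def)
  qed
  then have "AE \<omega> in step_space \<mu>. \<forall>\<^sub>F n in sequentially. \<omega> \<in> space (step_space \<mu>) - A n"
    using A by (intro borel_cantelli_AE1) (auto simp: E.emeasure_eq_measure)
  then show ?thesis
  proof eventually_elim
    case (elim \<omega>)
    then have "\<forall>\<^sub>F n in sequentially. ereal L \<le> ereal (displacement n \<omega> / real n)"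
      using eventually_gt_at_top[of 0]
      by eventually_elim (auto simp: A_def le_divide_eq mult.commute)
    then show ?case by (rule Liminf_bounded)
  qed
qed

lemma integrable_displacement_1:
  assumes "finite_first_moment x0 \<mu>"
  shows "integrable (step_space \<mu>) (displacement 1)"
proof (rule integrableI_nonneg)
  obtain P where P: "\<And>f. (\<integral>\<^sup>+g. f g \<partial>\<mu>) = (\<integral>\<^sup>+g. f g \<partial>measure_pmf P)"
    using step_pmf_exists by blast
  have "(\<integral>\<^sup>+\<omega>. ennreal (displacement 1 \<omega>) \<partial>step_space \<mu>) = (\<integral>\<^sup>+g. ennreal (dist x0 (g x0)) \<partial>\<mu>)"
    using nn_integral_walk[OF P, of "\<lambda>g. ennreal (dist x0 (g x0))" id 1]
    unfolding displacement_def P by simp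
  then show "(\<integral>\<^sup>+\<omega>. ennreal (displacement 1 \<omega>) \<partial>step_space \<mu>) < \<infinity>"
    using assms unfolding finite_first_moment_def by simp
qed auto

end

theorem theorem1p2:
  fixes G :: "('a::metric_space \<Rightarrow> 'a) set"
    and \<mu> :: "('a \<Rightarrow> 'a) measure"
    and x0 :: 'a
  assumes hyperbolic: "gromov_hyperbolic TYPE('a)"
    and separable: "separable_space (euclidean :: 'a topology)"
    and G_group: "subgroup G isom_group"
    and G_countable: "countable G"
    and mu_prob: "prob_space \<mu>"
    and mu_on_G: "sets \<mu> = Pow G"
    and mu_non_elementary: "non_elementary_measure x0 G \<mu>"
  shows "(\<exists>L::ereal. L > 0 \<and>
            (AE \<omega> in step_space \<mu>.
               liminf (\<lambda>n. ereal (dist x0 (walk \<omega> n x0) / real n)) = L) \<and>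
            (finite_first_moment x0 \<mu> \<longrightarrow>
               (\<exists>l::real. L = ereal l \<and>
                  (AE \<omega> in step_space \<mu>. (\<lambda>n. dist x0 (walk \<omega> n x0) / real n) \<longlonglongrightarrow> l)))) \<and>
         (bounded_support x0 \<mu> \<longrightarrow>
            (\<exists>c K L::real. c < 1 \<and> L > 0 \<and>
               (\<forall>n. \<P>(\<omega> in step_space \<mu>. dist x0 (walk \<omega> n x0) \<le> L * real n) \<le> K * c ^ n)))"
proof -
  interpret isometric_walk G \<mu> x0
    using G_group G_countable mu_prob mu_on_G by (rule isometric_walk.intro)
  obtain L0 K c where L0: "0 < L0" and c: "0 < c" "c < 1"
    and decay: "\<And>n. \<P>(\<omega> in step_space \<mu>. displacement n \<omega> \<le> L0 * real n) \<le> K * c ^ n"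
    using exponential_decay[OF hyperbolic mu_non_elementary] by blast
  \<comment> \<open>L is an extended real here; its finiteness under a first moment comes from
    \<open>displacement_converges\<close>.\<close>
  obtain L where L: "AE \<omega> in step_space \<mu>. liminf (\<lambda>n. ereal (displacement n \<omega> / real n)) = L"
    using liminf_displacement_constant by blast
  have "AE \<omega> in step_space \<mu>. ereal L0 \<le> L"
    using L liminf_displacement_positive[OF L0 c decay] by eventually_elim simp
  then have "ereal L0 \<le> L" by simp
  then have "0 < L" using L0 by (metis ereal_less(2) less_le_trans)
  moreover have "\<exists>l. L = ereal l \<and> (AE \<omega> in step_space \<mu>. (\<lambda>n. displacement n \<omega> / real n) \<longlonglongrightarrow> l)"
    if "finite_first_moment x0 \<mu>"
    by (rule displacement_converges[OF integrable_displacement_1[OF that] L])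
  ultimately show ?thesis
    using L L0 c decay unfolding displacement_def by blast
qed

end
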